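(* Suppose there is a $(c_{size}(\sigma),c_{con}(\sigma))$-approximate LBS cut algorithm with running time $t_{LSB}(n,\mathrm{vol}(A),\alpha,\sigma)$ when given $(G,A,\sigma,\alpha)$, where $G=(V,E)$ is an $n$-node graph, $A\subset V$, $\sigma$ is an overlapping parameter and $\alpha$ a conductance parameter. Then there is an algorithm which is given an $n$-node $m$-edge graph $G=(V,E)$ with maximum degree $\Delta$, a conductance parameter $\alpha_b$, a parameter $\epsilon\in(0,1)$, and a set of edges $D$ with $D\cap E=\emptyset$ and $|D|=O(\alpha_b^2m/\Delta)$; letting $G_b=(V,E\cup D)$, in time $\bar t=O\big((\frac{|D|}{\alpha_b})^{\epsilon}\cdot\frac{c_{size}(\alpha_b/2)}{\epsilon}\cdot t_{LSB}(n,\frac{\Delta|D|}{\alpha_b},\alpha_b,\alpha_b)\big)$ it either reports $\phi(G_b)<\alpha_b$ or outputs a set $P\subset V$ of pruning nodes; moreover, if $\phi(G_b)\ge\alpha_b$, then $\mathrm{vol}_G(P)\le 2|D|/\alpha_b$ and the pruned graph $H=G[V\setminus P]$ satisfies $\phi(H)\ge\frac{\alpha_b}{5\,c_{con}(\alpha_b/2)^{1/\epsilon-1}}$.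
   Context: For a graph $G=(V,E)$ and $S\subseteq V$: $\mathrm{vol}_G(S)=\sum_{v\in S}\deg_G(v)$, $\delta(S)$ is the number of edges crossing $S$, $\phi(S)=\delta(S)/\min\{\mathrm{vol}(S),\mathrm{vol}(V\setminus S)\}$, and $\phi(G)=\min_{\emptyset\ne S\subsetneq V}\phi(S)$. $S$ is $\alpha$-sparse if $\phi(S)<\alpha$, and $(A,\sigma)$-overlapping if $\mathrm{vol}(S\cap A)/\mathrm{vol}(S)\ge\sigma$. $\mathrm{OPT}(G,\alpha,A,\sigma)$ is the largest $\mathrm{vol}(S^* )$ over $\alpha$-sparse $(A,\sigma)$-overlapping sets $S^*$ with $\mathrm{vol}(S^* )\le\mathrm{vol}(V\setminus S^* )$, and $0$ if none exists. A $(c_{size},c_{con})$-approximate LBS cut algorithm, given $(G,A,\sigma,\alpha)$ with $A\subset V$, $0\le\sigma\le1$, $0\le\alpha\le1$, either outputs $S$ with $\mathrm{vol}(S)\le\mathrm{vol}(V\setminus S)$, $\phi(S)<\alpha$ and $c_{size}\mathrm{vol}(S)\ge\mathrm{OPT}(G,\alpha/c_{con},A,\sigma)$, or reports that $\mathrm{OPT}(G,\alpha/c_{con},A,\sigma)=0$. Here $c_{size}(\sigma),c_{con}(\sigma)$ denote approximation ratios depending on $\sigma$, and $c_{con}(\alpha_b/2)^{1/\epsilon-1}$ means $c_{con}(\alpha_b/2)$ raised to the power $1/\epsilon-1$. *)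

theory Defs
  imports Complex_Main "HOL-Library.Extended_Real" "HOL-Library.Disjoint_Sets"
begin

type_synonym 'a ugraph = "'a set \<times> 'a set set"

abbreviation verts :: "'a ugraph \<Rightarrow> 'a set" where "verts G \<equiv> fst G"
abbreviation edges :: "'a ugraph \<Rightarrow> 'a set set" where "edges G \<equiv> snd G"

definition simple_graph :: "'a ugraph \<Rightarrow> bool" where
  "simple_graph G \<longleftrightarrow> finite (verts G) \<and> (\<forall>e\<in>edges G. e \<subseteq> verts G \<and> card e = 2)"

definition neighbours :: "'a ugraph \<Rightarrow> 'a \<Rightarrow> 'a set" where
  "neighbours G v = {u. {v, u} \<in> edges G}"

definition degree :: "'a ugraph \<Rightarrow> 'a \<Rightarrow> nat" where
  "degree G v = card {e \<in> edges G. v \<in> e}"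

definition max_degree :: "'a ugraph \<Rightarrow> nat" where
  "max_degree G = Max (degree G ` verts G)"

definition vol :: "'a ugraph \<Rightarrow> 'a set \<Rightarrow> nat" where
  "vol G S = (\<Sum>v\<in>S. degree G v)"

definition cut_size :: "'a ugraph \<Rightarrow> 'a set \<Rightarrow> nat" where
  "cut_size G S = card {e \<in> edges G. e \<inter> S \<noteq> {} \<and> e - S \<noteq> {}}"

definition induced :: "'a ugraph \<Rightarrow> 'a set \<Rightarrow> 'a ugraph" where
  "induced G U = (U, {e \<in> edges G. e \<subseteq> U})"

definition is_cut :: "'a ugraph \<Rightarrow> 'a set \<Rightarrow> bool" where
  "is_cut G S \<longleftrightarrow> S \<noteq> {} \<and> S \<subset> verts G"

(* A cut with a side of volume 0 crosses no edge; since x / 0 = 0 its conductance is 0,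
   so that every disconnected graph, even one with isolated nodes, has conductance 0. *)
definition cut_conductance :: "'a ugraph \<Rightarrow> 'a set \<Rightarrow> real" where
  "cut_conductance G S = real (cut_size G S) / real (min (vol G S) (vol G (verts G - S)))"

(* Extended reals only because a graph with at most one node has no cut: there the value is \<infinity>. *)
definition conductance :: "'a ugraph \<Rightarrow> ereal" where
  "conductance G = (INF S\<in>{S. is_cut G S}. ereal (cut_conductance G S))"

definition sparse :: "'a ugraph \<Rightarrow> real \<Rightarrow> 'a set \<Rightarrow> bool" where
  "sparse G \<alpha> S \<longleftrightarrow> is_cut G S \<and> cut_conductance G S < \<alpha>"

definition overlapping :: "'a ugraph \<Rightarrow> 'a set \<Rightarrow> real \<Rightarrow> 'a set \<Rightarrow> bool" where
  "overlapping G A \<sigma> S \<longleftrightarrow> real (vol G (S \<inter> A)) / real (vol G S) \<ge> \<sigma>"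

definition OPT :: "'a ugraph \<Rightarrow> real \<Rightarrow> 'a set \<Rightarrow> real \<Rightarrow> nat" where
  "OPT G \<alpha> A \<sigma> = Max (insert 0
     {vol G S | S. sparse G \<alpha> S \<and> overlapping G A \<sigma> S \<and> vol G S \<le> vol G (verts G - S)})"

text \<open>
  Running times are step counts on a unit-cost real RAM: finitely many instructions, directly
  addressed registers (\<open>X\<close> for naturals, \<open>Y\<close> for reals) and two indirectly addressed memories
  (\<open>M\<close> for naturals, \<open>N\<close> for reals). There is no multiplication of naturals and no rounding of
  reals to naturals, because either would make unit cost unreasonably powerful. The only
  constants are naturals, so a program cannot hide information in a real constant.
\<close>

datatype instr =
    IConst nat nat
  | IAdd nat nat nat
  | ISub nat nat nat
  | IRead nat nat
  | IWrite nat nat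
  | RNat nat nat
  | RAdd nat nat nat
  | RSub nat nat nat
  | RMul nat nat nat
  | RDiv nat nat nat
  | RRead nat nat
  | RWrite nat nat
  | IJump nat nat nat
  | RJump nat nat nat

type_synonym program = "instr list"

record config =
  pc :: nat
  ireg :: "nat \<Rightarrow> nat"
  rreg :: "nat \<Rightarrow> real"
  imem :: "nat \<Rightarrow> nat"
  rmem :: "nat \<Rightarrow> real"

definition set_ireg :: "nat \<Rightarrow> nat \<Rightarrow> config \<Rightarrow> config" where
  "set_ireg d x s = s\<lparr>pc := Suc (pc s), ireg := (ireg s)(d := x)\<rparr>"

definition set_rreg :: "nat \<Rightarrow> real \<Rightarrow> config \<Rightarrow> config" where
  "set_rreg d x s = s\<lparr>pc := Suc (pc s), rreg := (rreg s)(d := x)\<rparr>"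

fun exec :: "instr \<Rightarrow> config \<Rightarrow> config" where
  "exec (IConst d k) s = set_ireg d k s"
| "exec (IAdd d a b) s = set_ireg d (ireg s a + ireg s b) s"
| "exec (ISub d a b) s = set_ireg d (ireg s a - ireg s b) s"
| "exec (IRead d a) s = set_ireg d (imem s (ireg s a)) s"
| "exec (IWrite a b) s = s\<lparr>pc := Suc (pc s), imem := (imem s)(ireg s a := ireg s b)\<rparr>"
| "exec (RNat d a) s = set_rreg d (real (ireg s a)) s"
| "exec (RAdd d a b) s = set_rreg d (rreg s a + rreg s b) s"
| "exec (RSub d a b) s = set_rreg d (rreg s a - rreg s b) s"
| "exec (RMul d a b) s = set_rreg d (rreg s a * rreg s b) s"
| "exec (RDiv d a b) s = set_rreg d (rreg s a / rreg s b) s"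
| "exec (RRead d a) s = set_rreg d (rmem s (ireg s a)) s"
| "exec (RWrite a b) s = s\<lparr>pc := Suc (pc s), rmem := (rmem s)(ireg s a := rreg s b)\<rparr>"
| "exec (IJump a b l) s = s\<lparr>pc := (if ireg s a \<le> ireg s b then l else Suc (pc s))\<rparr>"
| "exec (RJump a b l) s = s\<lparr>pc := (if rreg s a \<le> rreg s b then l else Suc (pc s))\<rparr>"

definition step :: "program \<Rightarrow> config \<Rightarrow> config" where
  "step Q s = (if pc s < length Q then exec (Q ! pc s) s else s)"

definition halts_after :: "program \<Rightarrow> config \<Rightarrow> nat \<Rightarrow> config \<Rightarrow> bool" where
  "halts_after Q s k s' \<longleftrightarrow> (step Q ^^ k) s = s' \<and> length Q \<le> pc s'"

definition initial :: "nat list \<Rightarrow> real list \<Rightarrow> (nat \<Rightarrow> nat) \<Rightarrow> config" where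
  "initial xs ys M = \<lparr>pc = 0,
     ireg = (\<lambda>i. if i < length xs then xs ! i else 0),
     rreg = (\<lambda>i. if i < length ys then ys ! i else 0),
     imem = M, rmem = (\<lambda>_. 0)\<rparr>"

text \<open>
  Input layout for a graph on the nodes \<open>{..<n}\<close> together with a list \<open>xs\<close>. Cells \<open>2v\<close> and
  \<open>2v + 1\<close> hold the degree of \<open>v\<close> and the address of its adjacency array, \<open>xs\<close> starts at
  cell \<open>2n\<close>, the (pairwise disjoint) adjacency arrays follow, and all cells from \<open>f\<close> on are free.
  An algorithm has random access to its input and need not read all of it.
\<close>

definition stores :: "(nat \<Rightarrow> nat) \<Rightarrow> nat \<Rightarrow> nat ugraph \<Rightarrow> nat list \<Rightarrow> bool" where
  "stores M f G xs \<longleftrightarrow>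
     (let n = card (verts G); b = 2 * n + length xs in
       verts G = {..<n} \<and> b \<le> f \<and>
       (\<forall>i<length xs. M (2 * n + i) = xs ! i) \<and>
       (\<forall>v<n. M (2 * v) = degree G v \<and>
              b \<le> M (2 * v + 1) \<and> M (2 * v + 1) + degree G v \<le> f \<and>
              bij_betw (\<lambda>i. M (M (2 * v + 1) + i)) {..<degree G v} (neighbours G v)) \<and>
       disjoint_family_on (\<lambda>v. {M (2 * v + 1)..<M (2 * v + 1) + degree G v}) {..<n} \<and>
       (\<forall>i\<ge>f. M i = 0))"

text \<open>Register \<open>X 0\<close> distinguishes the two kinds of answers; a set is returned as an array
  given by its address and length.\<close>

definition answer :: "config \<Rightarrow> nat set option" where
  "answer s = (if ireg s 0 = 0 then None
     else Some ((\<lambda>i. imem s (ireg s 1 + i)) ` {..<ireg s 2}))"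

fun LBS_answer ::
  "real \<Rightarrow> real \<Rightarrow> 'a ugraph \<Rightarrow> 'a set \<Rightarrow> real \<Rightarrow> real \<Rightarrow> 'a set option \<Rightarrow> bool" where
  "LBS_answer csz ccn G A \<sigma> \<alpha> None \<longleftrightarrow> OPT G (\<alpha> / ccn) A \<sigma> = 0"
| "LBS_answer csz ccn G A \<sigma> \<alpha> (Some S) \<longleftrightarrow>
     sparse G \<alpha> S \<and> vol G S \<le> vol G (verts G - S) \<and>
     csz * real (vol G S) \<ge> real (OPT G (\<alpha> / ccn) A \<sigma>)"

text \<open>
  The bound \<open>t n v \<alpha> \<sigma>\<close> applies to all sets \<open>A\<close> of volume at most \<open>v\<close>; for a bound that is
  nondecreasing in \<open>v\<close> this is the same as taking \<open>v = vol G A\<close>. It matters because bounds are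
  also evaluated at reals \<open>v\<close> that are not the volume of any set.
\<close>

definition LBS_algorithm ::
  "program \<Rightarrow> (real \<Rightarrow> real) \<Rightarrow> (real \<Rightarrow> real) \<Rightarrow> (nat \<Rightarrow> real \<Rightarrow> real \<Rightarrow> real \<Rightarrow> real) \<Rightarrow> bool" where
  "LBS_algorithm Q c_size c_con t \<longleftrightarrow>
     (\<forall>\<sigma>\<in>{0..1}. 1 \<le> c_size \<sigma> \<and> 1 \<le> c_con \<sigma>) \<and>
     (\<forall>G as \<sigma> \<alpha> M f.
        simple_graph G \<and> distinct as \<and> set as \<subset> verts G \<and>
        0 \<le> \<sigma> \<and> \<sigma> \<le> 1 \<and> 0 \<le> \<alpha> \<and> \<alpha> \<le> 1 \<and> stores M f G as \<longrightarrow>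
        (\<exists>k s. halts_after Q
                 (initial [card (verts G), card (edges G), length as, f] [\<alpha>, \<sigma>] M) k s \<and>
               LBS_answer (c_size \<sigma>) (c_con \<sigma>) G (set as) \<sigma> \<alpha> (answer s) \<and>
               (\<forall>v. real (vol G (set as)) \<le> v \<longrightarrow> real k \<le> t (card (verts G)) v \<alpha> \<sigma>)))"

definition add_edges :: "'a ugraph \<Rightarrow> 'a set set \<Rightarrow> 'a ugraph" where
  "add_edges G D = (verts G, edges G \<union> D)"

(* r is the conductance required of the pruned graph. *)
fun pruning_answer ::
  "'a ugraph \<Rightarrow> 'a set set \<Rightarrow> real \<Rightarrow> real \<Rightarrow> 'a set option \<Rightarrow> bool" where
  "pruning_answer G D \<alpha>b r None \<longleftrightarrow> conductance (add_edges G D) < ereal \<alpha>b"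
| "pruning_answer G D \<alpha>b r (Some P) \<longleftrightarrow>
     P \<subset> verts G \<and>
     (conductance (add_edges G D) \<ge> ereal \<alpha>b \<longrightarrow>
        real (vol G P) \<le> 2 * real (card D) / \<alpha>b \<and>
        conductance (induced G (verts G - P)) \<ge> ereal r)"

definition lists_edges :: "(nat \<times> nat) list \<Rightarrow> nat set set \<Rightarrow> bool" where
  "lists_edges ds D \<longleftrightarrow> (\<lambda>(u, v). {u, v}) ` set ds = D \<and> length ds = card D"

definition flatten :: "(nat \<times> nat) list \<Rightarrow> nat list" where
  "flatten ds = concat (map (\<lambda>(u, v). [u, v]) ds)"

end

(*
  The pruned set is found by routing tokens; the local cut algorithm is never called and only
  enters through a lower bound on its running time.

  Let k be the least integer with k alpha_b >= 2. Every endpoint of an edge of D sends out k tokens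
  along edges of capacity k, and each node v can absorb deg(v) of them. Push-relabel with labels up
  to H = O(k log (k |D|)) either absorbs all tokens or raises a node w to the maximal label. In the
  latter case a ball around w in the residual graph grows until its residual boundary is small
  compared with its volume; the ball is pruned and its boundary is saturated, which turns the
  missing units into new tokens outside. At the end the flow shows, for d(S) the number of endpoints
  of D in S and S disjoint from P, that k (d(S) + e(S, P)) <= vol(S) + k e(S, V - P - S). So if G_b
  expands S then a constant fraction of the edges leaving S stays in the pruned graph. Moreover
  e(P, V - P) <= d(P), so that the expansion of P in G_b gives vol(P) <= 2 |D| / alpha_b. The number
  of steps is O(k |D| H) = O(|D| / alpha_b^2 * (1 + ln x)) where x = |D| / alpha_b, and
  1 + ln x <= x^epsilon / epsilon.

  It remains to show that a local cut algorithm takes time of order |D| / alpha_b^2. An adversary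
  hides a component with two nodes in a graph that otherwise has no sparse cut of positive volume;
  the algorithm must read linearly many cells to find it. This needs alpha_b <= 27/50. Above that
  nothing has to be done, because G_b has conductance less than 27/50: averaging over all sets, some
  nearly balanced set cuts at most slightly more than half of the edges.
*)

theory Submission
  imports Defs
begin

section \<open>Structured programs for the machine\<close>

record mst =
  tm :: nat
  ir :: "nat \<Rightarrow> nat"
  rr :: "nat \<Rightarrow> real"
  im :: "nat \<Rightarrow> nat"
  rm :: "nat \<Rightarrow> real"

definition conf :: "nat \<Rightarrow> mst \<Rightarrow> config" where
  "conf p s = \<lparr>pc = p, ireg = ir s, rreg = rr s, imem = im s, rmem = rm s\<rparr>"

fun is_jump :: "instr \<Rightarrow> bool" where
  "is_jump (IJump a b l) = True"
| "is_jump (RJump a b l) = True"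
| "is_jump _ = False"

fun act :: "instr \<Rightarrow> mst \<Rightarrow> mst" where
  "act (IConst d k) s = s\<lparr>tm := Suc (tm s), ir := (ir s)(d := k)\<rparr>"
| "act (IAdd d a b) s = s\<lparr>tm := Suc (tm s), ir := (ir s)(d := ir s a + ir s b)\<rparr>"
| "act (ISub d a b) s = s\<lparr>tm := Suc (tm s), ir := (ir s)(d := ir s a - ir s b)\<rparr>"
| "act (IRead d a) s = s\<lparr>tm := Suc (tm s), ir := (ir s)(d := im s (ir s a))\<rparr>"
| "act (IWrite a b) s = s\<lparr>tm := Suc (tm s), im := (im s)(ir s a := ir s b)\<rparr>"
| "act (RNat d a) s = s\<lparr>tm := Suc (tm s), rr := (rr s)(d := real (ir s a))\<rparr>"
| "act (RAdd d a b) s = s\<lparr>tm := Suc (tm s), rr := (rr s)(d := rr s a + rr s b)\<rparr>"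
| "act (RSub d a b) s = s\<lparr>tm := Suc (tm s), rr := (rr s)(d := rr s a - rr s b)\<rparr>"
| "act (RMul d a b) s = s\<lparr>tm := Suc (tm s), rr := (rr s)(d := rr s a * rr s b)\<rparr>"
| "act (RDiv d a b) s = s\<lparr>tm := Suc (tm s), rr := (rr s)(d := rr s a / rr s b)\<rparr>"
| "act (RRead d a) s = s\<lparr>tm := Suc (tm s), rr := (rr s)(d := rm s (ir s a))\<rparr>"
| "act (RWrite a b) s = s\<lparr>tm := Suc (tm s), rm := (rm s)(ir s a := rr s b)\<rparr>"
| "act (IJump a b l) s = s"
| "act (RJump a b l) s = s"

datatype tst = ILe nat nat | RLe nat nat

fun holds :: "tst \<Rightarrow> mst \<Rightarrow> bool" where
  "holds (ILe a b) s \<longleftrightarrow> ir s a \<le> ir s b"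
| "holds (RLe a b) s \<longleftrightarrow> rr s a \<le> rr s b"

fun jump :: "tst \<Rightarrow> nat \<Rightarrow> instr" where
  "jump (ILe a b) l = IJump a b l"
| "jump (RLe a b) l = RJump a b l"

datatype cmd = Do "instr list" | Seq cmd cmd (infixr ";;" 60) | Cond tst cmd cmd | Until tst cmd

abbreviation tick :: "nat \<Rightarrow> mst \<Rightarrow> mst" where
  "tick j s \<equiv> s\<lparr>tm := tm s + j\<rparr>"

inductive big :: "cmd \<Rightarrow> mst \<Rightarrow> mst \<Rightarrow> bool" where
  Do: "\<forall>i\<in>set is. \<not> is_jump i \<Longrightarrow> big (Do is) s (fold act is s)"
| Seq: "big c1 s s1 \<Longrightarrow> big c2 s1 s2 \<Longrightarrow> big (c1 ;; c2) s s2"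
| CondT: "holds b s \<Longrightarrow> big c1 (tick 1 s) s' \<Longrightarrow> big (Cond b c1 c2) s s'"
| CondF: "\<not> holds b s \<Longrightarrow> big c2 (tick 1 s) s' \<Longrightarrow> big (Cond b c1 c2) s (tick 1 s')"
| UntilT: "holds b s \<Longrightarrow> big (Until b c) s (tick 1 s)"
| UntilF: "\<not> holds b s \<Longrightarrow> big c (tick 1 s) s1 \<Longrightarrow> big (Until b c) (tick 1 s1) s2 \<Longrightarrow> big (Until b c) s s2"

fun clen :: "cmd \<Rightarrow> nat" where
  "clen (Do is) = length is"
| "clen (c1 ;; c2) = clen c1 + clen c2"
| "clen (Cond b c1 c2) = clen c1 + clen c2 + 2"
| "clen (Until b c) = clen c + 2"

fun compile :: "nat \<Rightarrow> cmd \<Rightarrow> program" where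
  "compile p (Do is) = is"
| "compile p (c1 ;; c2) = compile p c1 @ compile (p + clen c1) c2"
| "compile p (Cond b c1 c2) =
     jump b (p + clen c2 + 2) # compile (p + 1) c2 @ [IJump 0 0 (p + clen c1 + clen c2 + 2)] @
     compile (p + clen c2 + 2) c1"
| "compile p (Until b c) = jump b (p + clen c + 2) # compile (p + 1) c @ [IJump 0 0 p]"

lemma length_compile [simp]: "length (compile p c) = clen c"
  by (induction c arbitrary: p) auto

definition code_at :: "program \<Rightarrow> nat \<Rightarrow> program \<Rightarrow> bool" where
  "code_at Q p is \<longleftrightarrow> (\<exists>us vs. Q = us @ is @ vs \<and> length us = p)"

lemma code_at_append:
  "code_at Q p (is @ js) \<Longrightarrow> code_at Q p is \<and> code_at Q (p + length is) js"
  unfolding code_at_def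
proof (elim exE conjE)
  fix us vs assume *: "Q = us @ (is @ js) @ vs" "length us = p"
  show "(\<exists>us vs. Q = us @ is @ vs \<and> length us = p) \<and>
        (\<exists>us vs. Q = us @ js @ vs \<and> length us = p + length is)"
    using * by (intro conjI exI[of _ us] exI[of _ "js @ vs"] exI[of _ "us @ is"] exI[of _ vs]) auto
qed

lemma code_at_Cons:
  assumes "code_at Q p (i # is)"
  shows "p < length Q \<and> Q ! p = i \<and> code_at Q (Suc p) is"
proof -
  have "code_at Q p ([i] @ is)" using assms by simp
  from code_at_append[OF this] have "code_at Q (Suc p) is" by simp
  moreover from assms have "p < length Q \<and> Q ! p = i" by (auto simp: code_at_def nth_append)
  ultimately show ?thesis by blast
qed

definition steps :: "program \<Rightarrow> nat \<Rightarrow> config \<Rightarrow> config \<Rightarrow> bool" where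
  "steps Q j x y \<longleftrightarrow> (step Q ^^ j) x = y"

lemma steps_trans: "steps Q j x y \<Longrightarrow> steps Q k y z \<Longrightarrow> steps Q (j + k) x z"
  by (simp add: steps_def add.commute[of j] funpow_add)

lemma steps_1: "steps Q 1 x (step Q x)"
  by (simp add: steps_def)

lemma step_act:
  "p < length Q \<Longrightarrow> \<not> is_jump (Q ! p) \<Longrightarrow> step Q (conf p s) = conf (Suc p) (act (Q ! p) s)"
  by (cases "Q ! p") (auto simp: step_def conf_def set_ireg_def set_rreg_def)

lemma tm_act: "\<not> is_jump i \<Longrightarrow> tm (act i s) = Suc (tm s)"
  by (cases i) auto

lemma step_jump:
  "p < length Q \<Longrightarrow> Q ! p = jump b l \<Longrightarrow> step Q (conf p s) = conf (if holds b s then l else Suc p) s"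
  by (cases b) (auto simp: step_def conf_def)

lemma step_goto:
  "p < length Q \<Longrightarrow> Q ! p = IJump 0 0 l \<Longrightarrow> step Q (conf p s) = conf l s"
  by (auto simp: step_def conf_def)

lemma conf_tick [simp]: "conf p (s\<lparr>tm := x\<rparr>) = conf p s"
  by (simp add: conf_def)

lemma compile_Do:
  assumes "code_at Q p is" "\<forall>i\<in>set is. \<not> is_jump i"
  shows "tm (fold act is s) = tm s + length is \<and>
         steps Q (length is) (conf p s) (conf (p + length is) (fold act is s))"
  using assms
proof (induction "is" arbitrary: p s)
  case Nil
  then show ?case by (simp add: steps_def)
next
  case (Cons i "is")
  from code_at_Cons[OF Cons.prems(1)] have
    c: "p < length Q" "Q ! p = i" "code_at Q (Suc p) is" by auto
  have "steps Q 1 (conf p s) (conf (Suc p) (act i s))"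
    using steps_1[of Q "conf p s"] step_act[of p Q s] c Cons.prems by simp
  from steps_trans[OF this conjunct2[OF Cons.IH[OF c(3), of "act i s"]]] Cons.prems
    conjunct1[OF Cons.IH[OF c(3), of "act i s"]]
  show ?case by (simp add: tm_act)
qed

lemma compile_correct:
  assumes "big c s s'" "code_at Q p (compile p c)"
  shows "tm s \<le> tm s' \<and> steps Q (tm s' - tm s) (conf p s) (conf (p + clen c) s')"
  using assms
proof (induction arbitrary: p rule: big.induct)
  case (Do "is" s)
  then show ?case using compile_Do[of Q p "is" s] by simp
next
  case (Seq c1 s s1 c2 s2)
  from Seq.prems have "code_at Q p (compile p c1)" "code_at Q (p + clen c1) (compile (p + clen c1) c2)"
    using code_at_append by fastforce+
  from Seq.IH(1)[OF this(1)] Seq.IH(2)[OF this(2)]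
  show ?case using steps_trans[of Q "tm s1 - tm s" _ _ "tm s2 - tm s1"]
    by (auto simp: add.assoc)
next
  case (CondT b s c1 s' c2)
  from code_at_Cons[OF CondT.prems[simplified]] have
    j: "p < length Q" "Q ! p = jump b (p + clen c2 + 2)"
    and c: "code_at Q (Suc p) (compile (Suc p) c2 @ [IJump 0 0 (p + clen c1 + clen c2 + 2)] @
       compile (p + clen c2 + 2) c1)" by auto
  from code_at_append[OF c] code_at_Cons
  have "code_at Q (p + clen c2 + 2) (compile (p + clen c2 + 2) c1)" by fastforce
  from CondT.IH[OF this] have
    ih: "Suc (tm s) \<le> tm s'"
    "steps Q (tm s' - Suc (tm s)) (conf (p + clen c2 + 2) s) (conf (p + clen c2 + 2 + clen c1) s')"
    by auto
  have "steps Q 1 (conf p s) (conf (p + clen c2 + 2) s)"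
    using steps_1[of Q "conf p s"] step_jump[OF j] CondT.hyps by simp
  have "1 + (tm s' - Suc (tm s)) = tm s' - tm s" using ih(1) by arith
  with steps_trans[OF \<open>steps Q 1 _ _\<close> ih(2)] ih(1)
  show ?case by (simp add: add.commute add.left_commute)
next
  case (CondF b s c2 s' c1)
  from code_at_Cons[OF CondF.prems[simplified]] have
    j: "p < length Q" "Q ! p = jump b (p + clen c2 + 2)"
    and c: "code_at Q (Suc p) (compile (Suc p) c2 @ [IJump 0 0 (p + clen c1 + clen c2 + 2)] @
       compile (p + clen c2 + 2) c1)" by auto
  from code_at_append[OF c] have c2: "code_at Q (Suc p) (compile (Suc p) c2)"
    and g: "code_at Q (Suc p + clen c2) (IJump 0 0 (p + clen c1 + clen c2 + 2) # compile (p + clen c2 + 2) c1)"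
    by auto
  from CondF.IH[OF c2] have
    ih: "Suc (tm s) \<le> tm s'"
    "steps Q (tm s' - Suc (tm s)) (conf (Suc p) s) (conf (Suc p + clen c2) s')"
    by auto
  have 1: "steps Q 1 (conf p s) (conf (Suc p) s)"
    using steps_1[of Q "conf p s"] step_jump[OF j] CondF.hyps by simp
  have 2: "steps Q 1 (conf (Suc p + clen c2) s') (conf (p + clen c1 + clen c2 + 2) s')"
    using steps_1[of Q "conf (Suc p + clen c2) s'"] step_goto[of "Suc p + clen c2" Q] code_at_Cons[OF g]
    by simp
  have "1 + (tm s' - Suc (tm s)) + 1 = tm (tick 1 s') - tm s" using ih(1) by simp
  with steps_trans[OF steps_trans[OF 1 ih(2)] 2] ih(1)
  show ?case by (simp add: add.commute add.left_commute)
next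
  case (UntilT b s c)
  from code_at_Cons[OF UntilT.prems[simplified]] have
    j: "p < length Q" "Q ! p = jump b (p + clen c + 2)" by auto
  then show ?case
    using steps_1[of Q "conf p s"] step_jump[OF j] UntilT.hyps by (simp add: algebra_simps)
next
  case (UntilF b s c s1 s2)
  from code_at_Cons[OF UntilF.prems[simplified]] have
    j: "p < length Q" "Q ! p = jump b (p + clen c + 2)"
    and c: "code_at Q (Suc p) (compile (Suc p) c @ [IJump 0 0 p])" by auto
  from code_at_append[OF c] have c2: "code_at Q (Suc p) (compile (Suc p) c)"
    and g: "code_at Q (Suc p + clen c) [IJump 0 0 p]"
    by auto
  from UntilF.IH(1)[OF c2] have
    ih: "Suc (tm s) \<le> tm s1"
    "steps Q (tm s1 - Suc (tm s)) (conf (Suc p) s) (conf (Suc p + clen c) s1)"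
    by auto
  have 1: "steps Q 1 (conf p s) (conf (Suc p) s)"
    using steps_1[of Q "conf p s"] step_jump[OF j] UntilF.hyps by simp
  have 2: "steps Q 1 (conf (Suc p + clen c) s1) (conf p s1)"
    using steps_1[of Q "conf (Suc p + clen c) s1"] step_goto[of "Suc p + clen c" Q] code_at_Cons[OF g]
    by simp
  from UntilF.IH(2)[OF UntilF.prems] have
    ih2: "Suc (tm s1) \<le> tm s2"
    "steps Q (tm s2 - Suc (tm s1)) (conf p s1) (conf (p + clen (Until b c)) s2)" by auto
  have "1 + (tm s1 - Suc (tm s)) + 1 + (tm s2 - Suc (tm s1)) = tm s2 - tm s"
    using ih(1) ih2(1) by arith
  with steps_trans[OF steps_trans[OF steps_trans[OF 1 ih(2)] 2] ih2(2)] ih(1) ih2(1)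
  show ?case by simp
qed

definition wp :: "cmd \<Rightarrow> (mst \<Rightarrow> bool) \<Rightarrow> mst \<Rightarrow> bool" where
  "wp c Q s \<longleftrightarrow> (\<exists>s'. big c s s' \<and> Q s')"

inductive_cases big_Do: "big (Do is) s s'"
inductive_cases big_Seq: "big (c1 ;; c2) s s'"
inductive_cases big_Cond: "big (Cond b c1 c2) s s'"

lemma wp_Do: "wp (Do is) Q s \<longleftrightarrow> (\<forall>i\<in>set is. \<not> is_jump i) \<and> Q (fold act is s)"
  unfolding wp_def by (auto elim: big_Do intro: big.Do)

lemma wp_Seq: "wp (c1 ;; c2) Q s \<longleftrightarrow> wp c1 (wp c2 Q) s"
  unfolding wp_def by (blast elim: big_Seq intro: big.Seq)

lemma wp_Cond:
  "wp (Cond b c1 c2) Q s \<longleftrightarrow>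
     (if holds b s then wp c1 Q (tick 1 s) else wp c2 (\<lambda>s'. Q (tick 1 s')) (tick 1 s))"
  unfolding wp_def by (auto elim!: big_Cond intro: big.CondT[simplified] big.CondF[simplified])


lemma wp_mono: "wp c Q s \<Longrightarrow> (\<And>s'. Q s' \<Longrightarrow> R s') \<Longrightarrow> wp c R s"
  unfolding wp_def by blast

lemma wp_tm: "wp c Q s \<Longrightarrow> wp c (\<lambda>s'. Q s' \<and> tm s \<le> tm s') s"
proof -
  assume "wp c Q s"
  then obtain s' where s': "big c s s'" "Q s'" unfolding wp_def by blast
  have "code_at (compile 0 c) 0 (compile 0 c)" unfolding code_at_def by simp
  from compile_correct[OF s'(1) this] s' show ?thesis unfolding wp_def by blast
qed

text \<open>A loop terminates because time passes and the invariant bounds the time.\<close>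

lemma wp_Until:
  assumes "I s"
    and bound: "\<And>s. I s \<Longrightarrow> tm s \<le> B"
    and body: "\<And>s. I s \<Longrightarrow> \<not> holds b s \<Longrightarrow> wp c (\<lambda>s'. I (tick 1 s')) (tick 1 s)"
    and exit: "\<And>s. I s \<Longrightarrow> holds b s \<Longrightarrow> Q (tick 1 s)"
  shows "wp (Until b c) Q s"
  using \<open>I s\<close>
proof (induction "B - tm s" arbitrary: s rule: less_induct)
  case less
  show ?case
  proof (cases "holds b s")
    case True
    then show ?thesis using exit[OF less.prems True] big.UntilT unfolding wp_def by blast
  next
    case False
    from wp_tm[OF body[OF less.prems False]] obtain s1 where
      s1: "big c (tick 1 s) s1" "I (tick 1 s1)" "tm s + 1 \<le> tm s1" unfolding wp_def by auto
    have "B - tm (tick 1 s1) < B - tm s" using s1(3) bound[OF less.prems] bound[OF s1(2)] by simp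
    from less.hyps[OF this s1(2)] show ?thesis
      using s1(1) False big.UntilF unfolding wp_def by blast
  qed
qed

lemma wp_halts:
  assumes "wp c Q s" "tm s = 0"
  shows "\<exists>s'. Q s' \<and> halts_after (compile 0 c) (conf 0 s) (tm s') (conf (clen c) s')"
proof -
  from assms obtain s' where s': "big c s s'" "Q s'" unfolding wp_def by blast
  have "code_at (compile 0 c) 0 (compile 0 c)" unfolding code_at_def by simp
  from compile_correct[OF s'(1) this] assms(2) have "steps (compile 0 c) (tm s') (conf 0 s) (conf (clen c) s')"
    by simp
  then show ?thesis using s'(2) unfolding halts_after_def steps_def
    by (intro exI[of _ s']) (simp add: conf_def)
qed

section \<open>Routing tokens in a flow network\<close>

text \<open>Absorbed tokens, labels, current arcs, flow, and the stack of the positions of the waiting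
  tokens.\<close>

record ast =
  ac :: "nat \<Rightarrow> nat"
  ah :: "nat \<Rightarrow> nat"
  acu :: "nat \<Rightarrow> nat"
  fl :: "nat \<Rightarrow> nat \<Rightarrow> int"
  ts :: "nat list"

definition addf :: "(nat \<Rightarrow> nat \<Rightarrow> int) \<Rightarrow> nat \<Rightarrow> nat \<Rightarrow> nat \<Rightarrow> nat \<Rightarrow> int" where
  "addf f u v = (\<lambda>x y. if x = u \<and> y = v then f x y + 1 else if x = v \<and> y = u then f x y - 1 else f x y)"

locale net =
  fixes n k H T :: nat and E :: "nat \<Rightarrow> nat \<Rightarrow> bool" and d :: "nat \<Rightarrow> nat" and nb :: "nat \<Rightarrow> nat \<Rightarrow> nat"
    and deg :: "nat \<Rightarrow> nat"
  assumes E_sym: "E u v \<Longrightarrow> E v u"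
    and E_irr: "\<not> E u u"
    and E_n: "E u v \<Longrightarrow> u < n \<and> v < n"
    and nb: "v < n \<Longrightarrow> bij_betw (nb v) {..<deg v} {u. E v u}"
    and d_T: "(\<Sum>v<n. d v) = T"
    and k_pos: "0 < k"
    and H_ge: "2 \<le> H"
    and H_big: "real (2 * k * T) < (1 + 1 / (4 * real k)) ^ (H - 2)"
begin

lemma E_ne: "E u v \<Longrightarrow> u \<noteq> v" using E_irr by blast

lemma fin_N [simp]: "finite {u. E v u}"
  by (rule finite_subset[of _ "{..<n}"]) (auto dest: E_n)

lemma deg_card: "v < n \<Longrightarrow> deg v = card {u. E v u}"
  using bij_betw_same_card[OF nb] by simp

lemma nb_E: "v < n \<Longrightarrow> i < deg v \<Longrightarrow> E v (nb v i)"
  using bij_betwE[OF nb] by auto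

lemma nb_ex: "E v u \<Longrightarrow> \<exists>i<deg v. nb v i = u"
proof -
  assume "E v u"
  then have "u \<in> nb v ` {..<deg v}" using nb[of v] E_n[of v u] unfolding bij_betw_def by simp
  then show ?thesis by auto
qed

definition pset :: "(nat \<Rightarrow> nat) \<Rightarrow> nat set" where
  "pset h = {v. v < n \<and> h v = H}"

definition ecut :: "nat set \<Rightarrow> nat set \<Rightarrow> nat" where
  "ecut A B = (\<Sum>u\<in>A. card ({v. E u v} \<inter> B))"

definition resid :: "(nat \<Rightarrow> nat \<Rightarrow> int) \<Rightarrow> nat set \<Rightarrow> nat set \<Rightarrow> nat" where
  "resid f A B = (\<Sum>u\<in>A. card {v\<in>B. E u v \<and> f u v < int k})"

text \<open>The units missing to saturate all edges that leave the pruned set. Each of them turns into a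
  token, and the volume of the pruned set pays for it in the invariant below.\<close>

definition deficit :: "ast \<Rightarrow> int" where
  "deficit a = (\<Sum>u\<in>pset (ah a). \<Sum>v | E u v \<and> ah a v < H. int k - fl a u v)"

definition dvol :: "nat set \<Rightarrow> nat" where
  "dvol S = sum deg S"

definition core :: "ast \<Rightarrow> bool" where
  "core a \<longleftrightarrow>
     (\<forall>u v. fl a u v + fl a v u = 0) \<and>
     (\<forall>u v. fl a u v \<le> int k) \<and>
     (\<forall>u v. \<not> E u v \<longrightarrow> fl a u v = 0) \<and>
     (\<forall>v<n. ah a v < H \<longrightarrow>
        int (ac a v) + int (count_list (ts a) v) = int (k * d v) - (\<Sum>u<n. fl a v u)) \<and>
     (\<forall>v<n. ac a v \<le> deg v \<and> ah a v \<le> H \<and> acu a v \<le> deg v) \<and>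
     (\<forall>v<n. 1 \<le> ah a v \<or> 0 < acu a v \<longrightarrow> ac a v = deg v) \<and>
     (\<forall>v<n. 1 \<le> ah a v \<longrightarrow> 1 \<le> deg v \<or> 1 \<le> d v) \<and>
     (\<forall>u v. E u v \<and> ah a u < H \<and> fl a u v < int k \<longrightarrow> ah a u \<le> Suc (ah a v)) \<and>
     (\<forall>v i. v < n \<and> ah a v < H \<and> i < acu a v \<longrightarrow> fl a v (nb v i) = int k \<or> ah a v \<le> ah a (nb v i)) \<and>
     set (ts a) \<subseteq> {..<n} \<and>
     2 * (int (\<Sum>v<n. ac a v) + int (length (ts a)) + deficit a) \<le> int (2 * k * T + dvol (pset (ah a))) \<and>
     dvol (pset (ah a)) + 2 * k * ecut (pset (ah a)) (- pset (ah a)) \<le> 2 * k * (\<Sum>v\<in>pset (ah a). d v)"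

definition main :: "ast \<Rightarrow> bool" where
  "main a \<longleftrightarrow> core a \<and> (\<forall>u v. E u v \<and> ah a u = H \<and> ah a v < H \<longrightarrow> fl a u v = int k)"

lemma coreD:
  assumes "core a"
  shows anti: "fl a u v = - fl a v u"
    and cap: "fl a u v \<le> int k"
    and noE: "\<not> E u v \<Longrightarrow> fl a u v = 0"
    and cons: "v < n \<Longrightarrow> ah a v < H \<Longrightarrow>
        int (ac a v) + int (count_list (ts a) v) = int (k * d v) - (\<Sum>u<n. fl a v u)"
    and c_le: "v < n \<Longrightarrow> ac a v \<le> deg v"
    and h_le: "v < n \<Longrightarrow> ah a v \<le> H"
    and cu_le: "v < n \<Longrightarrow> acu a v \<le> deg v"
    and sat: "v < n \<Longrightarrow> 1 \<le> ah a v \<or> 0 < acu a v \<Longrightarrow> ac a v = deg v"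
    and zero: "v < n \<Longrightarrow> 1 \<le> ah a v \<Longrightarrow> 1 \<le> deg v \<or> 1 \<le> d v"
    and valid: "E u v \<Longrightarrow> ah a u < H \<Longrightarrow> fl a u v < int k \<Longrightarrow> ah a u \<le> Suc (ah a v)"
    and arc: "v < n \<Longrightarrow> ah a v < H \<Longrightarrow> i < acu a v \<Longrightarrow>
        fl a v (nb v i) = int k \<or> ah a v \<le> ah a (nb v i)"
    and ts_n: "set (ts a) \<subseteq> {..<n}"
    and tok: "2 * (int (\<Sum>v<n. ac a v) + int (length (ts a)) + deficit a)
       \<le> int (2 * k * T + dvol (pset (ah a)))"
    and ineq: "dvol (pset (ah a)) + 2 * k * ecut (pset (ah a)) (- pset (ah a)) \<le> 2 * k * (\<Sum>v\<in>pset (ah a). d v)"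
  using assms unfolding core_def by (blast | simp add: eq_neg_iff_add_eq_0)+

lemma pset_fin [simp]: "finite (pset h)" by (simp add: pset_def)

lemma pset_sub: "pset h \<subseteq> {..<n}" by (auto simp: pset_def)

lemma deficit_nonneg: "core a \<Longrightarrow> 0 \<le> deficit a"
  unfolding deficit_def by (intro sum_nonneg) (auto dest: cap)

lemma vol_pset_le: "core a \<Longrightarrow> dvol (pset (ah a)) \<le> (\<Sum>v<n. ac a v)"
proof -
  assume c: "core a"
  have "dvol (pset (ah a)) = (\<Sum>v\<in>pset (ah a). ac a v)"
    unfolding dvol_def using sat[OF c] H_ge by (intro sum.cong) (auto simp: pset_def)
  also have "\<dots> \<le> (\<Sum>v<n. ac a v)" by (intro sum_mono2) (auto simp: pset_def)
  finally show ?thesis .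
qed

lemma token_bound: "core a \<Longrightarrow> (\<Sum>v<n. ac a v) + 2 * length (ts a) \<le> 2 * k * T"
proof -
  assume c: "core a"
  have "int ((\<Sum>v<n. ac a v) + 2 * length (ts a)) \<le> int (2 * k * T)"
    using tok[OF c] deficit_nonneg[OF c] of_nat_mono[OF vol_pset_le[OF c], where 'a = int] by simp
  then show ?thesis by (simp only: of_nat_le_iff)
qed

lemma sum_addf:
  assumes "u \<noteq> v" "u < n" "v < n"
  shows "(\<Sum>y<n. addf f u v x y) = (\<Sum>y<n. f x y) + (if x = u then 1 else if x = v then -1 else 0)"
proof -
  have "(\<Sum>y<n. addf f u v x y) =
      (\<Sum>y<n. f x y + (if y = v then if x = u then 1 else 0 else 0) + (if y = u then if x = v then -1 else 0 else 0))"
    using assms by (intro sum.cong) (auto simp: addf_def)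
  also have "\<dots> = (\<Sum>y<n. f x y) + (if x = u then 1 else if x = v then -1 else 0)"
    using assms by (simp add: sum.distrib)
  finally show ?thesis .
qed

lemma discard:
  assumes "main a" "ts a = w # r" "ah a w = H"
  shows "main (a\<lparr>ts := r\<rparr>)"
proof -
  from assms(1) have c: "core a" by (simp add: main_def)
  note [simp] = assms(2)
  have "core (a\<lparr>ts := r\<rparr>)"
    unfolding core_def
  proof (intro conjI)
    show "\<forall>v<n. ah (a\<lparr>ts := r\<rparr>) v < H \<longrightarrow> int (ac (a\<lparr>ts := r\<rparr>) v) + int (count_list (ts (a\<lparr>ts := r\<rparr>)) v) =
       int (k * d v) - (\<Sum>u<n. fl (a\<lparr>ts := r\<rparr>) v u)"
    proof (intro allI impI)
      fix v assume "v < n" "ah (a\<lparr>ts := r\<rparr>) v < H"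
      then show "int (ac (a\<lparr>ts := r\<rparr>) v) + int (count_list (ts (a\<lparr>ts := r\<rparr>)) v) =
          int (k * d v) - (\<Sum>u<n. fl (a\<lparr>ts := r\<rparr>) v u)"
        using cons[OF c, of v] assms(3) by (cases "v = w") auto
    qed
    show "2 * (int (\<Sum>v<n. ac (a\<lparr>ts := r\<rparr>) v) + int (length (ts (a\<lparr>ts := r\<rparr>))) + deficit (a\<lparr>ts := r\<rparr>))
      \<le> int (2 * k * T + dvol (pset (ah (a\<lparr>ts := r\<rparr>))))"
      using tok[OF c] by (simp add: deficit_def)
  qed (use c assms(2) in \<open>auto simp: core_def\<close>)
  with assms(1) show ?thesis by (simp add: main_def)
qed

lemma absorb:
  assumes "main a" "ts a = w # r" "ah a w \<noteq> H" "ac a w < deg w"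
  shows "main (a\<lparr>ac := (ac a)(w := Suc (ac a w)), ts := r\<rparr>)" (is "main ?b")
proof -
  from assms(1) have c: "core a" by (simp add: main_def)
  note [simp] = assms(2)
  have w: "w < n" using ts_n[OF c] by auto
  have "\<not> (1 \<le> ah a w \<or> 0 < acu a w)" using sat[OF c w] assms(4) by fastforce
  then have 0: "ah a w = 0" "acu a w = 0" by auto
  have s: "(\<Sum>v<n. ac ?b v) = Suc (\<Sum>v<n. ac a v)"
  proof -
    have "(\<Sum>v<n. ac ?b v) = (\<Sum>v<n. ac a v + (if v = w then 1 else 0))"
      by (intro sum.cong) auto
    then show ?thesis using w by (simp add: sum.distrib)
  qed
  have "core ?b"
    unfolding core_def
  proof (intro conjI)
    show "\<forall>v<n. ah ?b v < H \<longrightarrow> int (ac ?b v) + int (count_list (ts ?b) v) =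
       int (k * d v) - (\<Sum>u<n. fl ?b v u)"
    proof (intro allI impI)
      fix v assume "v < n" "ah ?b v < H"
      then show "int (ac ?b v) + int (count_list (ts ?b) v) = int (k * d v) - (\<Sum>u<n. fl ?b v u)"
        using cons[OF c, of v] by (cases "v = w") auto
    qed
    show "2 * (int (\<Sum>v<n. ac ?b v) + int (length (ts ?b)) + deficit ?b)
      \<le> int (2 * k * T + dvol (pset (ah ?b)))"
      unfolding s using tok[OF c] by (simp add: deficit_def)
  qed (use c assms(2,4) 0 in \<open>auto simp: core_def\<close>)
  with assms(1) show ?thesis by (simp add: main_def)
qed

lemma skip:
  assumes "main a" "ts a = w # r" "acu a w < deg w" "ac a w = deg w"
    and "\<not> (fl a w (nb w (acu a w)) < int k \<and> ah a (nb w (acu a w)) < ah a w)"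
  shows "main (a\<lparr>acu := (acu a)(w := Suc (acu a w))\<rparr>)" (is "main ?b")
proof -
  from assms(1) have c: "core a" by (simp add: main_def)
  have "core ?b"
    unfolding core_def
  proof (intro conjI)
    show "\<forall>v i. v < n \<and> ah ?b v < H \<and> i < acu ?b v \<longrightarrow>
        fl ?b v (nb v i) = int k \<or> ah ?b v \<le> ah ?b (nb v i)"
      using arc[OF c] assms(5) cap[OF c, of w "nb w (acu a w)"] by (auto simp: less_Suc_eq)
    show "2 * (int (\<Sum>v<n. ac ?b v) + int (length (ts ?b)) + deficit ?b)
      \<le> int (2 * k * T + dvol (pset (ah ?b)))"
      using tok[OF c] by (simp add: deficit_def)
  qed (use c assms(2,3,4) in \<open>auto simp: core_def\<close>)
  with assms(1) show ?thesis by (simp add: main_def)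
qed

lemma move:
  assumes "main a" "ts a = w # r" "ah a w \<noteq> H" "acu a w < deg w"
    and u: "u = nb w (acu a w)" and adm: "fl a w u < int k" "ah a u < ah a w"
  shows "main (a\<lparr>fl := addf (fl a) w u, ts := u # r\<rparr>)" (is "main ?b")
proof -
  from assms(1) have c: "core a" by (simp add: main_def)
  have w: "w < n" using ts_n[OF c] assms(2) by auto
  have E: "E w u" using nb_E[OF w assms(4)] u by simp
  have un: "u < n" and ne: "u \<noteq> w" using E_n[OF E] E_ne[OF E] by auto
  have hw: "ah a w < H" using h_le[OF c w] assms(3) by simp
  have hu: "ah a u < H" using adm hw by simp
  have df: "deficit ?b = deficit a"
    unfolding deficit_def using hw hu by (intro sum.cong) (auto simp: addf_def pset_def)
  have cap1: "fl a x y - 1 \<le> int k" for x y using cap[OF c, of x y] by simp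
  have "core ?b"
    unfolding core_def
  proof (intro conjI)
    show "\<forall>x v. fl ?b x v + fl ?b v x = 0"
      using c ne by (auto simp: addf_def core_def)
    show "\<forall>x v. fl ?b x v \<le> int k"
      using cap[OF c] adm cap1 by (auto simp: addf_def)
    show "\<forall>x v. \<not> E x v \<longrightarrow> fl ?b x v = 0"
      using noE[OF c] E E_sym by (auto simp: addf_def)
    show "\<forall>v<n. ah ?b v < H \<longrightarrow> int (ac ?b v) + int (count_list (ts ?b) v) =
       int (k * d v) - (\<Sum>u<n. fl ?b v u)"
    proof (intro allI impI)
      fix v assume "v < n" "ah ?b v < H"
      then show "int (ac ?b v) + int (count_list (ts ?b) v) = int (k * d v) - (\<Sum>u<n. fl ?b v u)"
        using cons[OF c, of v] assms(2) ne
        by (cases "v = w"; cases "v = u") (auto simp: sum_addf[OF ne[symmetric] w un])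
    qed
    show "\<forall>x v. E x v \<and> ah ?b x < H \<and> fl ?b x v < int k \<longrightarrow> ah ?b x \<le> Suc (ah ?b v)"
      using valid[OF c] adm by (auto simp: addf_def)
    show "\<forall>v i. v < n \<and> ah ?b v < H \<and> i < acu ?b v \<longrightarrow>
        fl ?b v (nb v i) = int k \<or> ah ?b v \<le> ah ?b (nb v i)"
    proof (intro allI impI)
      fix v i assume *: "v < n \<and> ah ?b v < H \<and> i < acu ?b v"
      show "fl ?b v (nb v i) = int k \<or> ah ?b v \<le> ah ?b (nb v i)"
      proof (cases "v = w \<and> nb v i = u \<or> v = u \<and> nb v i = w")
        case True
        then show ?thesis using * adm arc[OF c, of w i] hw by auto
      next
        case False
        then have "fl ?b v (nb v i) = fl a v (nb v i)" by (auto simp: addf_def)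
        then show ?thesis using * arc[OF c, of v i] by simp
      qed
    qed
    show "2 * (int (\<Sum>v<n. ac ?b v) + int (length (ts ?b)) + deficit ?b)
      \<le> int (2 * k * T + dvol (pset (ah ?b)))"
      using tok[OF c] assms(2) unfolding df by simp
  qed (use c assms(2) un in \<open>auto simp: core_def\<close>)
  moreover have "\<forall>x v. E x v \<and> ah ?b x = H \<and> ah ?b v < H \<longrightarrow> fl ?b x v = int k"
    using assms(1) hw hu by (auto simp: main_def addf_def)
  ultimately show ?thesis by (simp add: main_def)
qed

lemma top_zero:
  assumes "core a" "ts a = w # r" "ah a w \<noteq> H"
  shows "1 \<le> deg w \<or> 1 \<le> d w"
proof (rule ccontr)
  assume "\<not> ?thesis"
  then have 0: "deg w = 0" "d w = 0" by auto
  have w: "w < n" using ts_n[OF assms(1)] assms(2) by auto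
  have "{u. E w u} = {}" using 0 deg_card[OF w] by simp
  then have "(\<Sum>u<n. fl a w u) = 0" using noE[OF assms(1)] by (intro sum.neutral) auto
  then show False using cons[OF assms(1) w] h_le[OF assms(1) w] assms 0 by auto
qed

lemma arc_done:
  assumes "core a" "w < n" "ah a w < H" "acu a w = deg w" "E w u" "fl a w u < int k"
  shows "ah a w \<le> ah a u"
  using nb_ex[OF assms(5)] arc[OF assms(1,2,3)] assms by (metis less_irrefl)

lemma relabel:
  assumes "main a" "ts a = w # r" "Suc (ah a w) < H" "acu a w = deg w" "ac a w = deg w"
  shows "main (a\<lparr>ah := (ah a)(w := Suc (ah a w)), acu := (acu a)(w := 0)\<rparr>)" (is "main ?b")
proof -
  from assms(1) have c: "core a" by (simp add: main_def)
  have w: "w < n" using ts_n[OF c] assms(2) by auto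
  have hw: "ah a w < H" using assms(3) by simp
  have P: "pset (ah ?b) = pset (ah a)" using assms(3) by (auto simp: pset_def)
  have df: "deficit ?b = deficit a"
    unfolding deficit_def P using assms(3) by (intro sum.cong) auto
  have "core ?b"
    unfolding core_def
  proof (intro conjI)
    show "\<forall>v<n. 1 \<le> ah ?b v \<longrightarrow> 1 \<le> deg v \<or> 1 \<le> d v"
      using zero[OF c] top_zero[OF c assms(2)] hw by auto
    show "\<forall>x v. E x v \<and> ah ?b x < H \<and> fl ?b x v < int k \<longrightarrow> ah ?b x \<le> Suc (ah ?b v)"
      using valid[OF c] arc_done[OF c w hw assms(4)] E_irr by (auto intro: le_SucI)
    show "\<forall>v i. v < n \<and> ah ?b v < H \<and> i < acu ?b v \<longrightarrow>
        fl ?b v (nb v i) = int k \<or> ah ?b v \<le> ah ?b (nb v i)"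
      using arc[OF c] by (auto intro: le_SucI)
    show "2 * (int (\<Sum>v<n. ac ?b v) + int (length (ts ?b)) + deficit ?b)
      \<le> int (2 * k * T + dvol (pset (ah ?b)))"
      using tok[OF c] unfolding df P by simp
    show "dvol (pset (ah ?b)) + 2 * k * ecut (pset (ah ?b)) (- pset (ah ?b)) \<le> 2 * k * (\<Sum>v\<in>pset (ah ?b). d v)"
      using ineq[OF c] unfolding P .
  qed (use c assms(2,3,5) in \<open>auto simp: core_def\<close>)
  moreover have "\<forall>x v. E x v \<and> ah ?b x = H \<and> ah ?b v < H \<longrightarrow> fl ?b x v = int k"
    using assms(1,3) by (auto simp: main_def split: if_splits)
  ultimately show ?thesis by (simp add: main_def)
qed

lemma emit:
  assumes c: "core a" and E: "E u v" and h: "ah a u = H" "ah a v < H" and r: "fl a u v < int k"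
  shows "core (a\<lparr>fl := addf (fl a) u v, ts := v # ts a\<rparr>) \<and>
    deficit (a\<lparr>fl := addf (fl a) u v, ts := v # ts a\<rparr>) = deficit a - 1" (is "core ?b \<and> _")
proof -
  have un: "u < n" and vn: "v < n" and ne: "u \<noteq> v" using E_n[OF E] E_ne[OF E] by auto
  have up: "u \<in> pset (ah a)" using un h by (simp add: pset_def)
  have df: "deficit ?b = deficit a - 1"
  proof -
    have "deficit ?b = (\<Sum>x\<in>pset (ah a). \<Sum>y | E x y \<and> ah a y < H.
        (int k - fl a x y) - (if y = v then if x = u then 1 else 0 else 0))"
      unfolding deficit_def using h by (intro sum.cong) (auto simp: addf_def pset_def)
    also have "\<dots> = deficit a - (\<Sum>x\<in>pset (ah a). \<Sum>y | E x y \<and> ah a y < H.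
        (if y = v then if x = u then 1 else 0 else 0))"
      unfolding deficit_def by (simp only: sum_subtractf)
    also have "(\<Sum>x\<in>pset (ah a). \<Sum>y | E x y \<and> ah a y < H.
        (if y = v then if x = u then 1 else 0 else 0)) = (\<Sum>x\<in>pset (ah a). if x = u then 1 else (0::int))"
      using E h by (intro sum.cong refl) (auto simp: sum.delta)
    finally show ?thesis using up by simp
  qed
  have cap1: "fl a x y - 1 \<le> int k" for x y using cap[OF c, of x y] by simp
  have "core ?b"
    unfolding core_def
  proof (intro conjI)
    show "\<forall>x v. fl ?b x v + fl ?b v x = 0"
      using c ne by (auto simp: addf_def core_def)
    show "\<forall>x v. fl ?b x v \<le> int k"
      using cap[OF c] r cap1 by (auto simp: addf_def)
    show "\<forall>x v. \<not> E x v \<longrightarrow> fl ?b x v = 0"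
      using noE[OF c] E E_sym by (auto simp: addf_def)
    show "\<forall>v<n. ah ?b v < H \<longrightarrow> int (ac ?b v) + int (count_list (ts ?b) v) =
       int (k * d v) - (\<Sum>u<n. fl ?b v u)"
    proof (intro allI impI)
      fix x assume "x < n" "ah ?b x < H"
      then show "int (ac ?b x) + int (count_list (ts ?b) x) = int (k * d x) - (\<Sum>y<n. fl ?b x y)"
        using cons[OF c, of x] ne h
        by (cases "x = v"; cases "x = u") (auto simp: sum_addf[OF ne un vn])
    qed
    show "\<forall>x v. E x v \<and> ah ?b x < H \<and> fl ?b x v < int k \<longrightarrow> ah ?b x \<le> Suc (ah ?b v)"
      using valid[OF c] h by (auto simp: addf_def)
    show "\<forall>v i. v < n \<and> ah ?b v < H \<and> i < acu ?b v \<longrightarrow>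
        fl ?b v (nb v i) = int k \<or> ah ?b v \<le> ah ?b (nb v i)"
      using arc[OF c] h by (auto simp: addf_def)
    show "2 * (int (\<Sum>v<n. ac ?b v) + int (length (ts ?b)) + deficit ?b)
      \<le> int (2 * k * T + dvol (pset (ah ?b)))"
      using tok[OF c] unfolding df by simp
  qed (use c vn in \<open>auto simp: core_def\<close>)
  with df show ?thesis by blast
qed


end

context net
begin

lemma sum_ind:
  assumes "finite A" "B \<subseteq> A"
  shows "(\<Sum>u\<in>A. if u \<in> B then c else 0) = (c::int) * int (card B)"
proof -
  have "(\<Sum>u\<in>A. if u \<in> B then c else 0) = (\<Sum>u\<in>A \<inter> B. c)"
    by (rule sum.inter_restrict[symmetric]) (rule assms(1))
  then show ?thesis using assms(2) by (simp add: Int_absorb1)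
qed

lemma sum_anti:
  assumes c: "core a" and S: "S \<subseteq> {..<n}"
  shows "(\<Sum>v\<in>S. \<Sum>u<n. fl a v u) = (\<Sum>v\<in>S. \<Sum>u\<in>{..<n} - S. fl a v u)"
proof -
  have fS: "finite S" using S finite_subset by blast
  have "(\<Sum>v\<in>S. \<Sum>u\<in>S. fl a v u) = (\<Sum>v\<in>S. \<Sum>u\<in>S. fl a u v)" by (rule sum.swap)
  also have "\<dots> = - (\<Sum>v\<in>S. \<Sum>u\<in>S. fl a v u)"
    unfolding sum_negf[symmetric] by (intro sum.cong refl anti[OF c])
  finally have 0: "(\<Sum>v\<in>S. \<Sum>u\<in>S. fl a v u) = 0" by simp
  have "(\<Sum>u<n. fl a v u) = (\<Sum>u\<in>{..<n} - S. fl a v u) + (\<Sum>u\<in>S. fl a v u)" for v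
    by (rule sum.subset_diff) (use S in auto)
  then show ?thesis using 0 by (simp add: sum.distrib)
qed

lemma ecut_sym:
  assumes "finite A" "finite B"
  shows "ecut A B = ecut B A"
proof -
  have *: "card ({v. E u v} \<inter> C) = (\<Sum>v\<in>C. if E u v then 1 else 0)" if "finite C" for u C
    using that by (simp add: sum.If_cases Int_commute)
  have "ecut A B = (\<Sum>u\<in>A. \<Sum>v\<in>B. if E u v then 1 else 0)"
    unfolding ecut_def using *[OF assms(2)] by simp
  also have "\<dots> = (\<Sum>v\<in>B. \<Sum>u\<in>A. if E u v then 1 else 0)" by (rule sum.swap)
  also have "\<dots> = (\<Sum>v\<in>B. \<Sum>u\<in>A. if E v u then 1 else 0)"
    by (intro sum.cong refl) (auto dest: E_sym)
  also have "\<dots> = ecut B A"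
    unfolding ecut_def using *[OF assms(1)] by simp
  finally show ?thesis .
qed

lemma ecut_Un_right:
  assumes "B \<inter> C = {}"
  shows "ecut A (B \<union> C) = ecut A B + ecut A C"
  unfolding ecut_def sum.distrib[symmetric]
proof (intro sum.cong refl)
  fix u
  have "card ({v. E u v} \<inter> B \<union> {v. E u v} \<inter> C) = card ({v. E u v} \<inter> B) + card ({v. E u v} \<inter> C)"
    by (rule card_Un_disjoint) (use assms in auto)
  then show "card ({v. E u v} \<inter> (B \<union> C)) = card ({v. E u v} \<inter> B) + card ({v. E u v} \<inter> C)"
    by (simp add: Int_Un_distrib)
qed

lemma ecut_Un_left:
  "finite A \<Longrightarrow> finite B \<Longrightarrow> A \<inter> B = {} \<Longrightarrow> ecut (A \<union> B) C = ecut A C + ecut B C"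
  unfolding ecut_def by (rule sum.union_disjoint)

lemma outflow_ge:
  assumes c: "core a" and S: "S \<subseteq> {..<n}" and P: "P \<inter> S = {}"
  shows "int k * int (ecut S (- (P \<union> S))) - int k * int (ecut S P)
      - 2 * int k * int (resid (fl a) S (- (P \<union> S))) \<le> (\<Sum>v\<in>S. \<Sum>u<n. fl a v u)"
proof -
  let ?R = "- (P \<union> S)"
  have "int k * int (card ({u. E v u} \<inter> ?R)) - int k * int (card ({u. E v u} \<inter> P))
      - 2 * int k * int (card {u \<in> ?R. E v u \<and> fl a v u < int k}) \<le> (\<Sum>u\<in>{..<n} - S. fl a v u)"
    if "v \<in> S" for v
  proof -
    have "(\<Sum>u\<in>{..<n} - S. (if u \<in> {u. E v u} \<inter> ?R then int k else 0)
          + (if u \<in> {u. E v u} \<inter> P then - int k else 0)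
          + (if u \<in> {u \<in> ?R. E v u \<and> fl a v u < int k} then - 2 * int k else 0))
        \<le> (\<Sum>u\<in>{..<n} - S. fl a v u)"
    proof (rule sum_mono)
      fix u assume "u \<in> {..<n} - S"
      moreover have "- int k \<le> fl a v u" using anti[OF c, of v u] cap[OF c, of u v] by simp
      ultimately show "(if u \<in> {u. E v u} \<inter> ?R then int k else 0)
          + (if u \<in> {u. E v u} \<inter> P then - int k else 0)
          + (if u \<in> {u \<in> ?R. E v u \<and> fl a v u < int k} then - 2 * int k else 0) \<le> fl a v u"
        using noE[OF c, of v u] by auto
    qed
    also have "(\<Sum>u\<in>{..<n} - S. (if u \<in> {u. E v u} \<inter> ?R then int k else 0)
          + (if u \<in> {u. E v u} \<inter> P then - int k else 0)
          + (if u \<in> {u \<in> ?R. E v u \<and> fl a v u < int k} then - 2 * int k else 0))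
       = int k * int (card ({u. E v u} \<inter> ?R)) + (- int k) * int (card ({u. E v u} \<inter> P))
      + (- 2 * int k) * int (card {u \<in> ?R. E v u \<and> fl a v u < int k})"
      unfolding sum.distrib using P E_n by (subst (1 2 3) sum_ind) auto
    finally show ?thesis by simp
  qed
  then have "(\<Sum>v\<in>S. int k * int (card ({u. E v u} \<inter> ?R)) - int k * int (card ({u. E v u} \<inter> P))
      - 2 * int k * int (card {u \<in> ?R. E v u \<and> fl a v u < int k})) \<le> (\<Sum>v\<in>S. \<Sum>u\<in>{..<n} - S. fl a v u)"
    by (rule sum_mono)
  then show ?thesis
    unfolding sum_anti[OF c S] ecut_def resid_def
    by (simp add: sum_subtractf sum_distrib_left)
qed

lemma final_cut:
  assumes m: "main a" and t: "ts a = []" and S: "S \<subseteq> {..<n} - pset (ah a)"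
  shows "k * ((\<Sum>v\<in>S. d v) + ecut S (pset (ah a))) \<le> dvol S + k * ecut S (- (pset (ah a) \<union> S))"
proof -
  let ?P = "pset (ah a)"
  from m have c: "core a" by (simp add: main_def)
  have Sn: "S \<subseteq> {..<n}" using S by auto
  have fS: "finite S" using Sn finite_subset by blast
  have h: "ah a v < H" if "v \<in> S" for v
    using S that h_le[OF c, of v] by (force simp: pset_def)
  have "(\<Sum>u\<in>{..<n} - S. fl a v u) \<le>
      int k * int (card ({u. E v u} \<inter> - (?P \<union> S))) - int k * int (card ({u. E v u} \<inter> ?P))"
    if "v \<in> S" for v
  proof -
    have "(\<Sum>u\<in>{..<n} - S. fl a v u) \<le> (\<Sum>u\<in>{..<n} - S.
         (if u \<in> {u. E v u} \<inter> - (?P \<union> S) then int k else 0)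
          + (if u \<in> {u. E v u} \<inter> ?P then - int k else 0))"
    proof (rule sum_mono)
      fix u assume "u \<in> {..<n} - S"
      moreover have "fl a v u = - int k" if "E v u" "u \<in> ?P"
        using m h[OF \<open>v \<in> S\<close>] E_sym[OF \<open>E v u\<close>] that(2) anti[OF c, of v u]
        by (auto simp: main_def pset_def)
      ultimately show "fl a v u \<le> (if u \<in> {u. E v u} \<inter> - (?P \<union> S) then int k else 0)
          + (if u \<in> {u. E v u} \<inter> ?P then - int k else 0)"
        using noE[OF c, of v u] cap[OF c, of v u] by auto
    qed
    also have "\<dots> = int k * int (card ({u. E v u} \<inter> - (?P \<union> S))) + (- int k) * int (card ({u. E v u} \<inter> ?P))"
      unfolding sum.distrib using S E_n by (subst (1 2) sum_ind) auto
    finally show ?thesis by simp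
  qed
  then have "(\<Sum>v\<in>S. \<Sum>u\<in>{..<n} - S. fl a v u) \<le>
      (\<Sum>v\<in>S. int k * int (card ({u. E v u} \<inter> - (?P \<union> S))) - int k * int (card ({u. E v u} \<inter> ?P)))"
    by (rule sum_mono)
  then have 1: "(\<Sum>v\<in>S. \<Sum>u<n. fl a v u) \<le>
      int k * int (ecut S (- (?P \<union> S))) - int k * int (ecut S ?P)"
    unfolding sum_anti[OF c Sn] ecut_def by (simp add: sum_subtractf sum_distrib_left)
  have "(\<Sum>v\<in>S. int (k * d v) - (\<Sum>u<n. fl a v u)) \<le> (\<Sum>v\<in>S. int (deg v))"
  proof (rule sum_mono)
    fix v assume v: "v \<in> S"
    then have "v < n" using Sn by auto
    from cons[OF c this h[OF v]] c_le[OF c this] t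
    show "int (k * d v) - (\<Sum>u<n. fl a v u) \<le> int (deg v)" by simp
  qed
  then have "int k * int (\<Sum>v\<in>S. d v) - (\<Sum>v\<in>S. \<Sum>u<n. fl a v u) \<le> int (dvol S)"
    by (simp add: sum_subtractf dvol_def sum_distrib_left)
  with 1 have "int (k * ((\<Sum>v\<in>S. d v) + ecut S ?P)) \<le> int (dvol S + k * ecut S (- (?P \<union> S)))"
    by (simp add: algebra_simps)
  then show ?thesis by (simp only: of_nat_le_iff)
qed

section \<open>Cutting off a vertex of maximal label\<close>

definition bfs :: "ast \<Rightarrow> nat \<Rightarrow> nat \<Rightarrow> nat set \<Rightarrow> nat set \<Rightarrow> bool" where
  "bfs a w j S L \<longleftrightarrow>
     main a \<and> w \<in> S \<and> S \<subseteq> {v. v < n \<and> ah a v < H} \<and> L \<subseteq> S \<and>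
     (\<forall>v\<in>S. ac a v = deg v \<and> (1 \<le> deg v \<or> 1 \<le> d v) \<and> H \<le> ah a v + 1 + j) \<and>
     (\<forall>u\<in>S - L. \<forall>v. E u v \<and> fl a u v < int k \<longrightarrow> v \<in> pset (ah a) \<union> S) \<and>
     (dvol S = 0 \<or> (1 + 1 / (4 * real k)) ^ j \<le> real (dvol S))"

definition cutset :: "ast \<Rightarrow> nat set \<Rightarrow> ast" where
  "cutset a S = a\<lparr>ah := \<lambda>v. if v \<in> S then H else ah a v\<rparr>"

lemma bfs_init:
  assumes "main a" "ts a = w # r" "Suc (ah a w) = H" "ac a w = deg w"
  shows "bfs a w 0 {w} {w}"
proof -
  have c: "core a" using assms by (simp add: main_def)
  have w: "w < n" using ts_n[OF c] assms by auto
  from top_zero[OF c assms(2)] assms have "1 \<le> deg w \<or> 1 \<le> d w" by simp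
  then show ?thesis using assms w by (auto simp: bfs_def dvol_def)
qed

lemma bfs_grow:
  assumes b: "bfs a w j S L"
    and z: "dvol S < 4 * k * resid (fl a) L (- (pset (ah a) \<union> S))"
    and N: "N = {v. v \<notin> pset (ah a) \<union> S \<and> (\<exists>u\<in>L. E u v \<and> fl a u v < int k)}"
  shows "bfs a w (Suc j) (S \<union> N) N"
proof -
  let ?R = "- (pset (ah a) \<union> S)"
  from b have m: "main a" and c: "core a" and Sn: "S \<subseteq> {v. v < n \<and> ah a v < H}" and LS: "L \<subseteq> S"
    and satS: "\<forall>v\<in>S. ac a v = deg v" and dS: "\<forall>v\<in>S. H \<le> ah a v + 1 + j"
    and gr: "dvol S = 0 \<or> (1 + 1 / (4 * real k)) ^ j \<le> real (dvol S)"
    by (auto simp: bfs_def main_def)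
  have fS: "finite S" using Sn by (rule finite_subset) simp
  then have fL: "finite L" using LS finite_subset by blast
  have Nn: "N \<subseteq> {..<n}" using N E_n by auto
  then have fN: "finite N" using finite_subset by blast
  have disj: "S \<inter> N = {}" using N by auto
  have "resid (fl a) L ?R = (\<Sum>u\<in>L. \<Sum>v\<in>N. if E u v \<and> fl a u v < int k then 1 else 0)"
    unfolding resid_def
  proof (intro sum.cong refl)
    fix u assume "u \<in> L"
    then have "{v \<in> ?R. E u v \<and> fl a u v < int k} = N \<inter> {v. E u v \<and> fl a u v < int k}"
      using N by auto
    then show "card {v \<in> ?R. E u v \<and> fl a u v < int k} =
        (\<Sum>v\<in>N. if E u v \<and> fl a u v < int k then 1 else 0)"
      using fN by (simp add: sum.If_cases)
  qed
  also have "\<dots> = (\<Sum>v\<in>N. \<Sum>u\<in>L. if E u v \<and> fl a u v < int k then 1 else 0)" by (rule sum.swap)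
  also have "\<dots> \<le> (\<Sum>v\<in>N. deg v)"
  proof (rule sum_mono)
    fix v assume v: "v \<in> N"
    have "(\<Sum>u\<in>L. if E u v \<and> fl a u v < int k then 1 else 0) = card (L \<inter> {u. E u v \<and> fl a u v < int k})"
      using fL by (simp add: sum.If_cases)
    also have "\<dots> \<le> card {u. E v u}"
      by (rule card_mono[OF fin_N]) (auto dest: E_sym)
    also have "\<dots> = deg v" using deg_card v Nn by auto
    finally show "(\<Sum>u\<in>L. if E u v \<and> fl a u v < int k then 1 else 0) \<le> deg v" .
  qed
  finally have vN: "resid (fl a) L ?R \<le> dvol N" by (simp add: dvol_def)
  have vSN: "dvol (S \<union> N) = dvol S + dvol N"
    unfolding dvol_def by (rule sum.union_disjoint[OF fS fN disj])
  have "dvol S < 4 * k * dvol N" using z vN by (meson less_le_trans mult_le_mono2)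
  then have "real (dvol S) < 4 * real k * real (dvol N)"
    unfolding of_nat_mult[symmetric] of_nat_numeral[symmetric, where 'a = real] of_nat_less_iff by simp
  then have g: "(1 + 1 / (4 * real k)) * real (dvol S) \<le> real (dvol (S \<union> N))"
    unfolding vSN using k_pos by (simp add: field_simps)
  have S0: "dvol S \<noteq> 0"
  proof
    assume "dvol S = 0"
    then have "deg u = 0" if "u \<in> S" for u using that fS by (simp add: dvol_def)
    then have "{v. E u v} = {}" if "u \<in> L" for u
      using that LS Sn deg_card[of u] by force
    then have "resid (fl a) L ?R = 0" unfolding resid_def by (auto intro!: sum.neutral)
    then show False using z by simp
  qed
  then have "(1 + 1 / (4 * real k)) ^ j \<le> real (dvol S)" using gr by simp
  then have g2: "(1 + 1 / (4 * real k)) ^ Suc j \<le> real (dvol (S \<union> N))"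
    using g mult_left_mono[of "(1 + 1 / (4 * real k)) ^ j" "real (dvol S)" "1 + 1 / (4 * real k)"] by simp
  have "dvol S = (\<Sum>v\<in>S. ac a v)" unfolding dvol_def using satS by simp
  also have "\<dots> \<le> (\<Sum>v<n. ac a v)" using Sn by (intro sum_mono2) auto
  also have "\<dots> \<le> 2 * k * T" using token_bound[OF c] by simp
  finally have "(1 + 1 / (4 * real k)) ^ j < (1 + 1 / (4 * real k)) ^ (H - 2)"
    using H_big \<open>(1 + 1 / (4 * real k)) ^ j \<le> real (dvol S)\<close> by (smt (verit) of_nat_le_iff)
  then have j: "j < H - 2" using k_pos by (subst (asm) power_strict_increasing_iff) auto
  have dN: "H \<le> ah a v + 1 + Suc j" if "v \<in> N" for v
  proof -
    from that N obtain u where u: "u \<in> L" "E u v" "fl a u v < int k" by auto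
    have "ah a u \<le> Suc (ah a v)" using valid[OF c u(2) _ u(3)] u(1) LS Sn by auto
    then show ?thesis using dS u(1) LS by fastforce
  qed
  have hN: "1 \<le> ah a v" if "v \<in> N" for v using dN[OF that] j by linarith
  have "bfs a w (Suc j) (S \<union> N) N"
    unfolding bfs_def
  proof (intro conjI)
    show "S \<union> N \<subseteq> {v. v < n \<and> ah a v < H}"
    proof
      fix v assume "v \<in> S \<union> N"
      then consider "v \<in> S" | "v \<in> N" by blast
      then show "v \<in> {v. v < n \<and> ah a v < H}"
      proof cases
        case 2
        then have "v < n" "v \<notin> pset (ah a)" using Nn N by auto
        then show ?thesis using h_le[OF c, of v] by (simp add: pset_def)
      qed (use Sn in blast)
    qed
    show "\<forall>v\<in>S \<union> N. ac a v = deg v \<and> (1 \<le> deg v \<or> 1 \<le> d v) \<and> H \<le> ah a v + 1 + Suc j"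
    proof (intro ballI)
      fix v assume "v \<in> S \<union> N"
      then consider "v \<in> S" | "v \<in> N" by auto
      then show "ac a v = deg v \<and> (1 \<le> deg v \<or> 1 \<le> d v) \<and> H \<le> ah a v + 1 + Suc j"
      proof cases
        case 1
        then have "ac a v = deg v \<and> (1 \<le> deg v \<or> 1 \<le> d v) \<and> H \<le> ah a v + 1 + j"
          using b unfolding bfs_def by blast
        then show ?thesis by simp
      next
        case 2
        then have "v < n" using Nn by auto
        with dN[OF 2] hN[OF 2] sat[OF c] zero[OF c] show ?thesis by blast
      qed
    qed
    show "\<forall>u\<in>S \<union> N - N. \<forall>v. E u v \<and> fl a u v < int k \<longrightarrow> v \<in> pset (ah a) \<union> (S \<union> N)"
      using b N unfolding bfs_def by blast
  qed (use b g2 in \<open>auto simp: bfs_def\<close>)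
  then show ?thesis .
qed

lemma bfs_cut:
  assumes b: "bfs a w j S L"
    and z: "4 * k * resid (fl a) L (- (pset (ah a) \<union> S)) \<le> dvol S"
  shows "core (cutset a S)"
    and "2 * deficit (cutset a S) \<le> int (dvol S)"
    and "E u v \<Longrightarrow> ah (cutset a S) u = H \<Longrightarrow> ah (cutset a S) v < H \<Longrightarrow> fl a u v < int k \<Longrightarrow> u \<in> L"
proof -
  let ?P = "pset (ah a)" and ?b = "cutset a S"
  let ?R = "- (?P \<union> S)"
  from b have m: "main a" and c: "core a" and Sn: "S \<subseteq> {v. v < n \<and> ah a v < H}" and LS: "L \<subseteq> S"
    and satS: "\<forall>v\<in>S. ac a v = deg v" and zS: "\<forall>v\<in>S. 1 \<le> deg v \<or> 1 \<le> d v"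
    and out: "\<forall>u\<in>S - L. \<forall>v. E u v \<and> fl a u v < int k \<longrightarrow> v \<in> ?P \<union> S"
    by (auto simp: bfs_def main_def)
  have fS: "finite S" using Sn by (rule finite_subset) simp
  have Sn': "S \<subseteq> {..<n}" using Sn by auto
  have PS: "?P \<inter> S = {}" using Sn by (auto simp: pset_def)
  have P': "pset (ah ?b) = ?P \<union> S" using Sn by (auto simp: pset_def cutset_def)
  have hb: "ah ?b v = (if v \<in> S then H else ah a v)" and fb: "fl ?b = fl a" "ac ?b = ac a"
    "ts ?b = ts a" "acu ?b = acu a" for v
    by (auto simp: cutset_def)
  show bd: "E u v \<Longrightarrow> ah ?b u = H \<Longrightarrow> ah ?b v < H \<Longrightarrow> fl a u v < int k \<Longrightarrow> u \<in> L" for u v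
    using out m by (fastforce simp: hb main_def pset_def split: if_splits)
  have rS: "resid (fl a) S ?R = resid (fl a) L ?R"
    unfolding resid_def using out by (intro sum.mono_neutral_right fS LS) (auto simp: card_eq_0_iff)
  have df: "2 * deficit ?b \<le> 4 * int k * int (resid (fl a) L ?R)"
  proof -
    have "deficit ?b = (\<Sum>u\<in>?P. \<Sum>v | E u v \<and> ah ?b v < H. int k - fl a u v)
       + (\<Sum>u\<in>S. \<Sum>v | E u v \<and> ah ?b v < H. int k - fl a u v)"
      unfolding deficit_def P' fb by (rule sum.union_disjoint[OF pset_fin fS PS])
    also have "(\<Sum>u\<in>?P. \<Sum>v | E u v \<and> ah ?b v < H. int k - fl a u v) = 0"
      using m by (intro sum.neutral ballI) (auto simp: main_def pset_def hb split: if_splits)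
    also have "(\<Sum>u\<in>S. \<Sum>v | E u v \<and> ah ?b v < H. int k - fl a u v)
       \<le> (\<Sum>u\<in>S. 2 * int k * int (card {v \<in> ?R. E u v \<and> fl a u v < int k}))"
    proof (rule sum_mono)
      fix u assume "u \<in> S"
      have "(\<Sum>v | E u v \<and> ah ?b v < H. int k - fl a u v) \<le>
         (\<Sum>v | E u v \<and> ah ?b v < H. if v \<in> {v \<in> ?R. E u v \<and> fl a u v < int k} then 2 * int k else 0)"
      proof (rule sum_mono)
        fix v assume v: "v \<in> {v. E u v \<and> ah ?b v < H}"
        have "- int k \<le> fl a u v" using anti[OF c, of v u] cap[OF c, of v u] by simp
        then show "int k - fl a u v \<le> (if v \<in> {v \<in> ?R. E u v \<and> fl a u v < int k} then 2 * int k else 0)"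
          using v cap[OF c, of u v] by (auto simp: hb pset_def split: if_splits)
      qed
      also have "\<dots> = 2 * int k * int (card {v \<in> ?R. E u v \<and> fl a u v < int k})"
      proof (rule sum_ind)
        show "{v \<in> ?R. E u v \<and> fl a u v < int k} \<subseteq> {v. E u v \<and> ah ?b v < H}"
        proof
          fix v assume v: "v \<in> {v \<in> ?R. E u v \<and> fl a u v < int k}"
          then have "v < n" using E_n by auto
          then show "v \<in> {v. E u v \<and> ah ?b v < H}"
            using v h_le[OF c, of v] by (auto simp: hb pset_def)
        qed
      qed (rule finite_subset[OF _ fin_N[of u]], auto)
      finally show "(\<Sum>v | E u v \<and> ah ?b v < H. int k - fl a u v) \<le>
        2 * int k * int (card {v \<in> ?R. E u v \<and> fl a u v < int k})" .
    qed
    also have "\<dots> = 2 * int k * int (resid (fl a) S ?R)" by (simp add: resid_def sum_distrib_left)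
    finally show ?thesis unfolding rS by simp
  qed
  have zi: "4 * int k * int (resid (fl a) L ?R) \<le> int (dvol S)"
    using of_nat_mono[OF z, where 'a = int] by simp
  show d2: "2 * deficit ?b \<le> int (dvol S)" using df zi by linarith
  have vP: "dvol (?P \<union> S) = dvol ?P + dvol S"
    unfolding dvol_def by (rule sum.union_disjoint[OF pset_fin fS PS])
  have in_S: "dvol S + 2 * k * ecut S ?R \<le> 2 * k * (\<Sum>v\<in>S. d v) + 2 * k * ecut S ?P"
  proof -
    have "(\<Sum>v\<in>S. int (deg v)) \<le> (\<Sum>v\<in>S. int (k * d v) - (\<Sum>u<n. fl a v u))"
    proof (rule sum_mono)
      fix v assume v: "v \<in> S"
      then have "v < n" "ah a v < H" using Sn by auto
      from cons[OF c this] satS v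
      show "int (deg v) \<le> int (k * d v) - (\<Sum>u<n. fl a v u)" by auto
    qed
    then have "int (dvol S) \<le> int k * int (\<Sum>v\<in>S. d v) - (\<Sum>v\<in>S. \<Sum>u<n. fl a v u)"
      by (simp add: sum_subtractf dvol_def sum_distrib_left)
    with outflow_ge[OF c Sn' PS] zi
    have "int (dvol S + 2 * k * ecut S ?R) \<le> int (2 * k * (\<Sum>v\<in>S. d v) + 2 * k * ecut S ?P)"
      unfolding rS by simp
    then show ?thesis by (simp only: of_nat_le_iff)
  qed
  have R: "- ?P = S \<union> ?R" using PS by auto
  have e1: "ecut ?P (- ?P) = ecut S ?P + ecut ?P ?R"
    by (subst R, subst ecut_Un_right) (auto simp: ecut_sym[OF pset_fin fS])
  have e2: "ecut (?P \<union> S) ?R = ecut ?P ?R + ecut S ?R"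
    by (rule ecut_Un_left[OF pset_fin fS PS])
  have sd: "(\<Sum>v\<in>?P \<union> S. d v) = (\<Sum>v\<in>?P. d v) + (\<Sum>v\<in>S. d v)"
    by (rule sum.union_disjoint[OF pset_fin fS PS])
  show "core ?b"
    unfolding core_def
  proof (intro conjI)
    show "\<forall>u v. fl ?b u v + fl ?b v u = 0" using c by (simp add: core_def fb)
    show "\<forall>v<n. ah ?b v < H \<longrightarrow>
        int (ac ?b v) + int (count_list (ts ?b) v) = int (k * d v) - (\<Sum>u<n. fl ?b v u)"
      using cons[OF c] by (simp add: hb fb)
    show "\<forall>v<n. ac ?b v \<le> deg v \<and> ah ?b v \<le> H \<and> acu ?b v \<le> deg v"
      using c_le[OF c] h_le[OF c] cu_le[OF c] by (simp add: hb fb)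
    show "\<forall>v<n. 1 \<le> ah ?b v \<or> 0 < acu ?b v \<longrightarrow> ac ?b v = deg v"
      using sat[OF c] satS by (simp add: hb fb)
    show "\<forall>v<n. 1 \<le> ah ?b v \<longrightarrow> 1 \<le> deg v \<or> 1 \<le> d v"
      using zero[OF c] zS by (simp add: hb fb)
    show "\<forall>u v. E u v \<and> ah ?b u < H \<and> fl ?b u v < int k \<longrightarrow> ah ?b u \<le> Suc (ah ?b v)"
      using valid[OF c] by (simp add: hb fb)
    show "\<forall>v i. v < n \<and> ah ?b v < H \<and> i < acu ?b v \<longrightarrow>
       fl ?b v (nb v i) = int k \<or> ah ?b v \<le> ah ?b (nb v i)"
      using arc[OF c] by (simp add: hb fb)
    show "2 * (int (\<Sum>v<n. ac ?b v) + int (length (ts ?b)) + deficit ?b)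
      \<le> int (2 * k * T + dvol (pset (ah ?b)))"
      using tok[OF c] deficit_nonneg[OF c] d2 unfolding P' vP by (simp add: fb)
    show "dvol (pset (ah ?b)) + 2 * k * ecut (pset (ah ?b)) (- pset (ah ?b)) \<le> 2 * k * (\<Sum>v\<in>pset (ah ?b). d v)"
      using ineq[OF c] in_S unfolding P' vP e1 e2 sd distrib_left by linarith
  qed (use cap[OF c] noE[OF c] ts_n[OF c] in \<open>auto simp: fb\<close>)
qed

section \<open>The potential\<close>

text \<open>Moving a token to a lower label or disposing of it decreases \<open>mu\<close>; every other step increases
  \<open>wt\<close>, which never decreases and is bounded, by at least as much as it increases \<open>mu\<close>.\<close>

definition wt :: "ast \<Rightarrow> nat" where
  "wt a = (\<Sum>v<n. (deg v + 3) * ah a v + acu a v + (if ah a v = H then (H + 2) * (deg v + 1) else 0))"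

definition mu :: "ast \<Rightarrow> nat" where
  "mu a = (H + 1) * length (ts a) + (case ts a of [] \<Rightarrow> 0 | w # _ \<Rightarrow> ah a w)"

lemma wt_bound:
  assumes c: "core a"
  shows "wt a \<le> (4 * H + 3) * ((4 * k + 1) * T)"
proof -
  have "wt a \<le> (\<Sum>v<n. (4 * H + 3) * (2 * ac a v + d v))"
    unfolding wt_def
  proof (rule sum_mono)
    fix v assume "v \<in> {..<n}"
    then have v: "v < n" by simp
    show "(deg v + 3) * ah a v + acu a v + (if ah a v = H then (H + 2) * (deg v + 1) else 0)
        \<le> (4 * H + 3) * (2 * ac a v + d v)"
    proof (cases "1 \<le> ah a v \<or> 0 < acu a v")
      case True
      have "1 \<le> deg v \<or> 1 \<le> d v" using True zero[OF c v] cu_le[OF c v] by auto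
      then have "deg v + 1 \<le> 2 * ac a v + d v" using sat[OF c v True] by auto
      moreover have "(deg v + 3) * ah a v \<le> (3 * (deg v + 1)) * H"
        using h_le[OF c v] by (intro mult_le_mono) auto
      then have "(deg v + 3) * ah a v + acu a v + (if ah a v = H then (H + 2) * (deg v + 1) else 0)
         \<le> (4 * H + 3) * (deg v + 1)" using cu_le[OF c v] by (auto simp: algebra_simps)
      ultimately show ?thesis by (meson le_trans mult_le_mono2)
    next
      case False
      then have "ah a v = 0" "acu a v = 0" by auto
      then show ?thesis using H_ge by simp
    qed
  qed
  also have "\<dots> = (4 * H + 3) * (2 * (\<Sum>v<n. ac a v) + T)"
    by (simp add: sum_distrib_left[symmetric] sum.distrib d_T)
  also have "\<dots> \<le> (4 * H + 3) * ((4 * k + 1) * T)"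
    using token_bound[OF c] by (intro mult_le_mono2) (simp add: algebra_simps)
  finally show ?thesis .
qed

lemma mu_pop:
  assumes c: "core a" and t: "ts a = w # r" and r: "ts b = r" "ah b = ah a"
  shows "mu b + 1 \<le> mu a"
proof (cases r)
  case Nil
  then show ?thesis using assms by (simp add: mu_def)
next
  case (Cons x xs)
  then have "x < n" using ts_n[OF c] t by auto
  from h_le[OF c this] show ?thesis using assms Cons by (simp add: mu_def)
qed

lemma wt_update:
  assumes "w < n" and "\<And>v. v \<noteq> w \<Longrightarrow> ah b v = ah a v \<and> acu b v = acu a v"
    and "(deg w + 3) * ah b w + acu b w + (if ah b w = H then (H + 2) * (deg w + 1) else 0) =
      (deg w + 3) * ah a w + acu a w + (if ah a w = H then (H + 2) * (deg w + 1) else 0) + x"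
  shows "wt b = wt a + x"
proof -
  have "wt b = (\<Sum>v<n. (deg v + 3) * ah a v + acu a v + (if ah a v = H then (H + 2) * (deg v + 1) else 0)
     + (if v = w then x else 0))"
    unfolding wt_def using assms(2,3) by (intro sum.cong refl) (case_tac "v = w", auto)
  then show ?thesis using assms(1) by (simp add: wt_def sum.distrib)
qed

lemma cut_potential:
  assumes m: "main a" and c: "core b" and S: "S \<subseteq> {v. v < n \<and> ah a v < H}"
    and b: "ah b = ah (cutset a S)" "acu b = acu a" "length (ts b) = length (ts a) + x"
    and x: "2 * x \<le> dvol S" and S0: "S \<noteq> {}"
  shows "mu b + wt a + (dvol S + card S) \<le> mu a + wt b"
proof -
  have Sn: "S \<subseteq> {..<n}" using S by auto
  then have fS: "finite S" using finite_subset by blast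
  have "wt a + (H + 2) * (dvol S + card S) = (\<Sum>v<n. (deg v + 3) * ah a v + acu a v +
      (if ah a v = H then (H + 2) * (deg v + 1) else 0)) + (\<Sum>v<n. if v \<in> S then (H + 2) * (deg v + 1) else 0)"
  proof -
    have "(\<Sum>v<n. if v \<in> S then (H + 2) * (deg v + 1) else 0) = (\<Sum>v\<in>S. (H + 2) * (deg v + 1))"
      using Sn by (simp add: sum.inter_restrict[symmetric] Int_absorb1)
    then show ?thesis unfolding wt_def dvol_def
      by (simp only: sum_distrib_left[symmetric] sum.distrib sum_constant) simp
  qed
  also have "\<dots> \<le> wt b"
    unfolding wt_def sum.distrib[symmetric] b cutset_def
    using S by (intro sum_mono) auto
  finally have w: "wt a + (H + 2) * (dvol S + card S) \<le> wt b" .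
  have "mu b \<le> (H + 1) * length (ts b) + H"
  proof (cases "ts b")
    case (Cons v vs)
    then show ?thesis using h_le[OF c, of v] ts_n[OF c] by (simp add: mu_def)
  qed (simp add: mu_def)
  also have "\<dots> \<le> mu a + (H + 1) * x + H" unfolding b by (simp add: mu_def algebra_simps)
  also have "\<dots> \<le> mu a + (H + 1) * dvol S + (H + 1) * card S"
  proof -
    have "x \<le> dvol S" using x by simp
    then have "(H + 1) * x \<le> (H + 1) * dvol S" by (rule mult_le_mono2)
    moreover have "1 \<le> card S" using S0 fS by (simp add: Suc_leI card_gt_0_iff)
    then have "H \<le> (H + 1) * card S" using mult_le_mono2[of 1 "card S" "H + 1"] by simp
    ultimately show ?thesis by (intro add_mono order.refl)
  qed
  finally show ?thesis using w by (simp add: algebra_simps)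
qed

lemma main_init:
  assumes "\<And>v. count_list xs v = k * d v" "set xs \<subseteq> {..<n}"
  shows "main \<lparr>ac = \<lambda>_. 0, ah = \<lambda>_. 0, acu = \<lambda>_. 0, fl = \<lambda>_ _. 0, ts = xs\<rparr>" (is "main ?a")
proof -
  have "length xs = (\<Sum>v<n. count_list xs v)"
    using assms(2) sum_count_set[of xs "{..<n}"] by simp
  then have l: "length xs = k * T" using assms(1) d_T by (simp add: sum_distrib_left[symmetric])
  have P: "pset (ah ?a) = {}" using H_ge by (auto simp: pset_def)
  then show ?thesis using assms l H_ge
    by (auto simp: main_def core_def deficit_def dvol_def ecut_def)
qed

end

section \<open>The pruning program\<close>

text \<open>
  Registers: 0 number of nodes; 3, 5, 6, 7, 8, 9 base addresses of the arrays of absorbed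
  tokens, labels, current arcs, row pointers, removed nodes and waiting tokens; 10 capacity;
  11 maximal label; 12 number of waiting tokens; 13 number of removed nodes; 14 next free row;
  15 and 16 the constants 1 and 0. The flow from \<open>u\<close> to \<open>v\<close> is in the real memory at
  \<open>row u + v\<close>; rows are allocated on the first write, and the never written row 0
  stands for all rows that are not allocated.
\<close>

definition Ensure :: "nat \<Rightarrow> cmd" where
  "Ensure r = Do [IAdd 40 7 r, IRead 41 40] ;;
     Cond (ILe 15 41) (Do []) (Do [IWrite 40 14, IAdd 14 14 0])"

definition Push :: cmd where
  "Push = Ensure 17 ;; Ensure 18 ;;
     Do [IAdd 40 7 17, IRead 40 40, IAdd 40 40 18, RRead 4 40, RAdd 4 4 2, RWrite 40 4,
         IAdd 40 7 18, IRead 40 40, IAdd 40 40 17, RRead 4 40, RSub 4 4 2, RWrite 40 4]"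

definition Visit :: "cmd \<Rightarrow> cmd" where
  "Visit A = Do [IAdd 52 50 51, IRead 18 52, IAdd 52 5 18, IRead 55 52,
              IAdd 56 7 17, IRead 56 56, IAdd 56 56 18, RRead 3 56] ;;
       Cond (ILe 11 55) (Do []) (Cond (RLe 1 3) (Do []) A) ;;
       Do [IAdd 51 51 15]"

definition Scan :: "cmd \<Rightarrow> cmd" where
  "Scan A = Do [IAdd 48 43 16] ;; Until (ILe 47 48) (
     Do [IAdd 49 8 48, IRead 17 49, IAdd 50 17 17, IRead 54 50, IAdd 50 50 15, IRead 50 50,
         IConst 51 0] ;;
     Until (ILe 54 51) (Visit A) ;;
     Do [IAdd 48 48 15])"

definition Count :: cmd where
  "Count = Do [IConst 45 0, IAdd 47 13 16] ;; Scan (Do [IAdd 45 45 46])"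

definition Append :: cmd where
  "Append = Do [IAdd 47 13 16] ;;
     Scan (Do [IWrite 52 11, IAdd 42 8 13, IWrite 42 18, IAdd 13 13 15,
               IAdd 53 18 18, IRead 53 53, IAdd 44 44 53]) ;;
     Do [IAdd 43 47 16]"

definition Emit :: cmd where
  "Emit = Do [IAdd 47 13 16] ;;
     Scan (Until (RLe 1 3) (Push ;; Do [RAdd 3 3 2, IAdd 42 9 12, IWrite 42 18, IAdd 12 12 15]))"

definition Cut :: cmd where
  "Cut = Do [IAdd 42 8 13, IWrite 42 17, IAdd 43 13 16, IAdd 13 13 15, IAdd 44 24 16,
             IAdd 46 10 10, IAdd 46 46 46] ;;
     Count ;; Until (ILe 45 44) (Append ;; Count) ;; Emit"

definition Skip :: cmd where "Skip = Do [IAdd 28 28 15, IWrite 27 28]"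

definition Move :: cmd where "Move = Push ;; Do [IWrite 20 18]"

definition Body :: cmd where
  "Body = Do [ISub 20 12 15, IAdd 20 9 20, IRead 17 20, IAdd 21 5 17, IRead 22 21] ;;
     Cond (ILe 11 22) (Do [ISub 12 12 15])
      (Do [IAdd 23 17 17, IRead 24 23, IAdd 25 3 17, IRead 26 25] ;;
       Cond (ILe 24 26)
        (Do [IAdd 27 6 17, IRead 28 27] ;;
         Cond (ILe 24 28)
          (Do [IAdd 22 22 15, IWrite 21 22] ;; Cond (ILe 11 22) Cut (Do [IWrite 27 16]))
          (Do [IAdd 23 23 15, IRead 29 23, IAdd 29 29 28, IRead 18 29,
               IAdd 30 7 17, IRead 30 30, IAdd 30 30 18, RRead 3 30,
               IAdd 31 5 18, IRead 31 31] ;;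
           Cond (RLe 1 3) Skip (Cond (ILe 22 31) Skip Move)))
        (Do [IAdd 26 26 15, IWrite 25 26, ISub 12 12 15]))"

lemmas wp_simps = wp_Do wp_Seq wp_Cond

lemma wp_Until_measure:
  assumes "I s"
    and body: "\<And>s. I s \<Longrightarrow> \<not> holds b s \<Longrightarrow> wp c (\<lambda>s'. I (tick 1 s') \<and> m (tick 1 s') < (m s :: nat)) (tick 1 s)"
    and exit: "\<And>s. I s \<Longrightarrow> holds b s \<Longrightarrow> Q (tick 1 s)"
  shows "wp (Until b c) Q s"
  using \<open>I s\<close>
proof (induction "m s" arbitrary: s rule: less_induct)
  case less
  show ?case
  proof (cases "holds b s")
    case True
    then show ?thesis using exit[OF less.prems True] big.UntilT unfolding wp_def by blast
  next
    case False
    from body[OF less.prems False] obtain s1 where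
      s1: "big c (tick 1 s) s1" "I (tick 1 s1)" "m (tick 1 s1) < m s" unfolding wp_def by auto
    from less.hyps[OF s1(3,2)] show ?thesis
      using s1(1) False big.UntilF unfolding wp_def by blast
  qed
qed

locale prog = net +
  fixes M :: "nat \<Rightarrow> nat" and f :: nat
  assumes M_deg: "v < n \<Longrightarrow> M (2 * v) = deg v"
    and M_nb: "v < n \<Longrightarrow> j < deg v \<Longrightarrow> M (M (2 * v + 1) + j) = nb v j"
    and M_adr: "v < n \<Longrightarrow> M (2 * v + 1) + deg v \<le> f"
    and f_ge: "2 * n \<le> f"
begin

definition arr :: "(nat \<Rightarrow> nat) \<Rightarrow> nat \<Rightarrow> (nat \<Rightarrow> nat) \<Rightarrow> nat \<Rightarrow> bool" where
  "arr I b g l \<longleftrightarrow> (\<forall>i<l. I (b + i) = g i)"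

definition flows :: "(nat \<Rightarrow> nat) \<Rightarrow> nat \<Rightarrow> (nat \<Rightarrow> real) \<Rightarrow> (nat \<Rightarrow> nat \<Rightarrow> int) \<Rightarrow> nat \<Rightarrow> bool" where
  "flows I b R F tp \<longleftrightarrow>
     (\<forall>u<n. \<forall>v<n. R (I (b + u) + v) = real_of_int (F u v)) \<and>
     (\<forall>i<n. R i = 0) \<and> (\<forall>i\<ge>tp. R i = 0) \<and> n \<le> tp \<and>
     (\<forall>u<n. I (b + u) = 0 \<or> n \<le> I (b + u) \<and> I (b + u) + n \<le> tp) \<and>
     (\<forall>u<n. \<forall>v<n. u \<noteq> v \<and> I (b + u) \<noteq> 0 \<longrightarrow> I (b + u) + n \<le> I (b + v) \<or> I (b + v) + n \<le> I (b + u))"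

lemma flowsD:
  assumes "flows I b R F tp"
  shows flows_range: "u < n \<Longrightarrow> I (b + u) = 0 \<or> n \<le> I (b + u) \<and> I (b + u) + n \<le> tp"
    and flows_sep: "u < n \<Longrightarrow> v < n \<Longrightarrow> u \<noteq> v \<and> I (b + u) \<noteq> 0 \<longrightarrow>
       I (b + u) + n \<le> I (b + v) \<or> I (b + v) + n \<le> I (b + u)"
    and flows_low: "i < n \<Longrightarrow> R i = 0"
    and flows_high: "tp \<le> i \<Longrightarrow> R i = 0"
    and flows_top: "n \<le> tp"
proof -
  note F = assms[unfolded flows_def]
  show "u < n \<Longrightarrow> I (b + u) = 0 \<or> n \<le> I (b + u) \<and> I (b + u) + n \<le> tp"
    using F[THEN conjunct2, THEN conjunct2, THEN conjunct2, THEN conjunct2, THEN conjunct1] by simp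
  show "u < n \<Longrightarrow> v < n \<Longrightarrow> u \<noteq> v \<and> I (b + u) \<noteq> 0 \<longrightarrow>
       I (b + u) + n \<le> I (b + v) \<or> I (b + v) + n \<le> I (b + u)"
    using F[THEN conjunct2, THEN conjunct2, THEN conjunct2, THEN conjunct2, THEN conjunct2] by simp
qed (use assms in \<open>simp_all add: flows_def\<close>)

definition mem :: "(nat \<Rightarrow> nat) \<Rightarrow> (nat \<Rightarrow> real) \<Rightarrow> ast \<Rightarrow> nat list \<Rightarrow> nat \<Rightarrow> bool" where
  "mem I R a q tp \<longleftrightarrow>
     arr I 0 M f \<and> arr I f (ac a) n \<and> arr I (f + n) (ah a) n \<and> arr I (f + 2 * n) (acu a) n \<and>
     flows I (f + 3 * n) R (fl a) tp \<and> arr I (f + 4 * n) ((!) q) (length q) \<and>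
     arr I (f + 5 * n) ((!) (rev (ts a))) (length (ts a)) \<and>
     length q \<le> n \<and> set q \<subseteq> {..<n}"

lemma arr_out: "arr I b g l \<Longrightarrow> p < b \<or> b + l \<le> p \<Longrightarrow> arr (I(p := x)) b g l"
  unfolding arr_def by auto

lemma arr_in: "arr I b g l \<Longrightarrow> arr (I(b + i := x)) b (g(i := x)) l"
  unfolding arr_def by auto

lemma arr_snoc: "arr I b ((!) q) (length q) \<Longrightarrow> arr (I(b + length q := x)) b ((!) (q @ [x])) (Suc (length q))"
  unfolding arr_def by (auto simp: nth_append less_Suc_eq)

lemma flows_out:
  assumes "flows I b R F tp" "p < b \<or> b + n \<le> p"
  shows "flows (I(p := x)) b R F tp"
proof -
  have "(I(p := x)) (b + u) = I (b + u)" if "u < n" for u using assms(2) that by auto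
  then show ?thesis using assms(1) unfolding flows_def by (simp del: fun_upd_apply)
qed

definition regs :: "mst \<Rightarrow> ast \<Rightarrow> nat list \<Rightarrow> bool" where
  "regs s a q \<longleftrightarrow> ir s 0 = n \<and> ir s 3 = f \<and> ir s 5 = f + n \<and> ir s 6 = f + 2 * n \<and>
     ir s 7 = f + 3 * n \<and> ir s 8 = f + 4 * n \<and> ir s 9 = f + 5 * n \<and> ir s 10 = k \<and> ir s 11 = H \<and>
     ir s 12 = length (ts a) \<and> ir s 13 = length q \<and> ir s 15 = 1 \<and> ir s 16 = 0 \<and>
     rr s (Suc 0) = real k \<and> rr s 2 = 1"

definition rep :: "mst \<Rightarrow> ast \<Rightarrow> nat list \<Rightarrow> bool" where
  "rep s a q \<longleftrightarrow> regs s a q \<and> mem (im s) (rm s) a q (ir s 14)"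

lemma memD:
  assumes "mem I R a q tp"
  shows mem_M: "i < f \<Longrightarrow> I i = M i"
    and mem_c: "v < n \<Longrightarrow> I (f + v) = ac a v"
    and mem_h: "v < n \<Longrightarrow> I (f + n + v) = ah a v"
    and mem_cu: "v < n \<Longrightarrow> I (f + 2 * n + v) = acu a v"
    and mem_q: "i < length q \<Longrightarrow> I (f + 4 * n + i) = q ! i"
    and mem_ts: "i < length (ts a) \<Longrightarrow> I (f + 5 * n + i) = rev (ts a) ! i"
    and mem_fl: "u < n \<Longrightarrow> v < n \<Longrightarrow> R (I (f + 3 * n + u) + v) = real_of_int (fl a u v)"
    and mem_qn: "length q \<le> n" "set q \<subseteq> {..<n}"
    and mem_top: "n \<le> tp"
    and mem_flows: "flows I (f + 3 * n) R (fl a) tp"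
  using assms unfolding mem_def arr_def flows_def by simp_all

lemma mem_deg: "mem I R a q tp \<Longrightarrow> v < n \<Longrightarrow> I (v + v) = deg v"
  using mem_M[of I R a q tp "2 * v"] M_deg[of v] f_ge by (simp add: mult_2)

lemma mem_nb:
  assumes "mem I R a q tp" "v < n" "j < deg v"
  shows "I (I (Suc (v + v)) + j) = nb v j"
proof -
  have "I (2 * v + 1) = M (2 * v + 1)" using mem_M[OF assms(1)] assms(2) f_ge by simp
  moreover have "I (M (2 * v + 1) + j) = M (M (2 * v + 1) + j)"
    using mem_M[OF assms(1)] M_adr[OF assms(2)] assms(3) by simp
  ultimately show ?thesis using M_nb[OF assms(2,3)] by (simp add: mult_2)
qed

lemma upd_c: "mem I R a q tp \<Longrightarrow> v < n \<Longrightarrow>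
    mem (I(f + v := x)) R (a\<lparr>ac := (ac a)(v := x)\<rparr>) q tp"
  unfolding mem_def by (simp add: arr_out arr_in flows_out)

lemma upd_h: "mem I R a q tp \<Longrightarrow> v < n \<Longrightarrow>
    mem (I(f + n + v := x)) R (a\<lparr>ah := (ah a)(v := x)\<rparr>) q tp"
  unfolding mem_def by (simp add: arr_out arr_in flows_out)

lemma upd_cu: "mem I R a q tp \<Longrightarrow> v < n \<Longrightarrow>
    mem (I(f + 2 * n + v := x)) R (a\<lparr>acu := (acu a)(v := x)\<rparr>) q tp"
  unfolding mem_def by (simp add: arr_out arr_in flows_out)

lemma upd_q: "mem I R a q tp \<Longrightarrow> v < n \<Longrightarrow> length q < n \<Longrightarrow>
    mem (I(f + 4 * n + length q := v)) R a (q @ [v]) tp"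
  unfolding mem_def by (simp add: arr_out arr_snoc flows_out)

lemma upd_push: "mem I R a q tp \<Longrightarrow>
    mem (I(f + 5 * n + length (ts a) := v)) R (a\<lparr>ts := v # ts a\<rparr>) q tp"
  unfolding mem_def using arr_snoc[of I "f + 5 * n" "rev (ts a)" v] by (simp add: arr_out flows_out)

lemma upd_pop: "mem I R a q tp \<Longrightarrow> ts a = w # r \<Longrightarrow> mem I R (a\<lparr>ts := r\<rparr>) q tp"
  unfolding mem_def arr_def by (simp add: nth_append)

lemma upd_row: 
  assumes m: "mem I R a q tp" and u: "u < n" and 0: "I (f + 3 * n + u) = 0"
  shows "mem (I(f + 3 * n + u := tp)) R a q (tp + n)"
proof -
  note F = mem_flows[OF m, unfolded flows_def]
  have z: "fl a u v = 0" if "v < n" for v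
    using mem_fl[OF m u that] 0 F that by simp
  have "flows (I(f + 3 * n + u := tp)) (f + 3 * n) R (fl a) (tp + n)"
    unfolding flows_def
  proof (intro conjI)
    show "\<forall>x<n. \<forall>y<n. R ((I(f + 3 * n + u := tp)) (f + 3 * n + x) + y) = real_of_int (fl a x y)"
      using F z by simp
    show "\<forall>x<n. (I(f + 3 * n + u := tp)) (f + 3 * n + x) = 0 \<or> n \<le> (I(f + 3 * n + u := tp)) (f + 3 * n + x) \<and>
        (I(f + 3 * n + u := tp)) (f + 3 * n + x) + n \<le> tp + n"
    proof (intro allI impI)
      fix x assume "x < n"
      with F have "I (f + 3 * n + x) = 0 \<or> n \<le> I (f + 3 * n + x) \<and> I (f + 3 * n + x) + n \<le> tp" "n \<le> tp" by blast+
      then show "(I(f + 3 * n + u := tp)) (f + 3 * n + x) = 0 \<or> n \<le> (I(f + 3 * n + u := tp)) (f + 3 * n + x) \<and>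
        (I(f + 3 * n + u := tp)) (f + 3 * n + x) + n \<le> tp + n" by auto
    qed
    show "\<forall>x<n. \<forall>y<n. x \<noteq> y \<and> (I(f + 3 * n + u := tp)) (f + 3 * n + x) \<noteq> 0 \<longrightarrow>
       (I(f + 3 * n + u := tp)) (f + 3 * n + x) + n \<le> (I(f + 3 * n + u := tp)) (f + 3 * n + y) \<or>
       (I(f + 3 * n + u := tp)) (f + 3 * n + y) + n \<le> (I(f + 3 * n + u := tp)) (f + 3 * n + x)"
    proof (intro allI impI)
      fix x y assume xy: "x < n" "y < n" "x \<noteq> y \<and> (I(f + 3 * n + u := tp)) (f + 3 * n + x) \<noteq> 0"
      have rx: "I (f + 3 * n + x) = 0 \<or> I (f + 3 * n + x) + n \<le> tp"
        and ry: "I (f + 3 * n + y) = 0 \<or> I (f + 3 * n + y) + n \<le> tp" and nt: "n \<le> tp"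
        using F xy by blast+
      have "x = u \<or> y = u \<or> I (f + 3 * n + x) + n \<le> I (f + 3 * n + y) \<or> I (f + 3 * n + y) + n \<le> I (f + 3 * n + x)"
      proof (cases "x = u")
        case False
        then have "I (f + 3 * n + x) \<noteq> 0" using xy by simp
        then show ?thesis using F xy by blast
      qed simp
      then show "(I(f + 3 * n + u := tp)) (f + 3 * n + x) + n \<le> (I(f + 3 * n + u := tp)) (f + 3 * n + y) \<or>
       (I(f + 3 * n + u := tp)) (f + 3 * n + y) + n \<le> (I(f + 3 * n + u := tp)) (f + 3 * n + x)"
        using xy rx ry nt by auto
    qed
  qed (use F in auto)
  then show ?thesis using m u unfolding mem_def by (simp add: arr_out)
qed

lemma upd_flow:
  assumes m: "mem I R a q tp" and u: "u < n" "v < n" "u \<noteq> v"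
    and r: "I (f + 3 * n + u) \<noteq> 0" "I (f + 3 * n + v) \<noteq> 0"
  shows "mem I (R(I (f + 3 * n + u) + v := real_of_int (fl a u v) + 1,
      I (f + 3 * n + v) + u := real_of_int (fl a v u) - 1)) (a\<lparr>fl := addf (fl a) u v\<rparr>) q tp"
    (is "mem I ?R ?a q tp")
proof -
  let ?r = "\<lambda>u. I (f + 3 * n + u)"
  note FF = mem_flows[OF m]
  have sep: "?r x + n \<le> ?r y \<or> ?r y + n \<le> ?r x" if "x \<noteq> y" "x < n" "y < n" "?r x \<noteq> 0" for x y
    using flows_sep[OF FF that(2,3)] that(1,4) by blast
  have rg: "n \<le> ?r x \<and> ?r x + n \<le> tp" if "x < n" "?r x \<noteq> 0" for x
    using flows_range[OF FF that(1)] that(2) by blast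
  have ne: "?r x + y \<noteq> ?r u' + v'" if "x < n" "y < n" "u' < n" "v' < n" "?r u' \<noteq> 0" "(x, y) \<noteq> (u', v')"
    for x y u' v'
  proof (cases "x = u'")
    case False
    then have "?r u' + n \<le> ?r x \<or> ?r x + n \<le> ?r u'" using sep[of u' x] that by simp
    then show ?thesis using that by linarith
  qed (use that in simp)
  have F: "\<forall>x<n. \<forall>y<n. ?R (?r x + y) = real_of_int (fl ?a x y)"
  proof (intro allI impI)
    fix x y assume xy: "x < n" "y < n"
    show "?R (?r x + y) = real_of_int (fl ?a x y)"
    proof (cases "(x, y) = (v, u)")
      case True then show ?thesis using u by (simp add: addf_def)
    next
      case False
      note 1 = ne[OF xy u(2,1) r(2) False]
      show ?thesis
      proof (cases "(x, y) = (u, v)")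
        case True then show ?thesis using 1 u by (simp add: addf_def)
      next
        case F2: False
        have "fl ?a x y = fl a x y" using False F2 by (auto simp: addf_def)
        then show ?thesis using 1 ne[OF xy u(1,2) r(1) F2] mem_fl[OF m xy] by simp
      qed
    qed
  qed
  have "?R i = 0" if "i < n" for i
    using flows_low[OF FF that] that rg[OF u(1) r(1)] rg[OF u(2) r(2)] by simp
  moreover have "?R i = 0" if "tp \<le> i" for i
    using flows_high[OF FF that] that rg[OF u(1) r(1)] rg[OF u(2) r(2)] u by simp
  ultimately have "flows I (f + 3 * n) ?R (fl ?a) tp"
    using F flows_range[OF FF] flows_sep[OF FF] flows_top[OF FF] unfolding flows_def by blast
  with m show ?thesis unfolding mem_def by simp
qed

lemma repD:
  assumes "rep s a q"
  shows "ir s 0 = n" "ir s 3 = f" "ir s 5 = f + n" "ir s 6 = f + 2 * n"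
     "ir s 7 = f + 3 * n" "ir s 8 = f + 4 * n" "ir s 9 = f + 5 * n" "ir s 10 = k" "ir s 11 = H"
     "ir s 12 = length (ts a)" "ir s 13 = length q" "ir s 15 = 1" "ir s 16 = 0"
     "rr s (Suc 0) = real k" "rr s 2 = 1" and rep_mem: "mem (im s) (rm s) a q (ir s 14)"
  using assms unfolding rep_def regs_def by blast+

lemma real_le_flow: "real k \<le> real_of_int z \<longleftrightarrow> int k \<le> z" by linarith

lemma wp_Ensure:
  assumes r: "rep s a q" and x: "ir s x = u" "u < n" "x \<noteq> 40" "x \<noteq> 41" "x \<noteq> 14"
  shows "wp (Ensure x) (\<lambda>s'. rep s' a q \<and> im s' (f + 3 * n + u) \<noteq> 0 \<and>
     (\<forall>v<n. im s (f + 3 * n + v) \<noteq> 0 \<longrightarrow> im s' (f + 3 * n + v) \<noteq> 0) \<and>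
     (\<forall>y. y \<notin> {14, 40, 41} \<longrightarrow> ir s' y = ir s y) \<and> rr s' = rr s \<and> tm s' \<le> tm s + 6) s"
proof -
  note [simp] = repD(1-15)[OF r] x
  note m = rep_mem[OF r]
  have "ir s 14 \<noteq> 0" using mem_top[OF m] x(2) by linarith
  then show ?thesis
    using upd_row[OF m x(2)] m
    by (auto simp: Ensure_def wp_simps rep_def regs_def)
qed

lemma wp_Push:
  assumes r: "rep s a q" and x: "ir s 17 = u" "ir s 18 = v" "u < n" "v < n" "u \<noteq> v"
  shows "wp Push (\<lambda>s'. rep s' (a\<lparr>fl := addf (fl a) u v\<rparr>) q \<and>
     (\<forall>y. y \<notin> {14, 40, 41} \<longrightarrow> ir s' y = ir s y) \<and> (\<forall>y. y \<noteq> 4 \<longrightarrow> rr s' y = rr s y) \<and> tm s' \<le> tm s + 30) s"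
  unfolding Push_def wp_Seq
proof (rule wp_mono[OF wp_Ensure[OF r x(1,3)]]; (elim conjE)?)
  fix s1 assume r1: "rep s1 a q" and nz1: "im s1 (f + 3 * n + u) \<noteq> 0"
    and i1: "\<forall>y. y \<notin> {14, 40, 41} \<longrightarrow> ir s1 y = ir s y" "rr s1 = rr s" and t1: "tm s1 \<le> tm s + 6"
  show "wp (Ensure 18) (wp (Do [IAdd 40 7 17, IRead 40 40, IAdd 40 40 18, RRead 4 40, RAdd 4 4 2, RWrite 40 4,
         IAdd 40 7 18, IRead 40 40, IAdd 40 40 17, RRead 4 40, RSub 4 4 2, RWrite 40 4])
     (\<lambda>s'. rep s' (a\<lparr>fl := addf (fl a) u v\<rparr>) q \<and>
     (\<forall>y. y \<notin> {14, 40, 41} \<longrightarrow> ir s' y = ir s y) \<and> (\<forall>y. y \<noteq> 4 \<longrightarrow> rr s' y = rr s y) \<and> tm s' \<le> tm s + 30)) s1"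
  proof (rule wp_mono[OF wp_Ensure[OF r1 _ x(4)]]; (elim conjE)?)
    fix s2 assume r2: "rep s2 a q" and nzv: "im s2 (f + 3 * n + v) \<noteq> 0"
      and nz: "\<forall>v<n. im s1 (f + 3 * n + v) \<noteq> 0 \<longrightarrow> im s2 (f + 3 * n + v) \<noteq> 0"
      and i2: "\<forall>y. y \<notin> {14, 40, 41} \<longrightarrow> ir s2 y = ir s1 y" "rr s2 = rr s1" and t2: "tm s2 \<le> tm s1 + 6"
    have nzu: "im s2 (f + 3 * n + u) \<noteq> 0" using nz nz1 x by blast
    note m = rep_mem[OF r2]
    have [simp]: "ir s2 17 = u" "ir s2 18 = v" using i1 i2 x by auto
    have sep: "im s2 (f + 3 * n + v) + u \<noteq> im s2 (f + 3 * n + u) + v"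
    proof -
      have "im s2 (f + 3 * n + u) + n \<le> im s2 (f + 3 * n + v) \<or> im s2 (f + 3 * n + v) + n \<le> im s2 (f + 3 * n + u)"
        using mem_flows[OF m, unfolded flows_def] x nzu by blast
      then show ?thesis using x by auto
    qed
    show "wp (Do [IAdd 40 7 17, IRead 40 40, IAdd 40 40 18, RRead 4 40, RAdd 4 4 2, RWrite 40 4,
         IAdd 40 7 18, IRead 40 40, IAdd 40 40 17, RRead 4 40, RSub 4 4 2, RWrite 40 4])
     (\<lambda>s'. rep s' (a\<lparr>fl := addf (fl a) u v\<rparr>) q \<and>
     (\<forall>y. y \<notin> {14, 40, 41} \<longrightarrow> ir s' y = ir s y) \<and> (\<forall>y. y \<noteq> 4 \<longrightarrow> rr s' y = rr s y) \<and> tm s' \<le> tm s + 30) s2"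
      using upd_flow[OF m x(3,4,5) nzu nzv] repD(1-15)[OF r2] i1 i2 t1 t2 sep
        mem_fl[OF m x(3,4)] mem_fl[OF m x(4,3)]
      by (simp add: wp_simps rep_def regs_def)
  qed (use i1 x in auto)
qed simp_all

lemma top_read:
  assumes "mem I R a q tp" "ts a = w # r"
  shows "I (f + 5 * n + length r) = w"
  using mem_ts[OF assms(1), of "length r"] assms(2) by (simp add: nth_append)

lemma body_discard:
  assumes r: "rep s a q" and m: "main a" and t: "ts a = w # r" "ah a w = H"
  shows "wp Body (\<lambda>s'. rep s' (a\<lparr>ts := r\<rparr>) q \<and> tm s' \<le> tm s + 50) s"
proof -
  note mm = rep_mem[OF r]
  have w: "w < n" using m t ts_n[of a] by (auto simp: main_def)
  show ?thesis
    using repD(1-15)[OF r] t top_read[OF mm t(1)] mem_h[OF mm w] upd_pop[OF mm t(1)]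
    by (simp add: Body_def wp_simps rep_def regs_def)
qed

lemma body_absorb:
  assumes r: "rep s a q" and m: "main a" and t: "ts a = w # r" "ah a w \<noteq> H" "ac a w < deg w"
  shows "wp Body (\<lambda>s'. rep s' (a\<lparr>ac := (ac a)(w := Suc (ac a w)), ts := r\<rparr>) q \<and> tm s' \<le> tm s + 50) s"
proof -
  note mm = rep_mem[OF r]
  have w: "w < n" and h: "ah a w < H" using m t ts_n[of a] h_le[of a w] by (auto simp: main_def)
  show ?thesis
    using repD(1-15)[OF r] t h top_read[OF mm t(1)] mem_h[OF mm w] mem_c[OF mm w] mem_deg[OF mm w]
      upd_pop[OF upd_c[OF mm w, of "Suc (ac a w)"], of w r]
    by (simp add: Body_def wp_simps rep_def regs_def)
qed

lemma body_skip:
  assumes r: "rep s a q" and m: "main a" and t: "ts a = w # r" "ah a w \<noteq> H" "ac a w = deg w" "acu a w < deg w"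
    and na: "\<not> (fl a w (nb w (acu a w)) < int k \<and> ah a (nb w (acu a w)) < ah a w)"
  shows "wp Body (\<lambda>s'. rep s' (a\<lparr>acu := (acu a)(w := Suc (acu a w))\<rparr>) q \<and> tm s' \<le> tm s + 50) s"
proof -
  note mm = rep_mem[OF r]
  have w: "w < n" and h: "ah a w < H" using m t ts_n[of a] h_le[of a w] by (auto simp: main_def)
  have u: "nb w (acu a w) < n" using nb_E[OF w t(4)] E_n by blast
  from na have "int k \<le> fl a w (nb w (acu a w)) \<or> ah a w \<le> ah a (nb w (acu a w))" by auto
  then show ?thesis
    using repD(1-15)[OF r] t h top_read[OF mm t(1)] mem_h[OF mm w] mem_c[OF mm w] mem_deg[OF mm w]
      mem_cu[OF mm w] mem_nb[OF mm w t(4)] mem_h[OF mm u] mem_fl[OF mm w u]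
      upd_cu[OF mm w, of "Suc (acu a w)"]
    by (elim disjE) (simp_all add: Body_def Skip_def wp_simps rep_def regs_def real_le_flow)
qed

lemma body_move:
  assumes r: "rep s a q" and m: "main a" and t: "ts a = w # r" "ah a w \<noteq> H" "ac a w = deg w" "acu a w < deg w"
    and u: "u = nb w (acu a w)" and adm: "fl a w u < int k" "ah a u < ah a w"
  shows "wp Body (\<lambda>s'. rep s' (a\<lparr>fl := addf (fl a) w u, ts := u # r\<rparr>) q \<and> tm s' \<le> tm s + 80) s"
proof -
  note mm = rep_mem[OF r]
  have w: "w < n" and h: "ah a w < H" using m t ts_n[of a] h_le[of a w] by (auto simp: main_def)
  have E: "E w u" using nb_E[OF w t(4)] u by simp
  then have un: "u < n" "w \<noteq> u" using E_n E_ne by blast+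
  have mv: "wp Move (\<lambda>s''. rep s'' (a\<lparr>fl := addf (fl a) w u, ts := u # r\<rparr>) q \<and> tm s'' \<le> tm s' + 40) s'"
    if "rep s' a q" "ir s' 17 = w" "ir s' 18 = u" "ir s' 20 = f + 5 * n + length r" for s'
    unfolding Move_def wp_Seq
  proof (rule wp_mono[OF wp_Push[OF that(1-3) w un]], elim conjE)
    fix s1 assume r1: "rep s1 (a\<lparr>fl := addf (fl a) w u\<rparr>) q"
      and i1: "\<forall>y. y \<notin> {14, 40, 41} \<longrightarrow> ir s1 y = ir s' y" and t1: "tm s1 \<le> tm s' + 30"
    note m1 = rep_mem[OF r1]
    show "wp (Do [IWrite 20 18])
     (\<lambda>s''. rep s'' (a\<lparr>fl := addf (fl a) w u, ts := u # r\<rparr>) q \<and> tm s'' \<le> tm s' + 40) s1"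
      using repD(1-15)[OF r1] that i1 t1 t(1) upd_push[OF upd_pop[OF m1, of w r], of u]
      by (simp add: wp_simps rep_def regs_def)
  qed
  show ?thesis
    using repD(1-15)[OF r] t h adm top_read[OF mm t(1)] mem_h[OF mm w] mem_c[OF mm w] mem_deg[OF mm w]
      mem_cu[OF mm w] mem_nb[OF mm w t(4), folded u] mem_h[OF mm un(1)] mem_fl[OF mm w un(1)]
    apply (simp add: Body_def wp_simps real_le_flow)
    apply (rule wp_mono[OF mv])
    using mm apply (simp_all add: rep_def regs_def)
    done
qed

lemma body_relabel:
  assumes r: "rep s a q" and m: "main a" and t: "ts a = w # r" "Suc (ah a w) < H" "ac a w = deg w" "acu a w = deg w"
  shows "wp Body (\<lambda>s'. rep s' (a\<lparr>ah := (ah a)(w := Suc (ah a w)), acu := (acu a)(w := 0)\<rparr>) q \<and> tm s' \<le> tm s + 50) s"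
proof -
  note mm = rep_mem[OF r]
  have w: "w < n" using m t ts_n[of a] h_le[of a w] by (auto simp: main_def)
  show ?thesis
    using repD(1-15)[OF r] t top_read[OF mm t(1)] mem_h[OF mm w] mem_c[OF mm w] mem_deg[OF mm w]
      mem_cu[OF mm w] upd_cu[OF upd_h[OF mm w, of "Suc (ah a w)"] w, of 0]
    by (simp add: Body_def wp_simps rep_def regs_def)
qed

end

context prog
begin

lemma rep_upd [simp]:
  "rep (s\<lparr>tm := y\<rparr>) a q = rep s a q"
  "rep (s\<lparr>tm := y, ir := g\<rparr>) a q = rep (s\<lparr>ir := g\<rparr>) a q"
  "rep (s\<lparr>tm := y, rr := h\<rparr>) a q = rep (s\<lparr>rr := h\<rparr>) a q"
  "rep (s\<lparr>tm := y, ir := g, rr := h\<rparr>) a q = rep (s\<lparr>ir := g, rr := h\<rparr>) a q"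
  "rep (s\<lparr>ir := g, rr := rr s\<rparr>) a q = rep (s\<lparr>ir := g\<rparr>) a q"
  "x \<notin> {0, 3, 5, 6, 7, 8, 9, 10, 11, 12, 13, 14, 15, 16} \<Longrightarrow>
     rep (s\<lparr>ir := g(x := z)\<rparr>) a q = rep (s\<lparr>ir := g\<rparr>) a q"
  "x \<notin> {0, 3, 5, 6, 7, 8, 9, 10, 11, 12, 13, 14, 15, 16} \<Longrightarrow>
     rep (s\<lparr>ir := g(x := z), rr := h\<rparr>) a q = rep (s\<lparr>ir := g, rr := h\<rparr>) a q"
  "y \<notin> {Suc 0, 2} \<Longrightarrow> rep (s\<lparr>rr := h(y := c)\<rparr>) a q = rep (s\<lparr>rr := h\<rparr>) a q"
  by (simp_all add: rep_def regs_def)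

definition arcs :: "nat list \<Rightarrow> (nat \<times> nat) list" where
  "arcs us = concat (map (\<lambda>u. map (\<lambda>j. (u, nb u j)) [0..<deg u]) us)"

definition segm :: "nat \<Rightarrow> nat list \<Rightarrow> nat list \<Rightarrow> bool" where
  "segm b us q \<longleftrightarrow> (\<forall>i<length us. b + i < length q \<and> q ! (b + i) = us ! i)"

lemma arcs_snoc: "arcs (us @ [u]) = arcs us @ map (\<lambda>j. (u, nb u j)) [0..<deg u]"
  by (simp add: arcs_def)

lemma set_arcs: "set us \<subseteq> {..<n} \<Longrightarrow> set (arcs us) = {(u, v). u \<in> set us \<and> E u v}"
  using nb_E nb_ex by (fastforce simp: arcs_def image_iff)

lemma length_arcs: "distinct us \<Longrightarrow> length (arcs us) = dvol (set us)"
  by (simp add: arcs_def length_concat comp_def dvol_def sum_list_distinct_conv_sum_set)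

lemma length_filter_row:
  assumes "u < n"
  shows "length (filter Q (map (\<lambda>j. nb u j) [0..<deg u])) = card {v. E u v \<and> Q v}"
proof -
  have i: "inj_on (nb u) {..<deg u}" and im: "nb u ` {..<deg u} = {v. E u v}"
    using nb[OF assms] by (auto simp: bij_betw_def)
  have d: "distinct (map (nb u) [0..<deg u])"
    using i by (simp add: distinct_map atLeast0LessThan)
  have "length (filter Q (map (nb u) [0..<deg u])) = card (set (filter Q (map (nb u) [0..<deg u])))"
    using distinct_card[OF distinct_filter[OF d]] by simp
  also have "set (filter Q (map (nb u) [0..<deg u])) = {v. E u v \<and> Q v}"
    using im by (auto simp: atLeast0LessThan)
  finally show ?thesis by simp
qed

lemma length_filter_arcs:
  assumes "distinct us" "set us \<subseteq> {..<n}"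
  shows "length (filter (\<lambda>(u, v). v \<in> B \<and> g u v < int k) (arcs us)) = resid g (set us) B"
  using assms
proof (induction us rule: rev_induct)
  case Nil
  then show ?case by (simp add: arcs_def resid_def)
next
  case (snoc u us)
  have "filter (\<lambda>(u, v). v \<in> B \<and> g u v < int k) (map (\<lambda>j. (u, nb u j)) [0..<deg u]) =
      map (Pair u) (filter (\<lambda>v. v \<in> B \<and> g u v < int k) (map (\<lambda>j. nb u j) [0..<deg u]))"
    by (simp add: filter_map comp_def)
  then have "length (filter (\<lambda>(u, v). v \<in> B \<and> g u v < int k) (map (\<lambda>j. (u, nb u j)) [0..<deg u])) =
      card {v. E u v \<and> v \<in> B \<and> g u v < int k}"
    using length_filter_row[of u "\<lambda>v. v \<in> B \<and> g u v < int k"] snoc.prems by simp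
  also have "{v. E u v \<and> v \<in> B \<and> g u v < int k} = {v \<in> B. E u v \<and> g u v < int k}" by blast
  finally show ?case using snoc by (simp add: arcs_snoc resid_def)
qed

lemma wp_Scan:
  fixes K :: "(nat \<times> nat) list \<Rightarrow> ast \<Rightarrow> nat list \<Rightarrow> nat \<Rightarrow> nat \<Rightarrow> bool"
  assumes us: "set us \<subseteq> {..<n}"
    and r: "rep s a q" "segm b us q" "K [] a q (ir s 44) (ir s 45)" "ir s 43 = b" "ir s 47 = b + length us"
      "ir s 46 = k4"
    and skip: "\<And>ps u v a q vol z. K ps a q vol z \<Longrightarrow> u \<in> set us \<Longrightarrow> E u v \<Longrightarrow>
        \<not> (ah a v < H \<and> fl a u v < int k) \<Longrightarrow> K (ps @ [(u, v)]) a q vol z"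
    and A: "\<And>ps u v a q s. rep s a q \<Longrightarrow> segm b us q \<Longrightarrow> K ps a q (ir s 44) (ir s 45) \<Longrightarrow> u \<in> set us \<Longrightarrow> E u v \<Longrightarrow>
        ir s 17 = u \<Longrightarrow> ir s 18 = v \<Longrightarrow> ir s 52 = f + n + v \<Longrightarrow> ir s 46 = k4 \<Longrightarrow>
        rr s 3 = real_of_int (fl a u v) \<Longrightarrow> ah a v < H \<Longrightarrow> fl a u v < int k \<Longrightarrow>
        wp A (\<lambda>s'. \<exists>a' q'. rep s' a' q' \<and> segm b us q' \<and> K (ps @ [(u, v)]) a' q' (ir s' 44) (ir s' 45) \<and>
          (\<forall>x\<in>{17, 43, 46, 47, 48, 50, 51, 54}. ir s' x = ir s x) \<and>
          tm s' + ce * length (ts a) \<le> tm s + c + ce * length (ts a')) s"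
  shows "wp (Scan A) (\<lambda>s'. \<exists>a' q'. rep s' a' q' \<and> segm b us q' \<and> K (arcs us) a' q' (ir s' 44) (ir s' 45) \<and>
     ir s' 43 = b \<and> ir s' 47 = b + length us \<and> ir s' 46 = k4 \<and>
     tm s' + ce * length (ts a) \<le> tm s + (c + 20) * length (arcs us) + 20 * length us + 5 + ce * length (ts a')) s"
proof -
  define J where "J i ps s' \<longleftrightarrow> (\<exists>a' q'. rep s' a' q' \<and> segm b us q' \<and> K ps a' q' (ir s' 44) (ir s' 45) \<and>
     ir s' 43 = b \<and> ir s' 47 = b + length us \<and> ir s' 46 = k4 \<and> ir s' 48 = b + i \<and> 
     tm s' + ce * length (ts a) \<le> tm s + 2 + (c + 20) * length ps + 20 * i + ce * length (ts a'))" for i ps s'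
  define I where "I i j s' \<longleftrightarrow> (\<exists>a' q'. rep s' a' q' \<and> segm b us q' \<and>
     K (arcs (take i us) @ map (\<lambda>j. (us ! i, nb (us ! i) j)) [0..<j]) a' q' (ir s' 44) (ir s' 45) \<and>
     ir s' 43 = b \<and> ir s' 47 = b + length us \<and> ir s' 46 = k4 \<and> ir s' 48 = b + i \<and> 
     ir s' 17 = us ! i \<and> ir s' 54 = deg (us ! i) \<and> ir s' 50 = M (2 * (us ! i) + 1) \<and> ir s' 51 = j \<and> j \<le> deg (us ! i) \<and>
     tm s' + ce * length (ts a) \<le> tm s + 2 + (c + 20) * (length (arcs (take i us)) + j) + 20 * i + 10 + ce * length (ts a'))" for i j s'
  have inner: "wp (Until (ILe 54 51) (Visit A)) (I i (deg (us ! i))) s1" if I0: "I i 0 (tick 1 s1)" and i: "i < length us" for i s1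
  proof -
    let ?u = "us ! i"
    have u: "?u < n" "?u \<in> set us" using us nth_mem[OF i] by auto
    have "wp (Until (ILe 54 51) (Visit A)) (I i (deg ?u)) s1"
    proof (rule wp_Until_measure[where I = "\<lambda>s. I i (ir s 51) (tick 1 s)" and m = "\<lambda>s. ir s 54 - ir s 51"])
      have "ir s1 51 = 0" using I0 by (auto simp: I_def)
      then show "I i (ir s1 51) (tick 1 s1)" using I0 by simp
    next
      fix s2 assume I2: "I i (ir s2 51) (tick 1 s2)" and ex: "\<not> holds (ILe 54 51) s2"
      let ?j = "ir s2 51"
      let ?ps = "arcs (take i us) @ map (\<lambda>j. (?u, nb ?u j)) [0..<?j]"
      from I2 obtain a2 q2 where r2: "rep s2 a2 q2" and K2: "segm b us q2" "K ?ps a2 q2 (ir s2 44) (ir s2 45)"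
        and g2: "ir s2 43 = b" "ir s2 47 = b + length us" "ir s2 46 = k4" "ir s2 48 = b + i"
         "ir s2 17 = ?u" "ir s2 54 = deg ?u" "ir s2 50 = M (2 * ?u + 1)"
        and t2: "tm s2 + 1 + ce * length (ts a) \<le> tm s + 2 + (c + 20) * (length (arcs (take i us)) + ?j) + 20 * i + 10 + ce * length (ts a2)"
        by (auto simp: I_def )
      have j: "?j < deg ?u" using ex g2 by simp
      note mm = rep_mem[OF r2]
      let ?v = "nb ?u ?j"
      have E: "E ?u ?v" using nb_E[OF u(1) j] .
      then have v: "?v < n" using E_n by blast
      have rv: "im s2 (M (Suc (2 * ?u)) + ?j) = ?v"
        using mem_M[OF mm] M_nb[OF u(1) j] M_adr[OF u(1)] j by simp
      define s3 where "s3 = s2\<lparr>tm := tm s2 + 9, ir := (ir s2)(18 := ?v, 52 := f + n + ?v, 55 := ah a2 ?v,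
         56 := im s2 (f + 3 * n + ?u) + ?v), rr := (rr s2)(3 := real_of_int (fl a2 ?u ?v))\<rparr>"
      have r3: "rep (s3\<lparr>tm := x\<rparr>) a2 q2" for x using r2 by (simp add: s3_def)
      have fin: "wp (Do [IAdd 51 51 15]) (\<lambda>s'. I i (ir (tick 1 s') 51) (tick 1 (tick 1 s')) \<and>
          ir (tick 1 s') 54 - ir (tick 1 s') 51 < ir s2 54 - ir s2 51) s4"
        if r4: "rep s4 a4 q4" and K4: "segm b us q4" "K (?ps @ [(?u, ?v)]) a4 q4 (ir s4 44) (ir s4 45)"
          and g4: "\<forall>x\<in>{17, 43, 46, 47, 48, 50, 51, 54}. ir s4 x = ir s2 x"
          and t4: "tm s4 + ce * length (ts a2) \<le> tm s2 + c + 14 + ce * length (ts a4)" for s4 a4 q4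
      proof -
        have "rep (s4\<lparr>tm := x, ir := (ir s4)(51 := Suc ?j)\<rparr>) a4 q4" for x
          using r4 by simp
        moreover have "tm s4 + 3 + ce * length (ts a) \<le> tm s + 2 + (c + 20) * (length (arcs (take i us)) + Suc ?j) + 20 * i + 10 + ce * length (ts a4)"
          using t4 t2 by (simp add: algebra_simps)
        ultimately show ?thesis
          using K4 g4 g2 j repD(12)[OF r4] by (auto simp: wp_simps I_def)
      qed
      have act3: "wp (Cond (ILe 11 55) (Do []) (Cond (RLe 1 3) (Do []) A))
         (\<lambda>s'. \<exists>a4 q4. rep s' a4 q4 \<and> segm b us q4 \<and> K (?ps @ [(?u, ?v)]) a4 q4 (ir s' 44) (ir s' 45) \<and>
           (\<forall>x\<in>{17, 43, 46, 47, 48, 50, 51, 54}. ir s' x = ir s2 x) \<and>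
           tm s' + ce * length (ts a2) \<le> tm s2 + c + 14 + ce * length (ts a4)) s3"
      proof (cases "ah a2 ?v < H \<and> fl a2 ?u ?v < int k")
        case True
        have "wp A (\<lambda>s'. \<exists>a' q'. rep s' a' q' \<and> segm b us q' \<and> K (?ps @ [(?u, ?v)]) a' q' (ir s' 44) (ir s' 45) \<and>
          (\<forall>x\<in>{17, 43, 46, 47, 48, 50, 51, 54}. ir s' x = ir (s3\<lparr>tm := tm s2 + 11\<rparr>) x) \<and>
          tm s' + ce * length (ts a2) \<le> tm (s3\<lparr>tm := tm s2 + 11\<rparr>) + c + ce * length (ts a')) (s3\<lparr>tm := tm s2 + 11\<rparr>)"
          using True by (intro A[OF r3 K2(1) _ u(2) E]) (simp_all add: s3_def g2 K2(2))
        then have w: "wp A (\<lambda>s'. \<exists>a' q'. rep s' a' q' \<and> segm b us q' \<and> K (?ps @ [(?u, ?v)]) a' q' (ir s' 44) (ir s' 45) \<and>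
          (\<forall>x\<in>{17, 43, 46, 47, 48, 50, 51, 54}. ir s' x = ir s2 x) \<and>
          tm s' + ce * length (ts a2) \<le> tm s2 + 11 + c + ce * length (ts a')) (s3\<lparr>tm := tm s2 + 11\<rparr>)"
          by (simp add: s3_def)
        have c1: "\<not> holds (ILe 11 55) s3" "\<not> holds (RLe 1 3) (tick 1 s3)" "tm s3 = tm s2 + 9"
          using True repD[OF r2] by (auto simp: s3_def real_le_flow)
        have "tick 1 (tick 1 s3) = s3\<lparr>tm := Suc (Suc (tm s3))\<rparr>" by simp
        also have "Suc (Suc (tm s3)) = tm s2 + 11" using c1(3) by simp
        finally have tt: "tick 1 (tick 1 s3) = s3\<lparr>tm := tm s2 + 11\<rparr>" .
        show ?thesis
          unfolding wp_Cond if_not_P[OF c1(1)] if_not_P[OF c1(2)]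
        proof (rule wp_mono)
          show "wp A (\<lambda>s'. \<exists>a' q'. rep s' a' q' \<and> segm b us q' \<and> K (?ps @ [(?u, ?v)]) a' q' (ir s' 44) (ir s' 45) \<and>
            (\<forall>x\<in>{17, 43, 46, 47, 48, 50, 51, 54}. ir s' x = ir s2 x) \<and>
            tm s' + ce * length (ts a2) \<le> tm s2 + 11 + c + ce * length (ts a')) (tick 1 (tick 1 s3))"
            unfolding tt by (rule w)
        next
          fix s' assume "\<exists>a' q'. rep s' a' q' \<and> segm b us q' \<and> K (?ps @ [(?u, ?v)]) a' q' (ir s' 44) (ir s' 45) \<and>
            (\<forall>x\<in>{17, 43, 46, 47, 48, 50, 51, 54}. ir s' x = ir s2 x) \<and>
            tm s' + ce * length (ts a2) \<le> tm s2 + 11 + c + ce * length (ts a')"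
          then obtain a' q' where "rep s' a' q'" "segm b us q'" "K (?ps @ [(?u, ?v)]) a' q' (ir s' 44) (ir s' 45)"
            "\<forall>x\<in>{17, 43, 46, 47, 48, 50, 51, 54}. ir s' x = ir s2 x"
            "tm s' + ce * length (ts a2) \<le> tm s2 + 11 + c + ce * length (ts a')" by blast
          then show "\<exists>a4 q4. rep (tick 1 (tick 1 s')) a4 q4 \<and> segm b us q4 \<and>
             K (?ps @ [(?u, ?v)]) a4 q4 (ir (tick 1 (tick 1 s')) 44) (ir (tick 1 (tick 1 s')) 45) \<and>
             (\<forall>x\<in>{17, 43, 46, 47, 48, 50, 51, 54}. ir (tick 1 (tick 1 s')) x = ir s2 x) \<and>
             tm (tick 1 (tick 1 s')) + ce * length (ts a2) \<le> tm s2 + c + 14 + ce * length (ts a4)"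
            by (intro exI[of _ a'] exI[of _ q']) simp
        qed
      next
        case False
        have "K (?ps @ [(?u, ?v)]) a2 q2 (ir s2 44) (ir s2 45)" by (rule skip[OF K2(2) u(2) E False])
        then have q: "\<exists>a4 q4. rep (s3\<lparr>tm := x\<rparr>) a4 q4 \<and> segm b us q4 \<and>
            K (?ps @ [(?u, ?v)]) a4 q4 (ir (s3\<lparr>tm := x\<rparr>) 44) (ir (s3\<lparr>tm := x\<rparr>) 45) \<and>
            (\<forall>y\<in>{17, 43, 46, 47, 48, 50, 51, 54}. ir (s3\<lparr>tm := x\<rparr>) y = ir s2 y) \<and>
            tm (s3\<lparr>tm := x\<rparr>) + ce * length (ts a2) \<le> tm s2 + c + 14 + ce * length (ts a4)" if "x \<le> tm s2 + 14" for x
          using that r3 K2(1) by (intro exI[of _ a2] exI[of _ q2]) (simp add: s3_def)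
        have h1: "holds (ILe 11 55) s3 \<longleftrightarrow> H \<le> ah a2 ?v" and h2: "holds (RLe 1 3) (tick 1 s3) \<longleftrightarrow> int k \<le> fl a2 ?u ?v"
          and t3: "tm s3 = tm s2 + 9"
          using repD[OF r2] by (simp_all add: s3_def real_le_flow)
        show ?thesis
        proof (cases "H \<le> ah a2 ?v")
          case True
          then show ?thesis unfolding wp_Cond if_P[OF h1[THEN iffD2, OF True]]
            using q[of "tm s3 + 1"] t3 by (simp add: wp_Do)
        next
          case F: False
          then have "int k \<le> fl a2 ?u ?v" using False by simp
          with F show ?thesis unfolding wp_Cond h1 h2
            using q[of "Suc (Suc (Suc (tm s3)))"] q[of "Suc (Suc (tm s3))"] t3 by (simp add: wp_Do)
        qed
      qed
      have "wp (Visit A) (\<lambda>s'. I i (ir (tick 1 s') 51) (tick 1 (tick 1 s')) \<and>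
          ir (tick 1 s') 54 - ir (tick 1 s') 51 < ir s2 54 - ir s2 51) (tick 1 s2)"
      proof -
        have "fold act [IAdd 52 50 51, IRead 18 52, IAdd 52 5 18, IRead 55 52,
              IAdd 56 7 17, IRead 56 56, IAdd 56 56 18, RRead 3 56] (tick 1 s2) = s3"
          using rv mem_h[OF mm v] mem_fl[OF mm u(1) v] repD[OF r2] g2
          by (intro mst.equality) (simp_all add: s3_def)
        then have "wp (Do [IAdd 52 50 51, IRead 18 52, IAdd 52 5 18, IRead 55 52,
              IAdd 56 7 17, IRead 56 56, IAdd 56 56 18, RRead 3 56]) Q (tick 1 s2) \<longleftrightarrow> Q s3" for Q
          by (simp add: wp_Do)
        then show ?thesis unfolding Visit_def wp_Seq
          using wp_mono[OF act3] fin by blast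
      qed
      then show "wp (Visit A) (\<lambda>s'. I i (ir (tick 1 s') 51) (tick 1 (tick 1 s')) \<and>
          ir (tick 1 s') 54 - ir (tick 1 s') 51 < ir s2 54 - ir s2 51) (tick 1 s2)" .
    next
      fix s2 assume I2: "I i (ir s2 51) (tick 1 s2)" and ex: "holds (ILe 54 51) s2"
      then have "ir s2 51 = deg ?u" by (auto simp: I_def)
      then show "I i (deg ?u) (tick 1 s2)" using I2 by simp
    qed
    then show ?thesis .
  qed
  have outer: "wp (Until (ILe 47 48) (
     Do [IAdd 49 8 48, IRead 17 49, IAdd 50 17 17, IRead 54 50, IAdd 50 50 15, IRead 50 50,
         IConst 51 0] ;;
     Until (ILe 54 51) (Visit A) ;;
     Do [IAdd 48 48 15])) (J (length us) (arcs us)) (s\<lparr>tm := tm s + 1, ir := (ir s)(48 := b)\<rparr>)"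
  proof (rule wp_Until_measure[where I = "\<lambda>s. \<exists>i\<le>length us. J i (arcs (take i us)) (tick 1 s)"
        and m = "\<lambda>s. ir s 47 - ir s 48"])
    have "J 0 (arcs (take 0 us)) (tick 1 (s\<lparr>tm := tm s + 1, ir := (ir s)(48 := b)\<rparr>))"
      unfolding J_def using r by (intro exI[of _ a] exI[of _ q]) (auto simp:  arcs_def)
    then show "\<exists>i\<le>length us. J i (arcs (take i us)) (tick 1 (s\<lparr>tm := tm s + 1, ir := (ir s)(48 := b)\<rparr>))"
      by blast
  next
    fix s2 assume "\<exists>i\<le>length us. J i (arcs (take i us)) (tick 1 s2)" and ex: "\<not> holds (ILe 47 48) s2"
    then obtain i a2 q2 where r2: "rep s2 a2 q2" and K2: "segm b us q2" "K (arcs (take i us)) a2 q2 (ir s2 44) (ir s2 45)"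
        and g2: "ir s2 43 = b" "ir s2 47 = b + length us" "ir s2 46 = k4" "ir s2 48 = b + i"
        and t2: "tm s2 + 1 + ce * length (ts a) \<le> tm s + 2 + (c + 20) * length (arcs (take i us)) + 20 * i + ce * length (ts a2)"
      by (auto simp: J_def)
    have i: "i < length us" using ex g2 by simp
    let ?u = "us ! i"
    have u: "?u < n" "?u \<in> set us" using us nth_mem[OF i] by auto
    note mm = rep_mem[OF r2]
    have q2: "b + i < length q2" "q2 ! (b + i) = ?u" using K2(1) i by (auto simp: segm_def)
    have ru: "im s2 (f + 4 * n + (b + i)) = ?u" using mem_q[OF mm q2(1)] q2(2) by simp
    have ra: "im s2 (Suc (2 * ?u)) = M (Suc (2 * ?u))" using mem_M[OF mm, of "Suc (2 * ?u)"] u f_ge by simp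
    define s3 where "s3 = s2\<lparr>tm := tm s2 + 8, ir := (ir s2)(49 := f + 4 * n + (b + i), 17 := ?u,
        54 := deg ?u, 50 := M (2 * ?u + 1), 51 := 0)\<rparr>"
    have f3: "fold act [IAdd 49 8 48, IRead 17 49, IAdd 50 17 17, IRead 54 50, IAdd 50 50 15, IRead 50 50,
         IConst 51 0] (tick 1 s2) = s3"
      using ru ra mem_deg[OF mm u(1)] repD[OF r2] g2
      by (intro mst.equality) (simp_all add: s3_def mult_2)
    have "I i 0 (tick 1 s3)"
      unfolding I_def using r2 K2 g2 t2
      by (intro exI[of _ a2] exI[of _ q2]) (auto simp: s3_def )
    note inn = inner[OF this i]
    have "wp (Do [IAdd 48 48 15]) (\<lambda>s'. (\<exists>i\<le>length us. J i (arcs (take i us)) (tick 1 (tick 1 s'))) \<and>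
        ir (tick 1 s') 47 - ir (tick 1 s') 48 < ir s2 47 - ir s2 48) s4" if I4: "I i (deg ?u) s4" for s4
    proof -
      have tk: "take (Suc i) us = take i us @ [?u]" using i by (simp add: take_Suc_conv_app_nth)
      have ar: "arcs (take (Suc i) us) = arcs (take i us) @ map (\<lambda>j. (?u, nb ?u j)) [0..<deg ?u]"
        unfolding tk arcs_snoc ..
      from I4 obtain a4 q4 where r4: "rep s4 a4 q4" "segm b us q4" "K (arcs (take (Suc i) us)) a4 q4 (ir s4 44) (ir s4 45)"
        and g4: "ir s4 43 = b" "ir s4 47 = b + length us" "ir s4 46 = k4" "ir s4 48 = b + i"
        and t4: "tm s4 + ce * length (ts a) \<le> tm s + 2 + (c + 20) * (length (arcs (take i us)) + deg ?u) + 20 * i + 10 + ce * length (ts a4)"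
        unfolding I_def ar by blast
      have "rep (s4\<lparr>tm := x, ir := (ir s4)(48 := Suc (b + i))\<rparr>) a4 q4" for x
        using r4 by simp
      moreover have "length (arcs (take (Suc i) us)) = length (arcs (take i us)) + deg ?u"
        unfolding ar by simp
      ultimately have "J (Suc i) (arcs (take (Suc i) us)) (s4\<lparr>ir := (ir s4)(48 := Suc (b + i)), tm := Suc (Suc (Suc (tm s4)))\<rparr>)"
        unfolding J_def using r4 g4 t4 by (intro exI[of _ a4] exI[of _ q4]) auto
      moreover have "Suc i \<le> length us" using i by simp
      ultimately show ?thesis using g4 g2 i repD(12)[OF r4(1)]
        by (auto simp: wp_simps intro!: exI[of _ "Suc i"])
    qed
    then show "wp (Do [IAdd 49 8 48, IRead 17 49, IAdd 50 17 17, IRead 54 50, IAdd 50 50 15, IRead 50 50,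
         IConst 51 0] ;;
     Until (ILe 54 51) (Visit A) ;;
     Do [IAdd 48 48 15]) (\<lambda>s'. (\<exists>i\<le>length us. J i (arcs (take i us)) (tick 1 (tick 1 s'))) \<and>
        ir (tick 1 s') 47 - ir (tick 1 s') 48 < ir s2 47 - ir s2 48) (tick 1 s2)"
      unfolding wp_Seq wp_Do[of "IAdd 49 8 48 # _"] f3 using wp_mono[OF inn] by simp
  next
    fix s2 assume "\<exists>i\<le>length us. J i (arcs (take i us)) (tick 1 s2)" and ex: "holds (ILe 47 48) s2"
    then obtain i where i: "i \<le> length us" "J i (arcs (take i us)) (tick 1 s2)" by blast
    then have "i = length us" using ex by (auto simp: J_def)
    then show "J (length us) (arcs us) (tick 1 s2)" using i by simp
  qed
  have "fold act [IAdd 48 43 16] s = s\<lparr>tm := tm s + 1, ir := (ir s)(48 := b)\<rparr>"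
    using r repD[OF r(1)] by simp
  then have "wp (Scan A) (J (length us) (arcs us)) s"
    unfolding Scan_def wp_Seq wp_Do using outer by simp
  then show ?thesis
  proof (rule wp_mono)
    fix s' assume "J (length us) (arcs us) s'"
    then obtain a' q' where "rep s' a' q'" "segm b us q'" "K (arcs us) a' q' (ir s' 44) (ir s' 45)"
      "ir s' 43 = b" "ir s' 47 = b + length us" "ir s' 46 = k4"
      "tm s' + ce * length (ts a) \<le> tm s + 2 + (c + 20) * length (arcs us) + 20 * length us + ce * length (ts a')"
      unfolding J_def by blast
    then show "\<exists>a' q'. rep s' a' q' \<and> segm b us q' \<and> K (arcs us) a' q' (ir s' 44) (ir s' 45) \<and>
     ir s' 43 = b \<and> ir s' 47 = b + length us \<and> ir s' 46 = k4 \<and>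
     tm s' + ce * length (ts a) \<le> tm s + (c + 20) * length (arcs us) + 20 * length us + 5 + ce * length (ts a')"
      by (intro exI[of _ a'] exI[of _ q']) simp
  qed
qed

end

context prog
begin

lemma segm_append: "segm b us q \<Longrightarrow> segm b us (q @ r)"
  by (auto simp: segm_def nth_append)

lemma wp_Count:
  assumes r: "rep s (cutset a S) q" and seg: "segm (ir s 43) us q" "length q = ir s 43 + length us"
    and k4: "ir s 46 = 4 * k" and us: "distinct us" "set us \<subseteq> {..<n}" and S: "S \<subseteq> {..<n}" and a: "core a"
  shows "wp Count (\<lambda>s'. rep s' (cutset a S) q \<and> ir s' 43 = ir s 43 \<and> ir s' 44 = ir s 44 \<and> ir s' 46 = 4 * k \<and>
     ir s' 45 = 4 * k * resid (fl a) (set us) (- (pset (ah a) \<union> S)) \<and>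
     tm s' \<le> tm s + 21 * dvol (set us) + 20 * card (set us) + 7) s"
proof -
  let ?B = "- (pset (ah a) \<union> S)"
  let ?g = "\<lambda>(u, v). v \<in> ?B \<and> fl a u v < int k"
  define K where "K ps a' q' vol z \<longleftrightarrow> a' = cutset a S \<and> q' = q \<and> vol = ir s 44 \<and> z = 4 * k * length (filter ?g ps)"
    for ps :: "(nat \<times> nat) list" and a' q' vol z
  define s1 where "s1 = s\<lparr>tm := tm s + 2, ir := (ir s)(45 := 0, 47 := ir s 43 + length us)\<rparr>"
  have s1: "fold act [IConst 45 0, IAdd 47 13 16] s = s1"
    using repD[OF r] seg(2) by (intro mst.equality) (simp_all add: s1_def)
  have hB: "ah (cutset a S) v < H \<longleftrightarrow> v \<in> ?B" if "v < n" for v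
    using that h_le[OF a that] by (auto simp: cutset_def pset_def)
  have "wp (Scan (Do [IAdd 45 45 46])) (\<lambda>s'. \<exists>a' q'. rep s' a' q' \<and> segm (ir s 43) us q' \<and> K (arcs us) a' q' (ir s' 44) (ir s' 45) \<and>
     ir s' 43 = ir s 43 \<and> ir s' 47 = ir s 43 + length us \<and> ir s' 46 = 4 * k \<and>
     tm s' + 0 * length (ts (cutset a S)) \<le> tm s1 + (1 + 20) * length (arcs us) + 20 * length us + 5 + 0 * length (ts a')) s1"
  proof (rule wp_Scan[OF us(2)])
    show "rep s1 (cutset a S) q" using r by (simp add: s1_def)
    show "K [] (cutset a S) q (ir s1 44) (ir s1 45)" by (simp add: K_def s1_def)
  next
    fix ps u v a' q' vol z assume K: "K ps a' q' vol z" and E: "E u v" and "\<not> (ah a' v < H \<and> fl a' u v < int k)"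
    then have "\<not> ?g (u, v)" using hB[of v] E_n[OF E] by (auto simp: K_def cutset_def)
    then show "K (ps @ [(u, v)]) a' q' vol z" using K by (auto simp: K_def)
  next
    fix ps u v a' q' s2 assume r2: "rep s2 a' q'" and g: "segm (ir s 43) us q'" and K: "K ps a' q' (ir s2 44) (ir s2 45)"
      and E: "E u v" and k2: "ir s2 46 = 4 * k" and c: "ah a' v < H" "fl a' u v < int k"
    then have "?g (u, v)" using hB[of v] E_n[OF E] by (auto simp: K_def cutset_def)
    then have "K (ps @ [(u, v)]) a' q' (ir s2 44) (ir s2 45 + 4 * k)" using K by (auto simp: K_def algebra_simps)
    then show "wp (Do [IAdd 45 45 46]) (\<lambda>s'. \<exists>a'' q'. rep s' a'' q' \<and> segm (ir s 43) us q' \<and>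
        K (ps @ [(u, v)]) a'' q' (ir s' 44) (ir s' 45) \<and>
          (\<forall>x\<in>{17, 43, 46, 47, 48, 50, 51, 54}. ir s' x = ir s2 x) \<and>
          tm s' + 0 * length (ts a') \<le> tm s2 + 1 + 0 * length (ts a'')) s2"
      using r2 g k2 unfolding wp_Do by (intro conjI exI[of _ a'] exI[of _ q']) simp_all
  qed (use seg k4 in \<open>auto simp: s1_def\<close>)
  then have "wp (Scan (Do [IAdd 45 45 46])) (\<lambda>s'. rep s' (cutset a S) q \<and> ir s' 43 = ir s 43 \<and> ir s' 44 = ir s 44 \<and> ir s' 46 = 4 * k \<and>
     ir s' 45 = 4 * k * resid (fl a) (set us) ?B \<and>
     tm s' \<le> tm s + 21 * dvol (set us) + 20 * card (set us) + 7) s1"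
    by (rule wp_mono) (auto simp: K_def length_filter_arcs[OF us, of ?B "fl a", simplified] length_arcs[OF us(1)] s1_def distinct_card[OF us(1)])
  then show ?thesis unfolding Count_def wp_Seq using s1 by (simp add: wp_Do)
qed

lemma wp_Append:
  assumes r: "rep s (cutset a S) q" and seg: "segm (ir s 43) us q" "length q = ir s 43 + length us"
    and k4: "ir s 46 = 4 * k" and us: "distinct us" "set us \<subseteq> {..<n}" and S: "S \<subseteq> {..<n}" and a: "core a"
    and q: "distinct q" "set q = pset (ah a) \<union> S" and vol: "ir s 44 = dvol S"
    and N: "N = {v. v \<notin> pset (ah a) \<union> S \<and> (\<exists>u\<in>set us. E u v \<and> fl a u v < int k)}"
  shows "wp Append (\<lambda>s'. \<exists>xs. distinct (q @ xs) \<and> set xs = N \<and> rep s' (cutset a (S \<union> N)) (q @ xs) \<and>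
     ir s' 43 = length q \<and> ir s' 44 = dvol (S \<union> N) \<and> ir s' 46 = 4 * k \<and>
     tm s' \<le> tm s + 30 * dvol (set us) + 20 * card (set us) + 8) s"
proof -
  let ?P = "pset (ah a)"
  define K where "K ps a' q' vol z \<longleftrightarrow> (\<exists>xs. distinct (q @ xs) \<and>
      set xs = {v. v \<notin> ?P \<union> S \<and> (\<exists>u. (u, v) \<in> set ps \<and> fl a u v < int k)} \<and> set xs \<subseteq> {..<n} \<and>
      a' = cutset a (S \<union> set xs) \<and> q' = q @ xs \<and> vol = dvol (S \<union> set xs))"
    for ps :: "(nat \<times> nat) list" and a' q' vol and z :: nat
  define s1 where "s1 = s\<lparr>tm := tm s + 1, ir := (ir s)(47 := ir s 43 + length us)\<rparr>"
  have s1: "fold act [IAdd 47 13 16] s = s1"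
    using repD[OF r] seg(2) by (intro mst.equality) (simp_all add: s1_def)
  have hB: "ah (cutset a S') v < H \<longleftrightarrow> v \<notin> ?P \<union> S'" if "v < n" for v S'
    using that h_le[OF a that] by (auto simp: cutset_def pset_def)
  have fS: "finite S" using S finite_subset by blast
  have "wp (Scan (Do [IWrite 52 11, IAdd 42 8 13, IWrite 42 18, IAdd 13 13 15,
               IAdd 53 18 18, IRead 53 53, IAdd 44 44 53])) (\<lambda>s'. \<exists>a' q'. rep s' a' q' \<and> segm (ir s 43) us q' \<and> K (arcs us) a' q' (ir s' 44) (ir s' 45) \<and>
     ir s' 43 = ir s 43 \<and> ir s' 47 = ir s 43 + length us \<and> ir s' 46 = 4 * k \<and>
     tm s' + 0 * length (ts (cutset a S)) \<le> tm s1 + (10 + 20) * length (arcs us) + 20 * length us + 5 + 0 * length (ts a')) s1"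
  proof (rule wp_Scan[OF us(2)])
    show "rep s1 (cutset a S) q" using r by (simp add: s1_def)
    show "K [] (cutset a S) q (ir s1 44) (ir s1 45)" using q vol by (simp add: K_def s1_def)
  next
    fix ps u v a' q' vol z assume K: "K ps a' q' vol z" and E: "E u v" and nc: "\<not> (ah a' v < H \<and> fl a' u v < int k)"
    then obtain xs where xs: "distinct (q @ xs)"
      "set xs = {v. v \<notin> ?P \<union> S \<and> (\<exists>u. (u, v) \<in> set ps \<and> fl a u v < int k)}" "set xs \<subseteq> {..<n}"
      "a' = cutset a (S \<union> set xs)" "q' = q @ xs" "vol = dvol (S \<union> set xs)" unfolding K_def by blast
    from nc have "v \<in> ?P \<union> (S \<union> set xs) \<or> \<not> fl a u v < int k"
      using hB[of v "S \<union> set xs"] E_n[OF E] xs(4) by (auto simp: cutset_def)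
    then have "set xs = {v'. v' \<notin> ?P \<union> S \<and> (\<exists>u'. (u', v') \<in> set (ps @ [(u, v)]) \<and> fl a u' v' < int k)}"
      using xs(2) by auto
    then show "K (ps @ [(u, v)]) a' q' vol z" unfolding K_def using xs by blast
  next
    fix ps u v a' q' s2 assume r2: "rep s2 a' q'" and g: "segm (ir s 43) us q'" and K: "K ps a' q' (ir s2 44) (ir s2 45)"
      and E: "E u v" and c: "ah a' v < H" "fl a' u v < int k" and g2: "ir s2 18 = v" "ir s2 52 = f + n + v"
    from K obtain xs where xs: "distinct (q @ xs)"
      "set xs = {v. v \<notin> ?P \<union> S \<and> (\<exists>u. (u, v) \<in> set ps \<and> fl a u v < int k)}" "set xs \<subseteq> {..<n}"
      "a' = cutset a (S \<union> set xs)" "q' = q @ xs" "ir s2 44 = dvol (S \<union> set xs)" unfolding K_def by blast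
    have v: "v < n" using E_n[OF E] by simp
    have nv: "v \<notin> ?P \<union> (S \<union> set xs)" "fl a u v < int k" using c hB[OF v, of "S \<union> set xs"] xs(4) by (auto simp: cutset_def)
    have len: "length q' < n"
    proof -
      have "insert v (set q') \<subseteq> {..<n}" using v q(2) S xs(3,5) pset_sub by auto
      then have "card (insert v (set q')) \<le> n" using card_mono[of "{..<n}"] by simp
      moreover have "v \<notin> set q'" using nv q(2) xs(5) by auto
      ultimately show ?thesis using distinct_card xs(1,5) by fastforce
    qed
    note mm = rep_mem[OF r2]
    let ?a = "cutset a (S \<union> set (xs @ [v]))"
    have ca: "a'\<lparr>ah := (ah a')(v := H)\<rparr> = ?a" unfolding xs(4) by (auto simp: cutset_def fun_eq_iff)
    have K': "K (ps @ [(u, v)]) ?a (q' @ [v]) (ir s2 44 + deg v) z" for z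
      unfolding K_def
    proof (intro exI conjI)
      show "set (xs @ [v]) = {v'. v' \<notin> ?P \<union> S \<and> (\<exists>u'. (u', v') \<in> set (ps @ [(u, v)]) \<and> fl a u' v' < int k)}"
        using xs(2) nv by auto
      show "ir s2 44 + deg v = dvol (S \<union> set (xs @ [v]))"
        using nv fS xs(6) by (simp add: dvol_def add.commute)
    qed (use xs nv v q in auto)
    have md: "im s2 (v + v) = deg v" using mem_deg[OF mm v] .
    have md': "((im s2)(f + n + v := H, f + 4 * n + length q' := v)) (v + v) = deg v"
      using md v f_ge by simp
    have mm': "mem ((im s2)(f + n + v := H, f + 4 * n + length q' := v)) (rm s2) ?a (q' @ [v]) (ir s2 14)"
      using upd_q[OF upd_h[OF mm v, of H] v len] unfolding ca .
    have ta: "ts ?a = ts a'" unfolding xs(4) by (simp add: cutset_def)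
    have "wp (Do [IWrite 52 11, IAdd 42 8 13, IWrite 42 18, IAdd 13 13 15,
               IAdd 53 18 18, IRead 53 53, IAdd 44 44 53]) (\<lambda>s'. rep s' ?a (q' @ [v]) \<and> segm (ir s 43) us (q' @ [v]) \<and>
        K (ps @ [(u, v)]) ?a (q' @ [v]) (ir s' 44) (ir s' 45) \<and>
          (\<forall>x\<in>{17, 43, 46, 47, 48, 50, 51, 54}. ir s' x = ir s2 x) \<and>
          tm s' + 0 * length (ts a') \<le> tm s2 + 10 + 0 * length (ts ?a)) s2"
      using repD(1-15)[OF r2] g2 md md' mm' K' ta segm_append[OF g, of "[v]"]
      by (simp add: wp_Do rep_def regs_def)
    then show "wp (Do [IWrite 52 11, IAdd 42 8 13, IWrite 42 18, IAdd 13 13 15,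
               IAdd 53 18 18, IRead 53 53, IAdd 44 44 53]) (\<lambda>s'. \<exists>a'' q'. rep s' a'' q' \<and> segm (ir s 43) us q' \<and>
        K (ps @ [(u, v)]) a'' q' (ir s' 44) (ir s' 45) \<and>
          (\<forall>x\<in>{17, 43, 46, 47, 48, 50, 51, 54}. ir s' x = ir s2 x) \<and>
          tm s' + 0 * length (ts a') \<le> tm s2 + 10 + 0 * length (ts a'')) s2"
      by (rule wp_mono) blast
  qed (use seg k4 in \<open>auto simp: s1_def\<close>)
  then have "wp (Scan (Do [IWrite 52 11, IAdd 42 8 13, IWrite 42 18, IAdd 13 13 15,
               IAdd 53 18 18, IRead 53 53, IAdd 44 44 53])) (wp (Do [IAdd 43 47 16])
     (\<lambda>s'. \<exists>xs. distinct (q @ xs) \<and> set xs = N \<and> rep s' (cutset a (S \<union> N)) (q @ xs) \<and>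
     ir s' 43 = length q \<and> ir s' 44 = dvol (S \<union> N) \<and> ir s' 46 = 4 * k \<and>
     tm s' \<le> tm s + 30 * dvol (set us) + 20 * card (set us) + 8)) s1"
  proof (rule wp_mono)
    fix s' assume "\<exists>a' q'. rep s' a' q' \<and> segm (ir s 43) us q' \<and> K (arcs us) a' q' (ir s' 44) (ir s' 45) \<and>
     ir s' 43 = ir s 43 \<and> ir s' 47 = ir s 43 + length us \<and> ir s' 46 = 4 * k \<and>
     tm s' + 0 * length (ts (cutset a S)) \<le> tm s1 + (10 + 20) * length (arcs us) + 20 * length us + 5 + 0 * length (ts a')"
    then obtain a' q' where 1: "rep s' a' q'" "K (arcs us) a' q' (ir s' 44) (ir s' 45)"
      "ir s' 47 = ir s 43 + length us" "ir s' 46 = 4 * k"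
      "tm s' \<le> tm s1 + 30 * length (arcs us) + 20 * length us + 5" by auto
    have Neq: "{v. v \<notin> ?P \<union> S \<and> (\<exists>u. (u, v) \<in> set (arcs us) \<and> fl a u v < int k)} = N"
      unfolding set_arcs[OF us(2)] N by auto
    from 1(2) obtain xs where xs: "distinct (q @ xs)" "set xs = N"
      "a' = cutset a (S \<union> set xs)" "q' = q @ xs" "ir s' 44 = dvol (S \<union> set xs)"
      unfolding K_def Neq by blast
    note xs = xs(1,2) xs(3-5)[unfolded xs(2)]
    have "rep (s'\<lparr>tm := Suc (tm s'), ir := (ir s')(43 := length q)\<rparr>) (cutset a (S \<union> N)) (q @ xs)"
      using 1 xs by simp
    then show "wp (Do [IAdd 43 47 16])
     (\<lambda>s'. \<exists>xs. distinct (q @ xs) \<and> set xs = N \<and> rep s' (cutset a (S \<union> N)) (q @ xs) \<and>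
     ir s' 43 = length q \<and> ir s' 44 = dvol (S \<union> N) \<and> ir s' 46 = 4 * k \<and>
     tm s' \<le> tm s + 30 * dvol (set us) + 20 * card (set us) + 8) s'"
      using 1 xs repD(13)[OF 1(1)] seg(2) length_arcs[OF us(1)] distinct_card[OF us(1)]
      by (auto simp: wp_Do s1_def intro!: exI[of _ xs])
  qed
  then show ?thesis unfolding Append_def wp_Seq using s1 by (simp add: wp_Do)
qed

lemma wp_Emit:
  assumes r: "rep s a q" and seg: "segm (ir s 43) us q" "length q = ir s 43 + length us"
    and us: "distinct us" "set us \<subseteq> {..<n}" and a: "core a"
    and bd: "\<And>u v. E u v \<Longrightarrow> ah a u = H \<Longrightarrow> ah a v < H \<Longrightarrow> fl a u v < int k \<Longrightarrow> u \<in> set us"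
    and usH: "\<And>u. u \<in> set us \<Longrightarrow> ah a u = H"
  shows "wp Emit (\<lambda>s'. \<exists>b x. rep s' b q \<and> main b \<and> ah b = ah a \<and> acu b = acu a \<and>
     length (ts b) = length (ts a) + x \<and> int x \<le> deficit a \<and>
     tm s' \<le> tm s + 30 * dvol (set us) + 20 * card (set us) + 8 + 40 * x) s"
proof -
  define G where "G a' q' \<longleftrightarrow> q' = q \<and> core a' \<and> ah a' = ah a \<and> acu a' = acu a \<and> length (ts a) \<le> length (ts a') \<and>
      deficit a' + int (length (ts a')) = deficit a + int (length (ts a))" for a' q'
  define K where "K ps a' q' vol z \<longleftrightarrow> G a' q' \<and>
      (\<forall>u v. E u v \<and> ah a u = H \<and> ah a v < H \<and> fl a' u v < int k \<longrightarrow> u \<in> set us \<and> (u, v) \<notin> set ps)"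
    for ps :: "(nat \<times> nat) list" and a' q' and vol z :: nat
  define s1 where "s1 = s\<lparr>tm := tm s + 1, ir := (ir s)(47 := ir s 43 + length us)\<rparr>"
  have s1: "fold act [IAdd 47 13 16] s = s1"
    using repD[OF r] seg(2) by (intro mst.equality) (simp_all add: s1_def)
  let ?A = "Until (RLe 1 3) (Push ;; Do [RAdd 3 3 2, IAdd 42 9 12, IWrite 42 18, IAdd 12 12 15])"
  have "wp (Scan ?A) (\<lambda>s'. \<exists>a' q'. rep s' a' q' \<and> segm (ir s 43) us q' \<and> K (arcs us) a' q' (ir s' 44) (ir s' 45) \<and>
     ir s' 43 = ir s 43 \<and> ir s' 47 = ir s 43 + length us \<and> ir s' 46 = ir s 46 \<and>
     tm s' + 40 * length (ts a) \<le> tm s1 + (10 + 20) * length (arcs us) + 20 * length us + 5 + 40 * length (ts a')) s1"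
  proof (rule wp_Scan[OF us(2)])
    show "rep s1 a q" using r by (simp add: s1_def)
    show "K [] a q (ir s1 44) (ir s1 45)" using a bd by (auto simp add: K_def G_def s1_def)
  next
    fix ps u v a' q' vol z assume K: "K ps a' q' vol z" and nc: "\<not> (ah a' v < H \<and> fl a' u v < int k)"
    then show "K (ps @ [(u, v)]) a' q' vol z" by (auto simp: K_def G_def)
  next
    fix ps u v a2 q2 s2 assume r2: "rep s2 a2 q2" and g: "segm (ir s 43) us q2" and K: "K ps a2 q2 (ir s2 44) (ir s2 45)"
      and u: "u \<in> set us" and E: "E u v" and c: "ah a2 v < H" "fl a2 u v < int k" and g2: "ir s2 17 = u" "ir s2 18 = v"
      and F2: "rr s2 3 = real_of_int (fl a2 u v)"
    have un: "u < n" "v < n" "u \<noteq> v" using E_n[OF E] E_ne[OF E] by auto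
    have hu: "ah a u = H" "ah a v < H" using usH[OF u] c(1) K by (auto simp: K_def G_def)
    have q2: "q2 = q" using K by (simp add: K_def G_def)
    define I where "I s3 \<longleftrightarrow> (\<exists>a3. rep s3 a3 q \<and> G a3 q \<and> rr s3 3 = real_of_int (fl a3 u v) \<and>
       (\<forall>x y. E x y \<and> ah a x = H \<and> ah a y < H \<and> fl a3 x y < int k \<longrightarrow> x \<in> set us \<and> ((x, y) = (u, v) \<or> (x, y) \<notin> set ps)) \<and>
       (\<forall>x\<in>{17, 18, 43, 46, 47, 48, 50, 51, 54}. ir s3 x = ir s2 x) \<and>
       tm s3 + 40 * length (ts a2) \<le> tm s2 + 40 * length (ts a3))" for s3
    show "wp ?A (\<lambda>s'. \<exists>a' q'. rep s' a' q' \<and> segm (ir s 43) us q' \<and> K (ps @ [(u, v)]) a' q' (ir s' 44) (ir s' 45) \<and>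
          (\<forall>x\<in>{17, 43, 46, 47, 48, 50, 51, 54}. ir s' x = ir s2 x) \<and>
          tm s' + 40 * length (ts a2) \<le> tm s2 + 10 + 40 * length (ts a')) s2"
    proof (rule wp_Until_measure[where I = I and m = "\<lambda>s. nat (int k - \<lfloor>rr s 3\<rfloor>)"])
      show "I s2" unfolding I_def using r2 K F2 q2 by (intro exI[of _ a2]) (auto simp: K_def)
    next
      fix s3 assume I3: "I s3" and ex: "\<not> holds (RLe 1 3) s3"
      from I3 obtain a3 where r3: "rep s3 a3 q" and G3: "G a3 q" and F3: "rr s3 3 = real_of_int (fl a3 u v)"
        and sat3: "\<forall>x y. E x y \<and> ah a x = H \<and> ah a y < H \<and> fl a3 x y < int k \<longrightarrow> x \<in> set us \<and> ((x, y) = (u, v) \<or> (x, y) \<notin> set ps)"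
        and g3: "\<forall>x\<in>{17, 18, 43, 46, 47, 48, 50, 51, 54}. ir s3 x = ir s2 x"
        and t3: "tm s3 + 40 * length (ts a2) \<le> tm s2 + 40 * length (ts a3)" unfolding I_def by blast
      have c3: "fl a3 u v < int k" using ex F3 repD(14)[OF r3] by (simp add: real_le_flow)
      let ?b = "a3\<lparr>fl := addf (fl a3) u v, ts := v # ts a3\<rparr>"
      have e: "core ?b" "deficit ?b = deficit a3 - 1"
        using emit[OF _ E _ _ c3] G3 hu by (auto simp: G_def)
      have Gb: "G ?b q" using G3 e by (auto simp: G_def)
      have fb: "fl ?b u v = fl a3 u v + 1" by (simp add: addf_def)
      have satb: "\<forall>x y. E x y \<and> ah a x = H \<and> ah a y < H \<and> fl ?b x y < int k \<longrightarrow> x \<in> set us \<and> ((x, y) = (u, v) \<or> (x, y) \<notin> set ps)"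
      proof (intro allI impI)
        fix x y assume xy: "E x y \<and> ah a x = H \<and> ah a y < H \<and> fl ?b x y < int k"
        show "x \<in> set us \<and> ((x, y) = (u, v) \<or> (x, y) \<notin> set ps)"
        proof (cases "(x, y) = (u, v)")
          case True then show ?thesis using u by simp
        next
          case False
          moreover have "(x, y) \<noteq> (v, u)" using hu xy by auto
          ultimately have "fl ?b x y = fl a3 x y" by (auto simp: addf_def)
          with xy have "E x y \<and> ah a x = H \<and> ah a y < H \<and> fl a3 x y < int k" by simp
          with sat3 show ?thesis by blast
        qed
      qed
      have r3': "rep (tick 1 s3) a3 q" using r3 by simp
      have g3': "ir (tick 1 s3) 17 = u" "ir (tick 1 s3) 18 = v" using g3 g2 by auto
      show "wp (Push ;; Do [RAdd 3 3 2, IAdd 42 9 12, IWrite 42 18, IAdd 12 12 15])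
         (\<lambda>s'. I (tick 1 s') \<and> nat (int k - \<lfloor>rr (tick 1 s') 3\<rfloor>) < nat (int k - \<lfloor>rr s3 3\<rfloor>)) (tick 1 s3)"
        unfolding wp_Seq
      proof (rule wp_mono[OF wp_Push[OF r3' g3' un]], elim conjE)
        fix s4 assume r4: "rep s4 (a3\<lparr>fl := addf (fl a3) u v\<rparr>) q"
          and i4: "\<forall>y. y \<notin> {14, 40, 41} \<longrightarrow> ir s4 y = ir (tick 1 s3) y" "\<forall>y. y \<noteq> 4 \<longrightarrow> rr s4 y = rr (tick 1 s3) y"
          and t4: "tm s4 \<le> tm (tick 1 s3) + 30"
        note m4 = rep_mem[OF r4]
        define s5 where "s5 = s4\<lparr>rr := (rr s4)(3 := real_of_int (fl ?b u v)),
           ir := (ir s4)(42 := f + 5 * n + length (ts a3), 12 := Suc (length (ts a3))),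
           im := (im s4)(f + 5 * n + length (ts a3) := v), tm := tm s4 + 4\<rparr>"
        have f5: "fold act [RAdd 3 3 2, IAdd 42 9 12, IWrite 42 18, IAdd 12 12 15] s4 = s5"
          using repD[OF r4] i4 g3' F3 fb by (intro mst.equality) (simp_all add: s5_def)
        have r5: "rep s5 ?b q"
          using repD(1-15)[OF r4] upd_push[OF m4, of v] by (simp add: s5_def rep_def regs_def)
        have "I (tick 1 s5)"
          unfolding I_def
        proof (intro exI[of _ ?b] conjI)
          show "rr (tick 1 s5) 3 = real_of_int (fl ?b u v)" by (simp add: s5_def)
          show "\<forall>x\<in>{17, 18, 43, 46, 47, 48, 50, 51, 54}. ir (tick 1 s5) x = ir s2 x"
            using i4 g3 by (simp add: s5_def)
          show "tm (tick 1 s5) + 40 * length (ts a2) \<le> tm s2 + 40 * length (ts ?b)"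
            using t4 t3 by (simp add: s5_def)
          show "rep (tick 1 s5) ?b q" using r5 by simp
          show "G ?b q" by (rule Gb)
          show "\<forall>x y. E x y \<and> ah a x = H \<and> ah a y < H \<and> fl ?b x y < int k \<longrightarrow>
            x \<in> set us \<and> ((x, y) = (u, v) \<or> (x, y) \<notin> set ps)" by (rule satb)
        qed
        moreover have "nat (int k - \<lfloor>rr (tick 1 s5) 3\<rfloor>) < nat (int k - \<lfloor>rr s3 3\<rfloor>)"
          using F3 fb c3 by (simp add: s5_def)
        ultimately show "wp (Do [RAdd 3 3 2, IAdd 42 9 12, IWrite 42 18, IAdd 12 12 15])
           (\<lambda>s'. I (tick 1 s') \<and> nat (int k - \<lfloor>rr (tick 1 s') 3\<rfloor>) < nat (int k - \<lfloor>rr s3 3\<rfloor>)) s4"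
          unfolding wp_Do f5 by simp
      qed
    next
      fix s3 assume I3: "I s3" and ex: "holds (RLe 1 3) s3"
      from I3 obtain a3 where r3: "rep s3 a3 q" and G3: "G a3 q" and F3: "rr s3 3 = real_of_int (fl a3 u v)"
        and sat3: "\<forall>x y. E x y \<and> ah a x = H \<and> ah a y < H \<and> fl a3 x y < int k \<longrightarrow> x \<in> set us \<and> ((x, y) = (u, v) \<or> (x, y) \<notin> set ps)"
        and g3: "\<forall>x\<in>{17, 18, 43, 46, 47, 48, 50, 51, 54}. ir s3 x = ir s2 x"
        and t3: "tm s3 + 40 * length (ts a2) \<le> tm s2 + 40 * length (ts a3)" unfolding I_def by blast
      have "int k \<le> fl a3 u v" using ex F3 repD(14)[OF r3] by (simp add: real_le_flow)
      then have "\<forall>x y. E x y \<and> ah a x = H \<and> ah a y < H \<and> fl a3 x y < int k \<longrightarrow> x \<in> set us \<and> (x, y) \<notin> set (ps @ [(u, v)])"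
        using sat3 by fastforce
      then have "K (ps @ [(u, v)]) a3 q x y" for x y unfolding K_def using G3 by blast
      then show "\<exists>a' q'. rep (tick 1 s3) a' q' \<and> segm (ir s 43) us q' \<and> K (ps @ [(u, v)]) a' q' (ir (tick 1 s3) 44) (ir (tick 1 s3) 45) \<and>
          (\<forall>x\<in>{17, 43, 46, 47, 48, 50, 51, 54}. ir (tick 1 s3) x = ir s2 x) \<and>
          tm (tick 1 s3) + 40 * length (ts a2) \<le> tm s2 + 10 + 40 * length (ts a')"
        using r3 g3 t3 g q2 by (intro exI[of _ a3] exI[of _ q]) simp
    qed
  qed (use seg in \<open>auto simp: s1_def\<close>)
  then have "wp (Scan ?A) (\<lambda>s'. \<exists>b x. rep s' b q \<and> main b \<and> ah b = ah a \<and> acu b = acu a \<and>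
     length (ts b) = length (ts a) + x \<and> int x \<le> deficit a \<and>
     tm s' \<le> tm s + 30 * dvol (set us) + 20 * card (set us) + 8 + 40 * x) s1"
  proof (rule wp_mono)
    fix s' assume "\<exists>a' q'. rep s' a' q' \<and> segm (ir s 43) us q' \<and> K (arcs us) a' q' (ir s' 44) (ir s' 45) \<and>
     ir s' 43 = ir s 43 \<and> ir s' 47 = ir s 43 + length us \<and> ir s' 46 = ir s 46 \<and>
     tm s' + 40 * length (ts a) \<le> tm s1 + (10 + 20) * length (arcs us) + 20 * length us + 5 + 40 * length (ts a')"
    then obtain a' where 1: "rep s' a' q" "K (arcs us) a' q (ir s' 44) (ir s' 45)"
      "tm s' + 40 * length (ts a) \<le> tm s1 + 30 * length (arcs us) + 20 * length us + 5 + 40 * length (ts a')"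
      by (auto simp: K_def G_def)
    from 1(2) have G: "core a'" "ah a' = ah a" "acu a' = acu a" "length (ts a) \<le> length (ts a')"
      "deficit a' + int (length (ts a')) = deficit a + int (length (ts a))" by (auto simp: K_def G_def)
    have "fl a' u v = int k" if "E u v" "ah a' u = H" "ah a' v < H" for u v
    proof -
      have "u \<in> set us \<and> (u, v) \<notin> set (arcs us)" if "fl a' u v < int k"
        using 1(2) that \<open>E u v\<close> \<open>ah a' u = H\<close> \<open>ah a' v < H\<close> unfolding K_def G(2) by blast
      then show ?thesis using cap[OF G(1), of u v] \<open>E u v\<close> set_arcs[OF us(2)] by fastforce
    qed
    then have "main a'" using G(1) by (simp add: main_def)
    then show "\<exists>b x. rep s' b q \<and> main b \<and> ah b = ah a \<and> acu b = acu a \<and>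
     length (ts b) = length (ts a) + x \<and> int x \<le> deficit a \<and>
     tm s' \<le> tm s + 30 * dvol (set us) + 20 * card (set us) + 8 + 40 * x"
      using 1 G deficit_nonneg[OF G(1)] length_arcs[OF us(1)] distinct_card[OF us(1)]
      by (intro exI[of _ a'] exI[of _ "length (ts a') - length (ts a)"]) (auto simp: s1_def)
  qed
  then show ?thesis unfolding Emit_def wp_Seq using s1 by (simp add: wp_Do)
qed

end

context prog
begin

lemma wp_Cut:
  assumes r: "rep s (cutset a {w}) q" and m: "main a" and t: "ts a = w # r" "Suc (ah a w) = H" "ac a w = deg w"
    and s: "ir s 17 = w" "ir s 24 = deg w" and q: "distinct q" "set q = pset (ah a)"
  shows "wp Cut (\<lambda>s'. \<exists>b q' S x. rep s' b q' \<and> main b \<and> distinct q' \<and> set q' = pset (ah b) \<and>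
     S \<subseteq> {v. v < n \<and> ah a v < H} \<and> S \<noteq> {} \<and> ah b = ah (cutset a S) \<and> acu b = acu a \<and>
     length (ts b) = length (ts a) + x \<and> 2 * x \<le> dvol S \<and>
     tm s' \<le> (tm s + 40) + 200 * (dvol S + card S)) s"
proof -
  let ?P = "pset (ah a)"
  have c: "core a" using m by (simp add: main_def)
  have w: "w < n" using ts_n[OF c] t(1) by auto
  have wP: "w \<notin> ?P" using t(2) by (simp add: pset_def)
  note mm = rep_mem[OF r]
  have lq: "length q < n"
  proof -
    have "insert w (set q) \<subseteq> {..<n}" using w q(2) pset_sub by auto
    then have "card (insert w (set q)) \<le> n" using card_mono[of "{..<n}"] by simp
    then show ?thesis using wP q distinct_card[OF q(1)] by simp
  qed
  define I where "I s' \<longleftrightarrow> (\<exists>j S us q1. bfs a w j S (set us) \<and> rep s' (cutset a S) q1 \<and> distinct q1 \<and>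
     set q1 = ?P \<union> S \<and> segm (ir s' 43) us q1 \<and> length q1 = ir s' 43 + length us \<and> distinct us \<and> us \<noteq> [] \<and>
     ir s' 46 = 4 * k \<and> ir s' 44 = dvol S \<and> ir s' 45 = 4 * k * resid (fl a) (set us) (- (?P \<union> S)) \<and>
     tm s' + 60 * (dvol (set us) + card (set us)) \<le> tm s + 160 * (dvol S + card S) + 20)" for s'
  define s1 where "s1 = s\<lparr>ir := (ir s)(42 := f + 4 * n + length q, 43 := length q, 13 := Suc (length q),
     44 := deg w, 46 := k + k + (k + k)), im := (im s)(f + 4 * n + length q := w), tm := tm s + 7\<rparr>"
  have f1: "fold act [IAdd 42 8 13, IWrite 42 17, IAdd 43 13 16, IAdd 13 13 15, IAdd 44 24 16,
             IAdd 46 10 10, IAdd 46 46 46] s = s1"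
    using repD[OF r] s by (intro mst.equality) (simp_all add: s1_def fun_upd_twist)
  have r1: "rep s1 (cutset a {w}) (q @ [w])"
    using repD(1-15)[OF r] upd_q[OF mm w lq] by (simp add: s1_def rep_def regs_def)
  have seg1: "segm (ir s1 43) [w] (q @ [w])" "length (q @ [w]) = ir s1 43 + length [w]" "ir s1 46 = 4 * k"
    by (auto simp: segm_def s1_def)
  have count1: "wp Count I s1"
  proof (rule wp_mono[OF wp_Count[OF r1 seg1 _ _ _ c]], goal_cases)
    case (4 s2)
    show ?case unfolding I_def
    proof (intro exI conjI)
      show "bfs a w 0 {w} (set [w])" using bfs_init[OF m t] by simp
      show "rep s2 (cutset a {w}) (q @ [w])" using 4 by blast
      show "segm (ir s2 43) [w] (q @ [w])" using 4 seg1 by simp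
    qed (use 4 q wP seg1 in \<open>auto simp: s1_def dvol_def\<close>)
  qed (use w in auto)
  have loop: "wp (Until (ILe 45 44) (Append ;; Count)) (\<lambda>s'. \<exists>s2. s' = tick 1 s2 \<and> I s2 \<and> ir s2 45 \<le> ir s2 44) s2" if "I s2" for s2
  proof (rule wp_Until_measure[where I = I and m = "\<lambda>s. n - ir s 13"])
    show "I s2" by fact
  next
    fix s3 assume I3: "I s3" and ex: "\<not> holds (ILe 45 44) s3"
    from I3 obtain j S us q1 where b: "bfs a w j S (set us)" and r3: "rep s3 (cutset a S) q1"
      and q1: "distinct q1" "set q1 = ?P \<union> S" and seg: "segm (ir s3 43) us q1" "length q1 = ir s3 43 + length us"
      and us: "distinct us" "us \<noteq> []" and i3: "ir s3 46 = 4 * k" "ir s3 44 = dvol S"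
        "ir s3 45 = 4 * k * resid (fl a) (set us) (- (?P \<union> S))"
      and t3: "tm s3 + 60 * (dvol (set us) + card (set us)) \<le> tm s + 160 * (dvol S + card S) + 20"
      unfolding I_def by blast
    have z: "dvol S < 4 * k * resid (fl a) (set us) (- (?P \<union> S))" using ex i3 by simp
    define N where "N = {v. v \<notin> ?P \<union> S \<and> (\<exists>u\<in>set us. E u v \<and> fl a u v < int k)}"
    note b' = bfs_grow[OF b z N_def]
    have Sn: "S \<subseteq> {..<n}" and usS: "set us \<subseteq> S" using b by (auto simp: bfs_def)
    then have usn: "set us \<subseteq> {..<n}" by blast
    have Nn: "N \<subseteq> {..<n}" using E_n by (auto simp: N_def)
    have fin: "finite S" "finite N" using Sn Nn finite_subset by blast+
    have dj: "S \<inter> N = {}" by (auto simp: N_def)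
    have N0: "N \<noteq> {}"
    proof
      assume "N = {}"
      then have "{v \<in> - (?P \<union> S). E u v \<and> fl a u v < int k} = {}" if "u \<in> set us" for u
        using that by (auto simp: N_def)
      then have "resid (fl a) (set us) (- (?P \<union> S)) = 0" by (simp add: resid_def)
      then show False using z by simp
    qed
    then have cN: "1 \<le> card N" using fin by (simp add: Suc_leI card_gt_0_iff)
    have cu: "1 \<le> card (set us)" using us by (simp add: Suc_leI card_gt_0_iff)
    have dSN: "dvol (S \<union> N) = dvol S + dvol N" "card (S \<union> N) = card S + card N"
      using sum.union_disjoint[OF fin dj, of deg] card_Un_disjoint[OF fin dj] by (auto simp: dvol_def)
    have r3': "rep (tick 1 s3) (cutset a S) q1" using r3 by simp
    show "wp (Append ;; Count) (\<lambda>s'. I (tick 1 s') \<and> n - ir (tick 1 s') 13 < n - ir s3 13) (tick 1 s3)"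
      unfolding wp_Seq
    proof (rule wp_mono[OF wp_Append[OF r3' _ _ _ us(1) usn Sn c q1 _ N_def]], goal_cases)
      case (5 s4)
      then obtain xs where xs: "distinct (q1 @ xs)" "set xs = N" and r4: "rep s4 (cutset a (S \<union> N)) (q1 @ xs)"
        and i4: "ir s4 43 = length q1" "ir s4 44 = dvol (S \<union> N)" "ir s4 46 = 4 * k"
        and t4: "tm s4 \<le> tm (tick 1 s3) + 30 * dvol (set us) + 20 * card (set us) + 8" by blast
      have dx: "distinct xs" using xs by simp
      have seg4: "segm (ir s4 43) xs (q1 @ xs)" "length (q1 @ xs) = ir s4 43 + length xs"
        using i4 by (auto simp: segm_def)
      have SN: "S \<union> N \<subseteq> {..<n}" using Sn Nn by blast
      have xn: "set xs \<subseteq> {..<n}" using xs Nn by simp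
      have x0: "xs \<noteq> []" using xs N0 by auto
      show ?case
      proof (rule wp_mono[OF wp_Count[OF r4 seg4 i4(3) dx xn SN c]], elim conjE)
        fix s5 assume r5: "rep s5 (cutset a (S \<union> N)) (q1 @ xs)" and i5: "ir s5 43 = ir s4 43" "ir s5 44 = ir s4 44"
           "ir s5 46 = 4 * k" "ir s5 45 = 4 * k * resid (fl a) (set xs) (- (pset (ah a) \<union> (S \<union> N)))"
          and t5: "tm s5 \<le> tm s4 + 21 * dvol (set xs) + 20 * card (set xs) + 7"
        have "I (tick 1 s5)"
          unfolding I_def
        proof (intro exI conjI)
          show "bfs a w (Suc j) (S \<union> N) (set xs)" using b' xs(2) by simp
          show "rep (tick 1 s5) (cutset a (S \<union> N)) (q1 @ xs)" using r5 by simp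
          show "distinct (q1 @ xs)" by (rule xs(1))
          show "set (q1 @ xs) = ?P \<union> (S \<union> N)" using q1 xs by auto
          show "segm (ir (tick 1 s5) 43) xs (q1 @ xs)" using seg4 i5 by simp
          show "tm (tick 1 s5) + 60 * (dvol (set xs) + card (set xs)) \<le> tm s + 160 * (dvol (S \<union> N) + card (S \<union> N)) + 20"
            using t5 t4 t3 cN cu unfolding dSN xs(2) by simp
        qed (use i5 i4 seg4 dx x0 in simp_all)
        moreover have "n - ir s5 13 < n - ir s3 13"
        proof -
          have "length (q1 @ xs) \<le> n" using mem_qn(1)[OF rep_mem[OF r5]] .
          moreover have "length q1 < length (q1 @ xs)" using x0 by simp
          ultimately show ?thesis using repD(11)[OF r5] repD(11)[OF r3] x0 by (cases xs) auto
        qed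
        ultimately show "I (tick 1 s5) \<and> n - ir (tick 1 s5) 13 < n - ir s3 13" by simp
      qed
    qed (use seg i3 in simp_all)
  next
    fix s3 assume "I s3" "holds (ILe 45 44) s3"
    then show "\<exists>s2. tick 1 s3 = tick 1 s2 \<and> I s2 \<and> ir s2 45 \<le> ir s2 44" by auto
  qed
  have fin: "wp Emit (\<lambda>s'. \<exists>b q' S x. rep s' b q' \<and> main b \<and> distinct q' \<and> set q' = pset (ah b) \<and>
     S \<subseteq> {v. v < n \<and> ah a v < H} \<and> S \<noteq> {} \<and> ah b = ah (cutset a S) \<and> acu b = acu a \<and>
     length (ts b) = length (ts a) + x \<and> 2 * x \<le> dvol S \<and>
     tm s' \<le> (tm s + 40) + 200 * (dvol S + card S)) (tick 1 s3)" if I3: "I s3" and ex: "ir s3 45 \<le> ir s3 44" for s3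
  proof -
    from I3 obtain j S us q1 where b: "bfs a w j S (set us)" and r3: "rep s3 (cutset a S) q1"
      and q1: "distinct q1" "set q1 = ?P \<union> S" and seg: "segm (ir s3 43) us q1" "length q1 = ir s3 43 + length us"
      and us: "distinct us" "us \<noteq> []" and i3: "ir s3 46 = 4 * k" "ir s3 44 = dvol S"
        "ir s3 45 = 4 * k * resid (fl a) (set us) (- (?P \<union> S))"
      and t3: "tm s3 + 60 * (dvol (set us) + card (set us)) \<le> tm s + 160 * (dvol S + card S) + 20"
      unfolding I_def by blast
    have z: "4 * k * resid (fl a) (set us) (- (?P \<union> S)) \<le> dvol S" using ex i3 by simp
    have SR: "S \<subseteq> {v. v < n \<and> ah a v < H}" and usS: "set us \<subseteq> S" and S0: "S \<noteq> {}" using b by (auto simp: bfs_def)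
    then have usn: "set us \<subseteq> {..<n}" by blast
    have fb: "fl (cutset a S) = fl a" "ts (cutset a S) = ts a" "acu (cutset a S) = acu a" by (auto simp: cutset_def)
    have cu: "1 \<le> card (set us)" using us by (simp add: Suc_leI card_gt_0_iff)
    have P': "pset (ah (cutset a S)) = ?P \<union> S" using SR by (auto simp: pset_def cutset_def)
    have r3': "rep (tick 1 s3) (cutset a S) q1" using r3 by simp
    show ?thesis
    proof (rule wp_mono[OF wp_Emit[OF r3' _ _ us(1) usn bfs_cut(1)[OF b z]]], goal_cases)
      case (3 u v) then show ?case using bfs_cut(3)[OF b z] unfolding fb by blast
    next
      case (4 u) then show ?case using usS by (auto simp: cutset_def)
    next
      case (5 s4)
      then obtain b x where 1: "rep s4 b q1" "main b" "ah b = ah (cutset a S)" "acu b = acu a"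
         "length (ts b) = length (ts a) + x" "int x \<le> deficit (cutset a S)"
         "tm s4 \<le> tm (tick 1 s3) + 30 * dvol (set us) + 20 * card (set us) + 8 + 40 * x" unfolding fb by blast
      have x: "2 * x \<le> dvol S" using 1(6) bfs_cut(2)[OF b z] by linarith
      show ?case
      proof (intro exI conjI)
        show "set q1 = pset (ah b)" using q1 P' 1(3) by simp
        show "tm s4 \<le> (tm s + 40) + 200 * (dvol S + card S)" using 1(7) t3 x by simp
      qed (use 1 q1 SR S0 x in auto)
    qed (use seg in simp_all)
  qed
  show ?thesis
    unfolding Cut_def wp_Seq wp_Do f1
    using wp_mono[OF count1] wp_mono[OF loop] fin by simp (smt (verit, best) wp_mono)
qed

lemma body_cut:
  assumes r: "rep s a q" and m: "main a" and t: "ts a = w # r" "Suc (ah a w) = H" "ac a w = deg w" "acu a w = deg w"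
    and q: "distinct q" "set q = pset (ah a)"
  shows "wp Body (\<lambda>s'. \<exists>b q' S x. rep s' b q' \<and> main b \<and> distinct q' \<and> set q' = pset (ah b) \<and>
     S \<subseteq> {v. v < n \<and> ah a v < H} \<and> S \<noteq> {} \<and> ah b = ah (cutset a S) \<and> acu b = acu a \<and>
     length (ts b) = length (ts a) + x \<and> 2 * x \<le> dvol S \<and>
     tm s' \<le> (tm s + 80) + 200 * (dvol S + card S)) s"
proof -
  note mm = rep_mem[OF r]
  have w: "w < n" using m t ts_n[of a] by (auto simp: main_def)
  have h: "ah a w < H" "ah a w \<noteq> H" using t by auto
  have ca: "a\<lparr>ah := (ah a)(w := H)\<rparr> = cutset a {w}" by (auto simp: cutset_def fun_eq_iff)
  define Q where "Q t s' \<longleftrightarrow> (\<exists>b q' S x. rep s' b q' \<and> main b \<and> distinct q' \<and> set q' = pset (ah b) \<and>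
     S \<subseteq> {v. v < n \<and> ah a v < H} \<and> S \<noteq> {} \<and> ah b = ah (cutset a S) \<and> acu b = acu a \<and>
     length (ts b) = length (ts a) + x \<and> 2 * x \<le> dvol S \<and>
     tm s' \<le> t + 200 * (dvol S + card S))" for t s'
  have Q_mono: "Q t' (s'\<lparr>tm := x\<rparr>)" if "Q t s'" "x + t \<le> tm s' + t'" for t t' s' x
    using that(1) unfolding Q_def
  proof (elim exE conjE)
    fix b q' S y
    assume "rep s' b q'" "main b" "distinct q'" "set q' = pset (ah b)" "S \<subseteq> {v. v < n \<and> ah a v < H}" "S \<noteq> {}"
      "ah b = ah (cutset a S)" "acu b = acu a" "length (ts b) = length (ts a) + y" "2 * y \<le> dvol S"
      "tm s' \<le> t + 200 * (dvol S + card S)"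
    then show "\<exists>b q' S y. rep (s'\<lparr>tm := x\<rparr>) b q' \<and> main b \<and> distinct q' \<and> set q' = pset (ah b) \<and>
     S \<subseteq> {v. v < n \<and> ah a v < H} \<and> S \<noteq> {} \<and> ah b = ah (cutset a S) \<and> acu b = acu a \<and>
     length (ts b) = length (ts a) + y \<and> 2 * y \<le> dvol S \<and> tm (s'\<lparr>tm := x\<rparr>) \<le> t' + 200 * (dvol S + card S)"
      using that(2) by (intro exI[of _ b] exI[of _ q'] exI[of _ S] exI[of _ y]) simp
  qed
  have cut: "wp Cut (Q (tm s1 + 40)) s1" if "rep s1 (cutset a {w}) q" "ir s1 17 = w" "ir s1 24 = deg w" for s1
    using wp_Cut[OF that(1) m t(1,2,3) that(2,3) q] unfolding Q_def .
  have "wp Body (Q (tm s + 80)) s"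
    using repD(1-15)[OF r] t(1,3,4) h t(2) top_read[OF mm t(1)] mem_h[OF mm w] mem_c[OF mm w] mem_deg[OF mm w]
      mem_cu[OF mm w] upd_h[OF mm w, of H, unfolded ca]
    apply (simp add: Body_def wp_simps)
    apply (rule wp_mono[OF cut])
    apply (simp_all add: rep_def regs_def cutset_def)
    apply (erule Q_mono)
    apply simp
    done
  then show ?thesis unfolding Q_def .
qed

lemma body_step:
  assumes r: "rep s a q" and m: "main a" and q: "distinct q" "set q = pset (ah a)" and t: "ts a \<noteq> []"
  shows "wp Body (\<lambda>s'. \<exists>b q'. rep s' b q' \<and> main b \<and> distinct q' \<and> set q' = pset (ah b) \<and>
     tm s' + 400 * mu b + 400 * wt a + 2 \<le> tm s + 400 * mu a + 400 * wt b) s"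
    (is "wp Body ?Q s")
proof -
  have c: "core a" using m by (simp add: main_def)
  obtain w rs where ts: "ts a = w # rs" using t by (cases "ts a") auto
  have w: "w < n" using ts_n[OF c] ts by auto
  have Q: "?Q s'" if "rep s' b q" "main b" "ah b = ah a \<or> pset (ah b) = pset (ah a)" "tm s' \<le> tm s + 80"
      "mu b + wt a + 1 \<le> mu a + wt b" for s' b
  proof (intro exI conjI)
    show "rep s' b q" "main b" "distinct q" by fact+
    show "set q = pset (ah b)" using that(3) q(2) by (elim disjE) simp_all
    show "tm s' + 400 * mu b + 400 * wt a + 2 \<le> tm s + 400 * mu a + 400 * wt b"
      using that(4,5) by linarith
  qed
  consider "ah a w = H" | "ah a w \<noteq> H" "ac a w < deg w"
    | "ah a w \<noteq> H" "ac a w = deg w" "acu a w < deg w"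
    | "ah a w \<noteq> H" "ac a w = deg w" "acu a w = deg w"
    using c_le[OF c w] cu_le[OF c w] by linarith
  then show ?thesis
  proof cases
    case 1
    have "mu (a\<lparr>ts := rs\<rparr>) + 1 \<le> mu a" by (rule mu_pop[OF c ts]) auto
    then show ?thesis
      using discard[OF m ts 1] by (intro wp_mono[OF body_discard[OF r m ts 1]] Q) (auto simp: wt_def)
  next
    case 2
    have "mu (a\<lparr>ac := (ac a)(w := Suc (ac a w)), ts := rs\<rparr>) + 1 \<le> mu a" by (rule mu_pop[OF c ts]) auto
    then show ?thesis
      using absorb[OF m ts 2] by (intro wp_mono[OF body_absorb[OF r m ts 2]] Q) (auto simp: wt_def)
  next
    case 3
    let ?u = "nb w (acu a w)"
    show ?thesis
    proof (cases "fl a w ?u < int k \<and> ah a ?u < ah a w")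
      case True
      have "mu (a\<lparr>fl := addf (fl a) w ?u, ts := ?u # rs\<rparr>) + 1 \<le> mu a"
        using True ts by (simp add: mu_def)
      then show ?thesis
        using move[OF m ts 3(1,3) refl] True
        by (intro wp_mono[OF body_move[OF r m ts 3 refl]] Q) (auto simp: wt_def)
    next
      case False
      have "wt (a\<lparr>acu := (acu a)(w := Suc (acu a w))\<rparr>) = wt a + 1" by (rule wt_update[OF w]) auto
      moreover have mu_eq: "mu (a\<lparr>acu := (acu a)(w := Suc (acu a w))\<rparr>) = mu a" by (simp add: mu_def ts)
      ultimately show ?thesis
        using skip[OF m ts 3(3,2) False]
          mu_eq by (intro wp_mono[OF body_skip[OF r m ts 3 False]] Q) auto
    qed
  next
    case 4
    show ?thesis
    proof (cases "Suc (ah a w) < H")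
      case True
      let ?b = "a\<lparr>ah := (ah a)(w := Suc (ah a w)), acu := (acu a)(w := 0)\<rparr>"
      have "wt ?b = wt a + 3" using True 4 by (intro wt_update[OF w]) auto
      moreover have "mu ?b = mu a + 1" using ts by (simp add: mu_def)
      moreover have "pset (ah ?b) = pset (ah a)" using True by (auto simp: pset_def)
      ultimately show ?thesis
        using relabel[OF m ts True 4(3,2)]
        by (intro wp_mono[OF body_relabel[OF r m ts True 4(2,3)]] Q; elim conjE) (assumption | linarith | blast)+
    next
      case False
      then have H: "Suc (ah a w) = H" using h_le[OF c w] 4 by simp
      show ?thesis
      proof (rule wp_mono[OF body_cut[OF r m ts H 4(2,3) q]], elim exE conjE)
        fix s' b q' S x
        assume 1: "rep s' b q'" "main b" "distinct q'" "set q' = pset (ah b)" "S \<subseteq> {v. v < n \<and> ah a v < H}" "S \<noteq> {}"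
          "ah b = ah (cutset a S)" "acu b = acu a" "length (ts b) = length (ts a) + x" "2 * x \<le> dvol S"
          "tm s' \<le> (tm s + 80) + 200 * (dvol S + card S)"
        have "finite S" using 1(5) by (rule finite_subset) simp
        then have "1 \<le> card S" using 1(6) by (simp add: Suc_leI card_gt_0_iff)
        moreover have "core b" using 1(2) by (simp add: main_def)
        from cut_potential[OF m this 1(5,7,8,9,10,6)]
        have "mu b + wt a + (dvol S + card S) \<le> mu a + wt b" .
        ultimately have "tm s' + 400 * mu b + 400 * wt a + 2 \<le> tm s + 400 * mu a + 400 * wt b"
          using 1(11) le0[of "dvol S"] unfolding distrib_left by linarith
        with 1(1-4) show "?Q s'" by blast
      qed
    qed
  qed
qed

lemma wp_loop:
  assumes r: "rep s a q" and m: "main a" and q: "distinct q" "set q = pset (ah a)"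
  shows "wp (Until (ILe 12 16) Body) (\<lambda>s'. \<exists>b q'. rep s' b q' \<and> main b \<and> ts b = [] \<and> distinct q' \<and>
     set q' = pset (ah b) \<and> tm s' \<le> tm s + 400 * mu a + 400 * ((4 * H + 3) * ((4 * k + 1) * T)) + 1) s"
proof (rule wp_Until[where B = "tm s + 400 * mu a + 400 * ((4 * H + 3) * ((4 * k + 1) * T))"
      and I = "\<lambda>s'. \<exists>b q'. rep s' b q' \<and> main b \<and> distinct q' \<and> set q' = pset (ah b) \<and>
        tm s' + 400 * mu b \<le> tm s + 400 * mu a + 400 * wt b"])
  show "\<exists>b q'. rep s b q' \<and> main b \<and> distinct q' \<and> set q' = pset (ah b) \<and>
        tm s + 400 * mu b \<le> tm s + 400 * mu a + 400 * wt b"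
    using assms by (intro exI[of _ a] exI[of _ q]) auto
next
  fix s' assume "\<exists>b q'. rep s' b q' \<and> main b \<and> distinct q' \<and> set q' = pset (ah b) \<and>
        tm s' + 400 * mu b \<le> tm s + 400 * mu a + 400 * wt b"
  then obtain b where b: "main b" "tm s' + 400 * mu b \<le> tm s + 400 * mu a + 400 * wt b" by blast
  then have "wt b \<le> (4 * H + 3) * ((4 * k + 1) * T)" by (intro wt_bound) (simp add: main_def)
  then show "tm s' \<le> tm s + 400 * mu a + 400 * ((4 * H + 3) * ((4 * k + 1) * T))" using b by linarith
next
  fix s' assume "\<exists>b q'. rep s' b q' \<and> main b \<and> distinct q' \<and> set q' = pset (ah b) \<and>
        tm s' + 400 * mu b \<le> tm s + 400 * mu a + 400 * wt b" and ex: "\<not> holds (ILe 12 16) s'"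
  then obtain b q' where b: "rep s' b q'" "main b" "distinct q'" "set q' = pset (ah b)"
    "tm s' + 400 * mu b \<le> tm s + 400 * mu a + 400 * wt b" by blast
  have "ts b \<noteq> []" using ex repD[OF b(1)] by auto
  have b1: "rep (tick 1 s') b q'" using b(1) by simp
  show "wp Body (\<lambda>s'. \<exists>b q'. rep (tick 1 s') b q' \<and> main b \<and> distinct q' \<and> set q' = pset (ah b) \<and>
        tm (tick 1 s') + 400 * mu b \<le> tm s + 400 * mu a + 400 * wt b) (tick 1 s')"
  proof (rule wp_mono[OF body_step[OF b1 b(2,3,4) \<open>ts b \<noteq> []\<close>]], elim exE conjE)
    fix s2 b2 q2 assume 2: "rep s2 b2 q2" "main b2" "distinct q2" "set q2 = pset (ah b2)"
      "tm s2 + 400 * mu b2 + 400 * wt b + 2 \<le> tm (tick 1 s') + 400 * mu b + 400 * wt b2"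
    then show "\<exists>b q'. rep (tick 1 s2) b q' \<and> main b \<and> distinct q' \<and> set q' = pset (ah b) \<and>
        tm (tick 1 s2) + 400 * mu b \<le> tm s + 400 * mu a + 400 * wt b"
      using b(5) by (intro exI[of _ b2] exI[of _ q2]) simp
  qed
next
  fix s' assume "\<exists>b q'. rep s' b q' \<and> main b \<and> distinct q' \<and> set q' = pset (ah b) \<and>
        tm s' + 400 * mu b \<le> tm s + 400 * mu a + 400 * wt b" and ex: "holds (ILe 12 16) s'"
  then obtain b q' where b: "rep s' b q'" "main b" "distinct q'" "set q' = pset (ah b)"
    "tm s' + 400 * mu b \<le> tm s + 400 * mu a + 400 * wt b" by blast
  have t: "ts b = []" using ex repD[OF b(1)] by auto
  have "wt b \<le> (4 * H + 3) * ((4 * k + 1) * T)" using b(2) by (intro wt_bound) (simp add: main_def)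
  then show "\<exists>b q'. rep (tick 1 s') b q' \<and> main b \<and> ts b = [] \<and> distinct q' \<and>
     set q' = pset (ah b) \<and> tm (tick 1 s') \<le> tm s + 400 * mu a + 400 * ((4 * H + 3) * ((4 * k + 1) * T)) + 1"
    using b t by (intro exI[of _ b] exI[of _ q']) simp
qed

end

definition Setup :: cmd where
  "Setup =
     Do [IConst 15 1, IConst 16 0, IConst 20 2, RNat 2 15, RNat 3 16, RNat 5 20,
         IAdd 5 3 0, IAdd 6 5 0, IAdd 7 6 0, IAdd 8 7 0, IAdd 9 8 0,
         IConst 10 0, IConst 12 0, IConst 13 0, IAdd 14 0 16] ;;
     Until (RLe 5 3) (Do [RAdd 3 3 0, IAdd 10 10 15]) ;;
     Do [RNat 1 10, IAdd 21 0 0, IAdd 22 2 2, IAdd 22 21 22] ;;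
     Until (ILe 22 21)
       (Do [IRead 23 21, IConst 24 0] ;;
        Until (ILe 10 24) (Do [IAdd 25 9 12, IWrite 25 23, IAdd 12 12 15, IAdd 24 24 15]) ;;
        Do [IAdd 21 21 15]) ;;
     Do [IAdd 27 12 12, IAdd 27 27 15, IConst 28 1, IConst 11 2, IAdd 29 10 10, IAdd 29 29 29] ;;
     Until (ILe 27 28) (Do [IAdd 28 28 28, IAdd 11 11 29])"

text \<open>Above 27/50 there is nothing to do: no graph whose maximal degree is a small fraction of
  the number of edges has such a large conductance.\<close>

definition Prune :: cmd where
  "Prune = Cond (ILe 2 30) (Do [IConst 0 1])
     (Do [IConst 20 50, RNat 4 20, RMul 4 4 0, IConst 20 27, RNat 5 20] ;;
      Cond (RLe 4 5)
        (Setup ;; Until (ILe 12 16) Body ;; Do [IConst 0 1, IAdd 1 8 16, IAdd 2 13 16])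
        (Do [IConst 0 1, IConst 2 0]))"

lemma wp_capacity:
  assumes s: "rr s 5 = 2" "rr s 3 = 0" "ir s 10 = 0" "ir s 15 = 1" and \<alpha>: "0 < rr s 0"
  shows "wp (Until (RLe 5 3) (Do [RAdd 3 3 0, IAdd 10 10 15]))
     (\<lambda>s'. \<exists>k. s' = s\<lparr>ir := (ir s)(10 := k), rr := (rr s)(3 := real k * rr s 0), tm := tm s + 4 * k + 1\<rparr> \<and>
        0 < k \<and> 2 \<le> real k * rr s 0 \<and> real (k - 1) * rr s 0 < 2) s"
proof -
  define st where "st k = s\<lparr>ir := (ir s)(10 := k), rr := (rr s)(3 := real k * rr s 0), tm := tm s + 4 * k\<rparr>" for k
  show ?thesis
  proof (rule wp_Until[where B = "tm s + 4 * nat \<lceil>2 / rr s 0 + 1\<rceil>"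
        and I = "\<lambda>s'. \<exists>k. s' = st k \<and> (k = 0 \<or> real (k - 1) * rr s 0 < 2)"])
    show "\<exists>k. s = st k \<and> (k = 0 \<or> real (k - 1) * rr s 0 < 2)"
      using s by (intro exI[of _ 0]) (simp add: st_def fun_upd_idem)
  next
    fix s' assume "\<exists>k. s' = st k \<and> (k = 0 \<or> real (k - 1) * rr s 0 < 2)"
    then obtain k where k: "s' = st k" "k = 0 \<or> real (k - 1) * rr s 0 < 2" by blast
    have "real k \<le> 2 / rr s 0 + 1"
    proof (cases "k = 0")
      case False
      then have "real (k - 1) < 2 / rr s 0" using k(2) \<alpha> by (simp add: field_simps)
      then show ?thesis using False by (simp add: of_nat_diff)
    qed (use \<alpha> in simp)
    then have "k \<le> nat \<lceil>2 / rr s 0 + 1\<rceil>" by linarith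
    then show "tm s' \<le> tm s + 4 * nat \<lceil>2 / rr s 0 + 1\<rceil>" by (simp add: k st_def)
  next
    fix s' assume "\<exists>k. s' = st k \<and> (k = 0 \<or> real (k - 1) * rr s 0 < 2)" and ex: "\<not> holds (RLe 5 3) s'"
    then obtain k where k: "s' = st k" by blast
    have lt: "real k * rr s 0 < 2" using ex s by (simp add: k st_def)
    have "fold act [RAdd 3 3 0, IAdd 10 10 15] (tick 1 s') = (st (Suc k))\<lparr>tm := tm s + 4 * k + 3\<rparr>"
      using s by (intro mst.equality) (simp_all add: k st_def algebra_simps)
    moreover have "tick 1 ((st (Suc k))\<lparr>tm := tm s + 4 * k + 3\<rparr>) = st (Suc k)"
      by (intro mst.equality) (simp_all add: st_def)
    ultimately show "wp (Do [RAdd 3 3 0, IAdd 10 10 15])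
       (\<lambda>s'. \<exists>k. tick 1 s' = st k \<and> (k = 0 \<or> real (k - 1) * rr s 0 < 2)) (tick 1 s')"
      unfolding wp_Do using lt by (intro conjI exI[of _ "Suc k"]) simp_all
  next
    fix s' assume "\<exists>k. s' = st k \<and> (k = 0 \<or> real (k - 1) * rr s 0 < 2)" and ex: "holds (RLe 5 3) s'"
    then obtain k where k: "s' = st k" "k = 0 \<or> real (k - 1) * rr s 0 < 2" by blast
    have "2 \<le> real k * rr s 0" using ex s by (simp add: k st_def)
    moreover have "0 < k" using calculation by (cases k) auto
    moreover have "tick 1 s' = s\<lparr>ir := (ir s)(10 := k), rr := (rr s)(3 := real k * rr s 0), tm := tm s + 4 * k + 1\<rparr>"
      by (simp add: k st_def)
    ultimately show "\<exists>k. tick 1 s' = s\<lparr>ir := (ir s)(10 := k), rr := (rr s)(3 := real k * rr s 0), tm := tm s + 4 * k + 1\<rparr> \<and>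
        0 < k \<and> 2 \<le> real k * rr s 0 \<and> real (k - 1) * rr s 0 < 2" using k(2) by blast
  qed
qed

definition listed :: "mst \<Rightarrow> (nat \<Rightarrow> nat) \<Rightarrow> nat \<Rightarrow> nat list \<Rightarrow> bool" where
  "listed s M b l \<longleftrightarrow> (\<forall>i<b. im s i = M i) \<and> (\<forall>i<length l. im s (b + i) = l ! i) \<and> ir s 9 = b \<and> ir s 12 = length l"

lemma listed_snoc:
  assumes "listed s M b l" "ir s' 9 = b" "ir s' 12 = Suc (length l)" "im s' = (im s)(b + length l := x)"
  shows "listed s' M b (l @ [x])"
  using assms unfolding listed_def by (auto simp: nth_append less_Suc_eq)

lemma wp_repeat:
  assumes l: "listed s M b l" and s: "ir s 15 = 1" "ir s 24 = 0"
  shows "wp (Until (ILe 10 24) (Do [IAdd 25 9 12, IWrite 25 23, IAdd 12 12 15, IAdd 24 24 15]))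
    (\<lambda>s'. listed s' M b (l @ replicate (ir s 10) (ir s 23)) \<and> (\<forall>x. x \<notin> {12, 24, 25} \<longrightarrow> ir s' x = ir s x) \<and>
       rr s' = rr s \<and> rm s' = rm s \<and> tm s' = tm s + 6 * ir s 10 + 1) s"
proof (rule wp_Until_measure[where m = "\<lambda>s. ir s 10 - ir s 24" and
      I = "\<lambda>s'. listed s' M b (l @ replicate (ir s' 24) (ir s 23)) \<and> ir s' 24 \<le> ir s 10 \<and>
       (\<forall>x. x \<notin> {12, 24, 25} \<longrightarrow> ir s' x = ir s x) \<and>
       rr s' = rr s \<and> rm s' = rm s \<and> tm s' = tm s + 6 * ir s' 24"])
  show "listed s M b (l @ replicate (ir s 24) (ir s 23)) \<and> ir s 24 \<le> ir s 10 \<and>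
       (\<forall>x. x \<notin> {12, 24, 25} \<longrightarrow> ir s x = ir s x) \<and>
       rr s = rr s \<and> rm s = rm s \<and> tm s = tm s + 6 * ir s 24"
    using assms by simp
next
  fix s' assume I: "listed s' M b (l @ replicate (ir s' 24) (ir s 23)) \<and> ir s' 24 \<le> ir s 10 \<and>
       (\<forall>x. x \<notin> {12, 24, 25} \<longrightarrow> ir s' x = ir s x) \<and>
       rr s' = rr s \<and> rm s' = rm s \<and> tm s' = tm s + 6 * ir s' 24" and ex: "\<not> holds (ILe 10 24) s'"
  let ?j = "ir s' 24"
  have fr: "ir s' x = ir s x" if "x \<notin> {12, 24, 25}" for x using I that by blast
  have i9: "ir s' 9 = b" "ir s' 12 = length l + ?j" using I by (auto simp: listed_def)
  define s1 where "s1 = s'\<lparr>ir := (ir s')(25 := b + (length l + ?j), 12 := Suc (length l + ?j), 24 := Suc ?j),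
      im := (im s')(b + (length l + ?j) := ir s 23), tm := tm s' + 5\<rparr>"
  have f1: "fold act [IAdd 25 9 12, IWrite 25 23, IAdd 12 12 15, IAdd 24 24 15] (tick 1 s') = s1"
    using i9 fr[of 15] fr[of 23] s by (intro mst.equality) (simp_all add: s1_def)
  have "listed s1 M b ((l @ replicate ?j (ir s 23)) @ [ir s 23])"
    using I i9 by (intro listed_snoc[of s']) (simp_all add: s1_def)
  then have "listed (tick 1 s1) M b (l @ replicate (Suc ?j) (ir s 23))"
    by (simp add: listed_def replicate_append_same)
  then show "wp (Do [IAdd 25 9 12, IWrite 25 23, IAdd 12 12 15, IAdd 24 24 15])
     (\<lambda>s''. (listed (tick 1 s'') M b (l @ replicate (ir (tick 1 s'') 24) (ir s 23)) \<and> ir (tick 1 s'') 24 \<le> ir s 10 \<and>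
       (\<forall>x. x \<notin> {12, 24, 25} \<longrightarrow> ir (tick 1 s'') x = ir s x) \<and>
       rr (tick 1 s'') = rr s \<and> rm (tick 1 s'') = rm s \<and> tm (tick 1 s'') = tm s + 6 * ir (tick 1 s'') 24) \<and>
       ir (tick 1 s'') 10 - ir (tick 1 s'') 24 < ir s' 10 - ir s' 24) (tick 1 s')"
    unfolding wp_Do f1 using I ex fr[of 10] by (simp add: s1_def)
next
  fix s' assume I: "listed s' M b (l @ replicate (ir s' 24) (ir s 23)) \<and> ir s' 24 \<le> ir s 10 \<and>
       (\<forall>x. x \<notin> {12, 24, 25} \<longrightarrow> ir s' x = ir s x) \<and>
       rr s' = rr s \<and> rm s' = rm s \<and> tm s' = tm s + 6 * ir s' 24" and ex: "holds (ILe 10 24) s'"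
  moreover from this have "ir s' 24 = ir s 10" by auto
  ultimately show "listed (tick 1 s') M b (l @ replicate (ir s 10) (ir s 23)) \<and> (\<forall>x. x \<notin> {12, 24, 25} \<longrightarrow> ir (tick 1 s') x = ir s x) \<and>
       rr (tick 1 s') = rr s \<and> rm (tick 1 s') = rm s \<and> tm (tick 1 s') = tm s + 6 * ir s 10 + 1"
    by (simp add: listed_def)
qed

lemma wp_tokens:
  assumes l: "listed s M b []" and s: "ir s 15 = 1" "ir s 21 = c" "ir s 22 = c + length xs" "ir s 10 = k"
    and M: "\<And>i. i < length xs \<Longrightarrow> M (c + i) = xs ! i" and b: "c + length xs \<le> b"
  shows "wp (Until (ILe 22 21)
       (Do [IRead 23 21, IConst 24 0] ;;
        Until (ILe 10 24) (Do [IAdd 25 9 12, IWrite 25 23, IAdd 12 12 15, IAdd 24 24 15]) ;;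
        Do [IAdd 21 21 15]))
    (\<lambda>s'. listed s' M b (concat (map (replicate k) xs)) \<and> (\<forall>x. x \<notin> {12, 21, 23, 24, 25} \<longrightarrow> ir s' x = ir s x) \<and>
       rr s' = rr s \<and> rm s' = rm s \<and> tm s' = tm s + (6 * k + 6) * length xs + 1) s"
proof -
  define I where "I i s' \<longleftrightarrow> listed s' M b (concat (map (replicate k) (take i xs))) \<and> i \<le> length xs \<and> ir s' 21 = c + i \<and>
     (\<forall>x. x \<notin> {12, 21, 23, 24, 25} \<longrightarrow> ir s' x = ir s x) \<and>
       rr s' = rr s \<and> rm s' = rm s \<and> tm s' = tm s + (6 * k + 6) * i" for i s'
  show ?thesis
  proof (rule wp_Until_measure[where I = "\<lambda>s'. \<exists>i. I i s'" and m = "\<lambda>s. ir s 22 - ir s 21"])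
    show "\<exists>i. I i s" using l s by (intro exI[of _ 0]) (simp add: I_def)
  next
    fix s' assume "\<exists>i. I i s'" and ex: "\<not> holds (ILe 22 21) s'"
    then obtain i where I: "I i s'" by blast
    have fr: "ir s' x = ir s x" if "x \<notin> {12, 21, 23, 24, 25}" for x using I that unfolding I_def by blast
    have i: "i < length xs" "ir s' 21 = c + i" using I ex s fr[of 22] by (auto simp: I_def)
    have li: "listed s' M b (concat (map (replicate k) (take i xs)))" using I by (simp add: I_def)
    have rd: "im s' (c + i) = xs ! i" using li M[OF i(1)] i b by (simp add: listed_def)
    define s1 where "s1 = s'\<lparr>ir := (ir s')(23 := xs ! i, 24 := 0), tm := tm s' + 3\<rparr>"
    have f1: "fold act [IRead 23 21, IConst 24 0] (tick 1 s') = s1"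
      using i rd by (intro mst.equality) (simp_all add: s1_def)
    have l1: "listed s1 M b (concat (map (replicate k) (take i xs)))" "ir s1 15 = 1" "ir s1 24 = 0"
      using li fr[of 15] s by (simp_all add: listed_def s1_def)
    have tk: "concat (map (replicate k) (take (Suc i) xs)) = concat (map (replicate k) (take i xs)) @ replicate k (xs ! i)"
      using i by (simp add: take_Suc_conv_app_nth)
    have "wp (Do [IAdd 21 21 15]) (\<lambda>s''. (\<exists>i. I i (tick 1 s'')) \<and> ir (tick 1 s'') 22 - ir (tick 1 s'') 21 < ir s' 22 - ir s' 21) s2"
      if 2: "listed s2 M b (concat (map (replicate k) (take i xs)) @ replicate (ir s1 10) (ir s1 23))"
        "\<forall>x. x \<notin> {12, 24, 25} \<longrightarrow> ir s2 x = ir s1 x" "rr s2 = rr s1" "rm s2 = rm s1" "tm s2 = tm s1 + 6 * ir s1 10 + 1" for s2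
    proof -
      have fr2: "ir s2 x = ir s x" if "x \<notin> {12, 21, 23, 24, 25}" for x using 2(2) that fr[of x] by (simp add: s1_def)
      have k: "ir s1 10 = k" "ir s1 23 = xs ! i" using fr[of 10] s by (simp_all add: s1_def)
      have r21: "ir s2 21 = c + i" "ir s2 15 = 1" "ir s2 22 = c + length xs" "ir s' 22 = c + length xs"
        using 2(2) i fr[of 15] fr[of 22] s by (simp_all add: s1_def)
      have "I (Suc i) (s2\<lparr>ir := (ir s2)(21 := Suc (c + i)), tm := Suc (Suc (tm s2))\<rparr>)"
        unfolding I_def
      proof (intro conjI)
        show "listed (s2\<lparr>ir := (ir s2)(21 := Suc (c + i)), tm := Suc (Suc (tm s2))\<rparr>) M b (concat (map (replicate k) (take (Suc i) xs)))"
          unfolding tk using 2(1) k by (simp add: listed_def)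
        show "\<forall>x. x \<notin> {12, 21, 23, 24, 25} \<longrightarrow> ir (s2\<lparr>ir := (ir s2)(21 := Suc (c + i)), tm := Suc (Suc (tm s2))\<rparr>) x = ir s x"
          using fr2 by simp
        show "tm (s2\<lparr>ir := (ir s2)(21 := Suc (c + i)), tm := Suc (Suc (tm s2))\<rparr>) = tm s + (6 * k + 6) * Suc i"
          using 2(5) I k by (simp add: I_def s1_def)
      qed (use i 2 I in \<open>simp_all add: I_def s1_def\<close>)
      then have "\<exists>i. I i (s2\<lparr>ir := (ir s2)(21 := Suc (c + i')), tm := Suc (Suc (tm s2))\<rparr>)" if "i' = i" for i' using that by blast
      then show ?thesis using r21 i by (simp add: wp_Do)
    qed
    then show "wp (Do [IRead 23 21, IConst 24 0] ;;
        Until (ILe 10 24) (Do [IAdd 25 9 12, IWrite 25 23, IAdd 12 12 15, IAdd 24 24 15]) ;;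
        Do [IAdd 21 21 15]) (\<lambda>s''. (\<exists>i. I i (tick 1 s'')) \<and> ir (tick 1 s'') 22 - ir (tick 1 s'') 21 < ir s' 22 - ir s' 21) (tick 1 s')"
      unfolding wp_Seq wp_Do[of "[IRead 23 21, IConst 24 0]"] f1 using wp_mono[OF wp_repeat[OF l1]] by simp
  next
    fix s' assume "\<exists>i. I i s'" and ex: "holds (ILe 22 21) s'"
    then obtain i where I: "I i s'" by blast
    have "ir s' 22 = ir s 22" using I by (simp add: I_def)
    then have "i = length xs" using I ex s by (auto simp: I_def)
    then show "listed (tick 1 s') M b (concat (map (replicate k) xs)) \<and> (\<forall>x. x \<notin> {12, 21, 23, 24, 25} \<longrightarrow> ir (tick 1 s') x = ir s x) \<and>
       rr (tick 1 s') = rr s \<and> rm (tick 1 s') = rm s \<and> tm (tick 1 s') = tm s + (6 * k + 6) * length xs + 1"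
      using I by (simp add: I_def listed_def)
  qed
qed

lemma wp_levels:
  assumes s: "ir s 28 = 1" "ir s 11 = 2" "ir s 29 = 4 * k" "ir s 27 = Suc B"
  shows "wp (Until (ILe 27 28) (Do [IAdd 28 28 28, IAdd 11 11 29]))
    (\<lambda>s'. \<exists>L. s' = s\<lparr>ir := (ir s)(28 := 2 ^ L, 11 := 2 + 4 * k * L), tm := tm s + 4 * L + 1\<rparr> \<and>
       B < 2 ^ L \<and> (L = 0 \<or> 2 ^ (L - 1) \<le> B)) s"
proof -
  define st where "st L = s\<lparr>ir := (ir s)(28 := 2 ^ L, 11 := 2 + 4 * k * L), tm := tm s + 4 * L\<rparr>" for L
  show ?thesis
  proof (rule wp_Until_measure[where m = "\<lambda>s. ir s 27 - ir s 28" and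
        I = "\<lambda>s'. \<exists>L. s' = st L \<and> (L = 0 \<or> 2 ^ (L - 1) \<le> B)"])
    show "\<exists>L. s = st L \<and> (L = 0 \<or> 2 ^ (L - 1) \<le> B)"
      using s by (intro exI[of _ 0]) (auto simp: st_def fun_upd_idem)
  next
    fix s' assume "\<exists>L. s' = st L \<and> (L = 0 \<or> 2 ^ (L - 1) \<le> B)" and ex: "\<not> holds (ILe 27 28) s'"
    then obtain L where L: "s' = st L" by blast
    have lt: "2 ^ L \<le> B" using ex s by (simp add: L st_def)
    have "fold act [IAdd 28 28 28, IAdd 11 11 29] (tick 1 s') = (st (Suc L))\<lparr>tm := tm s + 4 * L + 3\<rparr>"
      using s by (intro mst.equality) (simp_all add: L st_def algebra_simps mult_2)
    moreover have "tick 1 ((st (Suc L))\<lparr>tm := tm s + 4 * L + 3\<rparr>) = st (Suc L)"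
      by (intro mst.equality) (simp_all add: st_def)
    moreover have "ir (st (Suc L)) 27 - ir (st (Suc L)) 28 < ir s' 27 - ir s' 28"
      using lt s by (simp add: L st_def) (simp add: diff_less_mono2)
    ultimately show "wp (Do [IAdd 28 28 28, IAdd 11 11 29])
       (\<lambda>s''. (\<exists>L. tick 1 s'' = st L \<and> (L = 0 \<or> 2 ^ (L - 1) \<le> B)) \<and>
          ir (tick 1 s'') 27 - ir (tick 1 s'') 28 < ir s' 27 - ir s' 28) (tick 1 s')"
      unfolding wp_Do using lt by (intro conjI exI[of _ "Suc L"]) simp_all
  next
    fix s' assume "\<exists>L. s' = st L \<and> (L = 0 \<or> 2 ^ (L - 1) \<le> B)" and ex: "holds (ILe 27 28) s'"
    then obtain L where L: "s' = st L" "L = 0 \<or> 2 ^ (L - 1) \<le> B" by blast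
    have "B < 2 ^ L" using ex s by (simp add: L st_def)
    then show "\<exists>L. tick 1 s' = s\<lparr>ir := (ir s)(28 := 2 ^ L, 11 := 2 + 4 * k * L), tm := tm s + 4 * L + 1\<rparr> \<and>
       B < 2 ^ L \<and> (L = 0 \<or> 2 ^ (L - 1) \<le> B)"
      using L by (intro exI[of _ L]) (simp add: st_def)
  qed
qed

lemma wp_Setup:
  assumes s: "ir s 0 = n" "ir s 3 = f" "2 * ir s 2 = length xs" "im s = M" "0 < rr s 0"
    and M: "\<And>i. i < length xs \<Longrightarrow> M (2 * n + i) = xs ! i" and b: "2 * n + length xs \<le> f"
  shows "wp Setup (\<lambda>s'. \<exists>k L. 0 < k \<and> 2 \<le> real k * rr s 0 \<and> real (k - 1) * rr s 0 < 2 \<and>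
     2 * k * length xs < 2 ^ L \<and> (L = 0 \<or> 2 ^ (L - 1) \<le> 2 * k * length xs) \<and>
     listed s' M (f + 5 * n) (concat (map (replicate k) xs)) \<and>
     ir s' 0 = n \<and> ir s' 3 = f \<and> ir s' 5 = f + n \<and> ir s' 6 = f + 2 * n \<and> ir s' 7 = f + 3 * n \<and> ir s' 8 = f + 4 * n \<and>
     ir s' 10 = k \<and> ir s' 11 = 2 + 4 * k * L \<and> ir s' 13 = 0 \<and> ir s' 14 = n \<and> ir s' 15 = 1 \<and> ir s' 16 = 0 \<and>
     rr s' 1 = real k \<and> rr s' 2 = 1 \<and> rm s' = rm s \<and>
     tm s' = tm s + 28 + 4 * k + (6 * k + 6) * length xs + 4 * L) s"
proof -
  define s1 where "s1 = fold act [IConst 15 1, IConst 16 0, IConst 20 2, RNat 2 15, RNat 3 16, RNat 5 20,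
         IAdd 5 3 0, IAdd 6 5 0, IAdd 7 6 0, IAdd 8 7 0, IAdd 9 8 0,
         IConst 10 0, IConst 12 0, IConst 13 0, IAdd 14 0 16] s"
  have r1: "ir s1 0 = n" "ir s1 3 = f" "ir s1 5 = f + n" "ir s1 6 = f + 2 * n" "ir s1 7 = f + 3 * n" "ir s1 8 = f + 4 * n"
    "ir s1 9 = f + 5 * n" "ir s1 10 = 0" "ir s1 12 = 0" "ir s1 13 = 0" "ir s1 14 = n" "ir s1 15 = 1" "ir s1 16 = 0"
    "ir s1 2 = ir s 2" "rr s1 0 = rr s 0" "rr s1 2 = 1" "rr s1 3 = 0" "rr s1 5 = 2" "rm s1 = rm s" "im s1 = M" "tm s1 = tm s + 15"
    using s by (simp_all add: s1_def)
  let ?xs = "\<lambda>k. concat (map (replicate k) xs)"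
  have len: "length (?xs k) = k * length xs" for k by (induction xs) auto
  have pos: "0 < rr s1 0" using s r1 by simp
  show ?thesis
    unfolding Setup_def wp_Seq wp_Do[of "IConst 15 1 # _"] s1_def[symmetric]
  proof (intro conjI, simp, rule wp_mono[OF wp_capacity[OF r1(18,17,8,12) pos]], elim exE conjE)
    fix s2 k assume s2: "s2 = s1\<lparr>ir := (ir s1)(10 := k), rr := (rr s1)(3 := real k * rr s1 0), tm := tm s1 + 4 * k + 1\<rparr>"
      and k: "0 < k" "2 \<le> real k * rr s1 0" "real (k - 1) * rr s1 0 < 2"
    define s3 where "s3 = fold act [RNat 1 10, IAdd 21 0 0, IAdd 22 2 2, IAdd 22 21 22] s2"
    have r3: "ir s3 x = ir s1 x" if "x \<notin> {10, 21, 22}" for x using that by (simp add: s3_def s2)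
    have v3: "ir s3 10 = k" "ir s3 21 = 2 * n" "ir s3 22 = 2 * n + length xs" "rr s3 1 = real k" "rr s3 2 = 1"
       "rm s3 = rm s" "im s3 = M" "tm s3 = tm s + 20 + 4 * k"
      using r1 s by (simp_all add: s3_def s2)
    have l3: "listed s3 M (f + 5 * n) []" using v3 r3[of 9] r3[of 12] r1 by (simp add: listed_def)
    have i3: "ir s3 15 = 1" using r3[of 15] r1 by simp
    show "wp (Do [RNat 1 10, IAdd 21 0 0, IAdd 22 2 2, IAdd 22 21 22]) (wp (Until (ILe 22 21)
       (Do [IRead 23 21, IConst 24 0] ;;
        Until (ILe 10 24) (Do [IAdd 25 9 12, IWrite 25 23, IAdd 12 12 15, IAdd 24 24 15]) ;;
        Do [IAdd 21 21 15])) (wp (Do [IAdd 27 12 12, IAdd 27 27 15, IConst 28 1, IConst 11 2, IAdd 29 10 10, IAdd 29 29 29])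
     (wp (Until (ILe 27 28) (Do [IAdd 28 28 28, IAdd 11 11 29])) (\<lambda>s'. \<exists>k L. 0 < k \<and> 2 \<le> real k * rr s 0 \<and> real (k - 1) * rr s 0 < 2 \<and>
     2 * k * length xs < 2 ^ L \<and> (L = 0 \<or> 2 ^ (L - 1) \<le> 2 * k * length xs) \<and>
     listed s' M (f + 5 * n) (concat (map (replicate k) xs)) \<and>
     ir s' 0 = n \<and> ir s' 3 = f \<and> ir s' 5 = f + n \<and> ir s' 6 = f + 2 * n \<and> ir s' 7 = f + 3 * n \<and> ir s' 8 = f + 4 * n \<and>
     ir s' 10 = k \<and> ir s' 11 = 2 + 4 * k * L \<and> ir s' 13 = 0 \<and> ir s' 14 = n \<and> ir s' 15 = 1 \<and> ir s' 16 = 0 \<and>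
     rr s' 1 = real k \<and> rr s' 2 = 1 \<and> rm s' = rm s \<and>
     tm s' = tm s + 28 + 4 * k + (6 * k + 6) * length xs + 4 * L)))) s2"
      unfolding wp_Do[of "[RNat 1 10, _, _, _]"] s3_def[symmetric]
    proof (intro conjI, simp, rule wp_mono[OF wp_tokens[OF l3 i3 v3(2,3,1) M]], goal_cases)
      case (3 s4)
      define s5 where "s5 = fold act [IAdd 27 12 12, IAdd 27 27 15, IConst 28 1, IConst 11 2, IAdd 29 10 10, IAdd 29 29 29] s4"
      have fr4: "ir s4 x = ir s1 x" if "x \<notin> {10, 12, 21, 22, 23, 24, 25}" for x using 3 r3[of x] that by auto
      have i4: "ir s4 10 = k" "ir s4 15 = 1" "ir s4 12 = k * length xs" using 3 v3 i3 len by (auto simp: listed_def)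
      have fr5: "ir s5 x = ir s1 x" if "x \<notin> {10, 11, 12, 21, 22, 23, 24, 25, 27, 28, 29}" for x
        using fr4[of x] that by (simp add: s5_def)
      have i5: "ir s5 28 = 1" "ir s5 11 = 2" "ir s5 29 = 4 * k" "ir s5 27 = Suc (2 * k * length xs)"
        using i4 by (simp_all add: s5_def)
      have o5: "rr s5 = rr s4" "rm s5 = rm s4" "im s5 = im s4" "tm s5 = tm s4 + 6" "ir s5 9 = ir s4 9" "ir s5 12 = ir s4 12" "ir s5 10 = ir s4 10"
        by (simp_all add: s5_def)
      show ?case
        unfolding wp_Do[of "[IAdd 27 12 12, _, _, _, _, _]"] s5_def[symmetric]
      proof (intro conjI, simp, rule wp_mono[OF wp_levels[OF i5]], elim exE conjE)
        fix s6 L assume s6: "s6 = s5\<lparr>ir := (ir s5)(28 := 2 ^ L, 11 := 2 + 4 * k * L), tm := tm s5 + 4 * L + 1\<rparr>"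
          and L: "2 * k * length xs < 2 ^ L" "L = 0 \<or> 2 ^ (L - 1) \<le> 2 * k * length xs"
        have fr6: "ir s6 x = ir s5 x" if "x \<notin> {11, 28}" for x using that by (simp add: s6)
        have l6: "listed s6 M (f + 5 * n) (?xs k)" using 3 o5 fr6[of 9] fr6[of 12] by (simp add: listed_def s6)
        have i6: "ir s6 x = ir s1 x" if "x \<notin> {10, 11, 12, 21, 22, 23, 24, 25, 27, 28, 29}" for x
          using fr6[of x] fr5[of x] that by simp
        have g6: "ir s6 0 = n" "ir s6 3 = f" "ir s6 5 = f + n" "ir s6 6 = f + 2 * n" "ir s6 7 = f + 3 * n"
          "ir s6 8 = f + 4 * n" "ir s6 13 = 0" "ir s6 14 = n" "ir s6 15 = 1" "ir s6 16 = 0"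
          using i6[of 0] i6[of 3] i6[of 5] i6[of 6] i6[of 7] i6[of 8] i6[of 13] i6[of 14] i6[of 15] i6[of 16]
            r1(1-6,10-13) by simp_all
        have h6: "ir s6 10 = k" "ir s6 11 = 2 + 4 * k * L" using i4 o5 by (simp_all add: s6)
        have e6: "rr s6 1 = real k" "rr s6 2 = 1" "rm s6 = rm s" using 3 o5 v3 by (simp_all add: s6)
        have t6: "tm s6 = tm s + 28 + 4 * k + (6 * k + 6) * length xs + 4 * L"
          using 3 o5 v3(8) by (simp add: s6)
        show "\<exists>k L. 0 < k \<and> 2 \<le> real k * rr s 0 \<and> real (k - 1) * rr s 0 < 2 \<and>
     2 * k * length xs < 2 ^ L \<and> (L = 0 \<or> 2 ^ (L - 1) \<le> 2 * k * length xs) \<and>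
     listed s6 M (f + 5 * n) (concat (map (replicate k) xs)) \<and>
     ir s6 0 = n \<and> ir s6 3 = f \<and> ir s6 5 = f + n \<and> ir s6 6 = f + 2 * n \<and> ir s6 7 = f + 3 * n \<and> ir s6 8 = f + 4 * n \<and>
     ir s6 10 = k \<and> ir s6 11 = 2 + 4 * k * L \<and> ir s6 13 = 0 \<and> ir s6 14 = n \<and> ir s6 15 = 1 \<and> ir s6 16 = 0 \<and>
     rr s6 1 = real k \<and> rr s6 2 = 1 \<and> rm s6 = rm s \<and>
     tm s6 = tm s + 28 + 4 * k + (6 * k + 6) * length xs + 4 * L"
          using k[unfolded r1(15)] L l6 g6 h6 e6 t6 by blast
      qed
    qed (use b in simp_all)
  qed
qed

definition crossing :: "(nat \<Rightarrow> nat \<Rightarrow> bool) \<Rightarrow> nat set \<Rightarrow> nat set \<Rightarrow> nat" where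
  "crossing E A B = (\<Sum>u\<in>A. card ({v. E u v} \<inter> B))"

definition pruned :: "nat \<Rightarrow> (nat \<Rightarrow> nat \<Rightarrow> bool) \<Rightarrow> (nat \<Rightarrow> nat) \<Rightarrow> (nat \<Rightarrow> nat) \<Rightarrow> nat \<Rightarrow> nat set \<Rightarrow> bool" where
  "pruned n E deg d k P \<longleftrightarrow> P \<subseteq> {..<n} \<and>
     sum deg P + 2 * k * crossing E P (- P) \<le> 2 * k * sum d P \<and>
     sum deg P \<le> 2 * k * sum d {..<n} \<and>
     (\<forall>S \<subseteq> {..<n} - P. k * (sum d S + crossing E S P) \<le> sum deg S + k * crossing E S (- (P \<union> S)))"

lemma (in net) pruned_pset:
  assumes "main a" "ts a = []"
  shows "pruned n E deg d k (pset (ah a))"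
proof -
  have c: "core a" using assms by (simp add: main_def)
  have "sum deg (pset (ah a)) \<le> 2 * k * sum d {..<n}"
    using vol_pset_le[OF c] token_bound[OF c] d_T by (simp add: dvol_def)
  then show ?thesis
    using ineq[OF c] final_cut[OF assms] pset_sub
    unfolding pruned_def crossing_def ecut_def dvol_def by blast
qed

lemma level_bound:
  assumes "0 < k" "2 * k * N < 2 ^ L"
  shows "real (2 * k * N) < (1 + 1 / (4 * real k)) ^ (4 * k * L)"
proof -
  have "1 + real (4 * k) * (1 / (4 * real k)) \<le> (1 + 1 / (4 * real k)) ^ (4 * k)"
    by (rule Bernoulli_inequality) (use assms(1) in \<open>simp add: field_simps\<close>)
  then have "2 \<le> (1 + 1 / (4 * real k)) ^ (4 * k)" using assms(1) by simp
  then have "2 ^ L \<le> ((1 + 1 / (4 * real k)) ^ (4 * k)) ^ L" by (rule power_mono) simp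
  moreover have "real (2 * k * N) < 2 ^ L" using assms(2) by (metis of_nat_less_iff of_nat_numeral of_nat_power)
  ultimately show ?thesis by (simp add: power_mult)
qed

lemma length_concat_replicate: "length (concat (map (replicate k) xs)) = k * length xs"
  by (induction xs) auto

lemma count_list_concat_replicate:
  "count_list (concat (map (replicate k) xs)) v = k * count_list xs v"
proof -
  have "count_list (replicate k x) v = (if x = v then k else 0)" for x :: 'a by (induction k) auto
  then show ?thesis by (induction xs) (auto simp: count_list_append)
qed

lemma count_list_rev [simp]: "count_list (rev xs) v = count_list xs v"
  by (induction xs) (auto simp: count_list_append)

lemma time_bound:
  fixes k N L :: nat
  assumes "0 < k" "0 < N"
  shows "48 + 4 * k + (6 * k + 6) * N + 4 * L + 400 * (((2 + 4 * k * L) + 1) * (k * N)) +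
    400 * ((4 * (2 + 4 * k * L) + 3) * ((4 * k + 1) * N)) \<le> 60000 * (k * k * N * (L + 1))"
proof -
  let ?A = "k * k * N * (L + 1)"
  have k: "1 \<le> k" and N: "1 \<le> N" using assms by auto
  have kk: "1 \<le> k * k" using k by simp
  have A: "N * (L + 1) \<le> ?A"
    using mult_le_mono1[OF kk, of "N * (L + 1)"] by (simp only: mult_1 mult.assoc)
  have A2: "k * (N * (L + 1)) \<le> ?A"
    using mult_le_mono1[OF k, of "k * (N * (L + 1))"] by (simp only: mult_1 mult.assoc)
  have NL: "1 \<le> N * (L + 1)" "N \<le> N * (L + 1)" "L \<le> N * (L + 1)"
    using mult_le_mono1[OF N, of "L + 1"] by simp_all
  have 1: "1 \<le> ?A" using NL(1) A by (rule order.trans)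
  have 2: "k \<le> ?A" using order.trans[OF mult_le_mono2[OF NL(1), of k] A2] by (simp only: mult_1_right)
  have 3: "k * N \<le> ?A" "N \<le> ?A" "L \<le> ?A"
    using order.trans[OF mult_le_mono2[OF NL(2), of k] A2] order.trans[OF NL(2) A] order.trans[OF NL(3) A]
    by (simp_all only:)
  have 4: "k * L * (k * N) \<le> ?A" by (simp add: algebra_simps)
  have "k * L * N \<le> k * (N * (L + 1))" by (simp add: algebra_simps)
  then have 5: "k * L * N \<le> ?A" using A2 by (rule order.trans)
  have e1: "(2 + 4 * k * L + 1) * (k * N) = 3 * (k * N) + 4 * (k * L * (k * N))" by (simp add: algebra_simps)
  have e2: "(4 * (2 + 4 * k * L) + 3) * ((4 * k + 1) * N) = 44 * (k * N) + 11 * N + 64 * (k * L * (k * N)) + 16 * (k * L * N)"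
    by (simp add: algebra_simps)
  have e3: "(6 * k + 6) * N = 6 * (k * N) + 6 * N" by (simp add: algebra_simps)
  have lin: "48 + 4 * k + (6 * p + 6 * N) + 4 * L + 400 * (3 * p + 4 * q) + 400 * (44 * p + 11 * N + 64 * q + 16 * r) \<le> 60000 * A"
    if "1 \<le> A" "k \<le> A" "p \<le> A" "N \<le> A" "L \<le> A" "q \<le> A" "r \<le> A" for p q r A :: nat
    using that unfolding distrib_left by linarith
  show ?thesis unfolding e1 e2 e3 by (rule lin[OF 1 2 3 4 5])
qed

lemma wp_Prune:
  fixes E :: "nat \<Rightarrow> nat \<Rightarrow> bool" and nb :: "nat \<Rightarrow> nat \<Rightarrow> nat" and deg :: "nat \<Rightarrow> nat"
  assumes E: "\<And>u v. E u v \<Longrightarrow> E v u" "\<And>u. \<not> E u u" "\<And>u v. E u v \<Longrightarrow> u < n \<and> v < n"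
    and nb: "\<And>v. v < n \<Longrightarrow> bij_betw (nb v) {..<deg v} {u. E v u}"
    and M: "\<And>v. v < n \<Longrightarrow> M (2 * v) = deg v" "\<And>v j. v < n \<Longrightarrow> j < deg v \<Longrightarrow> M (M (2 * v + 1) + j) = nb v j"
      "\<And>v. v < n \<Longrightarrow> M (2 * v + 1) + deg v \<le> f" "\<And>i. f \<le> i \<Longrightarrow> M i = 0"
      "\<And>i. i < length xs \<Longrightarrow> M (2 * n + i) = xs ! i" "2 * n + length xs \<le> f"
    and xs: "set xs \<subseteq> {..<n}" "xs \<noteq> []"
    and s: "ir s 0 = n" "ir s 3 = f" "2 * ir s 2 = length xs" "ir s 30 = 0" "im s = M" "rm s = (\<lambda>_. 0)"
      "0 < rr s 0" "tm s = 0" and small: "50 * rr s 0 \<le> 27"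
  shows "wp Prune (\<lambda>s'. \<exists>k L P. 0 < k \<and> 2 \<le> real k * rr s 0 \<and> real (k - 1) * rr s 0 < 2 \<and>
     pruned n E deg (count_list xs) k P \<and>
     ir s' 0 = 1 \<and> (\<lambda>i. im s' (ir s' 1 + i)) ` {..<ir s' 2} = P \<and>
     (L = 0 \<or> 2 ^ (L - 1) \<le> 2 * k * length xs) \<and> tm s' \<le> 60000 * (k * k * length xs * (L + 1))) s"
proof -
  have ne: "\<not> holds (ILe 2 30) s" using s xs(2) by (cases xs) auto
  define s9 where "s9 = s\<lparr>ir := (ir s)(20 := 27), rr := (rr s)(4 := 50 * rr s 0, 5 := 27), tm := 6\<rparr>"
  have f9: "fold act [IConst 20 50, RNat 4 20, RMul 4 4 0, IConst 20 27, RNat 5 20] (tick 1 s) = s9"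
    using s by (intro mst.equality) (simp_all add: s9_def)
  have h9: "holds (RLe 4 5) s9" using small by (simp add: s9_def)
  define s0 where "s0 = tick 1 s9"
  have s0: "ir s0 0 = n" "ir s0 3 = f" "2 * ir s0 2 = length xs" "im s0 = M" "0 < rr s0 0" using s by (simp_all add: s0_def s9_def)
  have t0: "tm s0 = 7" "rm s0 = rm s" "rr s0 0 = rr s 0" by (simp_all add: s0_def s9_def)
  show ?thesis
    unfolding Prune_def wp_Cond if_not_P[OF ne] wp_Seq wp_Do[of "IConst 20 50 # _"] f9 if_P[OF h9] s0_def[symmetric]
  proof (intro conjI, simp, rule wp_mono[OF wp_Setup[OF s0 M(5,6)]], assumption, elim exE conjE, goal_cases)
    case (1 s1 k L)
    note su = 1
    define H where "H = 2 + 4 * k * L"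
    note len = length_concat_replicate[of k xs]
    have sx: "(\<Sum>v<n. count_list xs v) = length xs" using sum_count_set[OF xs(1)] by simp
    interpret prog n k H "length xs" E "count_list xs" nb deg M f
    proof unfold_locales
      show "real (2 * k * length xs) < (1 + 1 / (4 * real k)) ^ (H - 2)"
        unfolding H_def using level_bound[OF 1(1,4)] by simp
      show "2 \<le> H" by (simp add: H_def)
      show "2 * n \<le> f" using M(6) by simp
    qed (fact E nb M sx 1(1) | rule E nb M, assumption+)+
    define a where "a = \<lparr>ac = \<lambda>_. 0, ah = \<lambda>_. 0, acu = \<lambda>_. 0, fl = \<lambda>_ _. 0, ts = rev (concat (map (replicate k) xs))\<rparr>"
    have "set (concat (map (replicate k) xs)) \<subseteq> {..<n}"
    proof
      fix x assume "x \<in> set (concat (map (replicate k) xs))"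
      then obtain y where "y \<in> set xs" "x \<in> set (replicate k y)" by auto
      then have "x \<in> set xs" by (auto simp: in_set_replicate)
      then show "x \<in> {..<n}" using xs(1) by (rule subsetD[rotated])
    qed
    then have m: "main a" unfolding a_def
      by (intro main_init) (simp_all only: count_list_rev count_list_concat_replicate set_rev)
    have ts0: "rev (ts a) = concat (map (replicate k) xs)" "length (ts a) = k * length xs" by (simp_all add: a_def len)
    have mem0: "mem (im s1) (rm s1) a [] n"
    proof -
      have i: "im s1 i = M i" if "i < f + 5 * n" for i using su(6) that by (simp add: listed_def)
      have z: "im s1 i = 0" if "f \<le> i" "i < f + 5 * n" for i using i[OF that(2)] M(4)[OF that(1)] by simp
      have rm: "rm s1 i = 0" for i using su(21) s(6) t0 by simp
      show ?thesis
        unfolding mem_def arr_def flows_def ts0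
        using su(6) i z rm by (simp add: listed_def len a_def)
    qed
    have r: "rep s1 a []"
      unfolding rep_def regs_def using 1 mem0 ts0 len by (simp add: listed_def H_def)
    have P0: "pset (ah a) = {}" using H_ge by (auto simp: pset_def a_def)
    have mu0: "mu a \<le> (H + 1) * (k * length xs)" unfolding mu_def ts0
      by (simp add: a_def split: list.split)
    show ?case
    proof (rule wp_mono[OF wp_loop[OF r m]], simp, simp add: P0, elim exE conjE, goal_cases)
      case (1 s2 b q)
      note rD = repD[OF 1(1)]
      have pr: "pruned n E deg (count_list xs) k (pset (ah b))" by (rule pruned_pset[OF 1(2,3)])
      have im: "(\<lambda>i. im s2 (f + 4 * n + i)) ` {..<length q} = pset (ah b)"
      proof -
        have "(\<lambda>i. im s2 (f + 4 * n + i)) ` {..<length q} = (\<lambda>i. q ! i) ` {..<length q}"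
          using mem_q[OF rD(16)] by (intro image_cong) auto
        also have "\<dots> = set q" by (auto simp: set_conv_nth)
        finally show ?thesis using 1(5) by simp
      qed
      have t: "tm s2 + 5 \<le> 60000 * (k * k * length xs * (L + 1))"
      proof -
        have "tm s2 \<le> tm s1 + 400 * ((H + 1) * (k * length xs)) + 400 * ((4 * H + 3) * ((4 * k + 1) * length xs)) + 1"
          using 1(6) mu0 by simp
        moreover have "tm s1 = 35 + 4 * k + (6 * k + 6) * length xs + 4 * L"
          using su(22) t0 by simp
        moreover have "0 < length xs" using xs(2) by simp
        ultimately show ?thesis using time_bound[OF su(1), of "length xs" L] unfolding H_def by linarith
      qed
      have "\<exists>k' L' P. 0 < k' \<and> 2 \<le> real k' * rr s 0 \<and> real (k' - 1) * rr s 0 < 2 \<and> pruned n E deg (count_list xs) k' P \<and>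
          (\<lambda>i. im s2 (f + 4 * n + i)) ` {..<length q} = P \<and>
          (L' = 0 \<or> 2 ^ (L' - 1) \<le> 2 * k' * length xs) \<and> Suc (Suc (Suc (Suc (tm s2)))) \<le> 60000 * (k' * k' * length xs * (L' + 1))"
        using su(1,2,3,5) pr im t by (intro exI[of _ k] exI[of _ L] exI[of _ "pset (ah b)"]) (simp add: t0)
      then show ?case using rD(1-15) by (simp add: wp_Do add.assoc)
    qed
  qed
qed

section \<open>Cuts and volumes\<close>

lemma simple_graphD:
  assumes "simple_graph G"
  shows sg_fin: "finite (verts G)" and sg_sub: "e \<in> edges G \<Longrightarrow> e \<subseteq> verts G" and sg_card: "e \<in> edges G \<Longrightarrow> card e = 2"
    and sg_fin_edges: "finite (edges G)" and sg_fin_edge: "e \<in> edges G \<Longrightarrow> finite e"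
proof -
  show f: "finite (verts G)" and s: "\<And>e. e \<in> edges G \<Longrightarrow> e \<subseteq> verts G" and "e \<in> edges G \<Longrightarrow> card e = 2"
    using assms by (auto simp: simple_graph_def)
  have "edges G \<subseteq> Pow (verts G)" using s by auto
  then show "finite (edges G)" using f by (meson finite_Pow_iff finite_subset)
  show "e \<in> edges G \<Longrightarrow> finite e" using s f finite_subset by blast
qed

lemma edge_ne: "simple_graph G \<Longrightarrow> {u, v} \<in> edges G \<Longrightarrow> u \<noteq> v"
  using sg_card by fastforce

lemma edge_vert: "simple_graph G \<Longrightarrow> {u, v} \<in> edges G \<Longrightarrow> u \<in> verts G \<and> v \<in> verts G"
  using sg_sub by fastforce

lemma edge_other:
  assumes "simple_graph G" "e \<in> edges G" "v \<in> e"
  obtains u where "e = {v, u}" "u \<noteq> v"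
proof -
  from sg_card[OF assms(1,2)] obtain x y where "e = {x, y}" "x \<noteq> y" by (auto simp: card_2_iff)
  then show ?thesis using assms(3) that[of x] that[of y] by (auto simp: insert_commute)
qed

lemma degree_neighbours:
  assumes "simple_graph G"
  shows "degree G v = card (neighbours G v)"
proof -
  have "{e \<in> edges G. v \<in> e} = (\<lambda>u. {v, u}) ` neighbours G v"
  proof
    show "{e \<in> edges G. v \<in> e} \<subseteq> (\<lambda>u. {v, u}) ` neighbours G v"
    proof
      fix e assume e: "e \<in> {e \<in> edges G. v \<in> e}"
      then obtain u where "e = {v, u}" using edge_other[OF assms, of e v] by auto
      then show "e \<in> (\<lambda>u. {v, u}) ` neighbours G v" using e by (auto simp: neighbours_def)
    qed
  qed (auto simp: neighbours_def)
  moreover have "inj_on (\<lambda>u. {v, u}) (neighbours G v)" by (auto simp: inj_on_def doubleton_eq_iff)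
  ultimately show ?thesis unfolding degree_def by (simp add: card_image)
qed

lemma finite_neighbours: "simple_graph G \<Longrightarrow> finite (neighbours G v)"
  by (rule finite_subset[of _ "verts G"]) (auto simp: neighbours_def dest: edge_vert intro: sg_fin)

lemma cut_size_crossing:
  assumes G: "simple_graph G" and S: "finite S"
  shows "cut_size G S = (\<Sum>u\<in>S. card (neighbours G u \<inter> - S))"
proof -
  let ?A = "SIGMA u:S. neighbours G u \<inter> - S"
  have "{e \<in> edges G. e \<inter> S \<noteq> {} \<and> e - S \<noteq> {}} = (\<lambda>(u, v). {u, v}) ` ?A"
  proof
    show "{e \<in> edges G. e \<inter> S \<noteq> {} \<and> e - S \<noteq> {}} \<subseteq> (\<lambda>(u, v). {u, v}) ` ?A"
    proof
      fix e assume e: "e \<in> {e \<in> edges G. e \<inter> S \<noteq> {} \<and> e - S \<noteq> {}}"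
      then obtain u where u: "u \<in> e" "u \<in> S" by auto
      obtain v where v: "e = {u, v}" "v \<noteq> u" using edge_other[OF G _ u(1)] e by auto
      then have "v \<notin> S" using e u by auto
      then show "e \<in> (\<lambda>(u, v). {u, v}) ` ?A" using e u v by (auto simp: neighbours_def)
    qed
  qed (auto simp: neighbours_def)
  moreover have "inj_on (\<lambda>(u, v). {u, v}) ?A" by (auto simp: inj_on_def doubleton_eq_iff)
  ultimately have "cut_size G S = card ?A" unfolding cut_size_def by (simp add: card_image)
  also have "\<dots> = (\<Sum>u\<in>S. card (neighbours G u \<inter> - S))"
    using S finite_neighbours[OF G] by (intro card_SigmaI) auto
  finally show ?thesis .
qed

lemma cut_size_le_vol: "simple_graph G \<Longrightarrow> finite S \<Longrightarrow> cut_size G S \<le> vol G S"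
  by (simp add: cut_size_crossing vol_def degree_neighbours) (intro sum_mono card_mono finite_neighbours Int_lower1)

lemma cut_size_independent:
  assumes "simple_graph G" "finite S" "\<And>u v. u \<in> S \<Longrightarrow> v \<in> S \<Longrightarrow> {u, v} \<notin> edges G"
  shows "cut_size G S = vol G S"
  unfolding cut_size_crossing[OF assms(1,2)] vol_def degree_neighbours[OF assms(1)]
  using assms(3) by (intro sum.cong refl arg_cong[where f = card]) (auto simp: neighbours_def)

lemma cut_size_compl:
  assumes "simple_graph G" "S \<subseteq> verts G"
  shows "cut_size G (verts G - S) = cut_size G S"
proof -
  have "e \<inter> (verts G - S) \<noteq> {} \<and> e - (verts G - S) \<noteq> {} \<longleftrightarrow> e \<inter> S \<noteq> {} \<and> e - S \<noteq> {}" if "e \<in> edges G" for e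
    using sg_sub[OF assms(1) that] assms(2) by auto
  then show ?thesis unfolding cut_size_def by (intro arg_cong[where f = card]) blast
qed

lemma vol_compl: "finite (verts G) \<Longrightarrow> S \<subseteq> verts G \<Longrightarrow> vol G S + vol G (verts G - S) = vol G (verts G)"
  unfolding vol_def using sum.subset_diff[of S "verts G" "degree G"] by simp

lemma vol_mono: "finite B \<Longrightarrow> A \<subseteq> B \<Longrightarrow> vol G A \<le> vol G B"
  unfolding vol_def by (rule sum_mono2) auto

lemma sum_degrees:
  assumes "finite F" "finite V" "\<And>e. e \<in> F \<Longrightarrow> finite e"
  shows "(\<Sum>v\<in>V. card {e \<in> F. v \<in> e}) = (\<Sum>e\<in>F. card (e \<inter> V))"
proof -
  have "(\<Sum>v\<in>V. card {e \<in> F. v \<in> e}) = (\<Sum>v\<in>V. \<Sum>e\<in>F. if v \<in> e then 1 else 0)"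
    using assms by (intro sum.cong refl) (simp add: sum.If_cases Int_def)
  also have "\<dots> = (\<Sum>e\<in>F. \<Sum>v\<in>V. if v \<in> e then 1 else 0)" by (rule sum.swap)
  also have "\<dots> = (\<Sum>e\<in>F. card (e \<inter> V))"
    using assms by (intro sum.cong refl) (simp add: sum.If_cases Int_commute)
  finally show ?thesis .
qed

lemma handshake:
  assumes "simple_graph G"
  shows "vol G (verts G) = 2 * card (edges G)"
proof -
  have "vol G (verts G) = (\<Sum>e\<in>edges G. card (e \<inter> verts G))"
    unfolding vol_def degree_def using assms sg_fin sg_fin_edges sg_fin_edge by (intro sum_degrees) blast+
  also have "\<dots> = (\<Sum>e\<in>edges G. 2)"
    using sg_card[OF assms] sg_sub[OF assms] by (intro sum.cong refl) (simp add: Int_absorb2)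
  finally show ?thesis by simp
qed

lemma conductance_le: "is_cut G S \<Longrightarrow> conductance G \<le> ereal (cut_conductance G S)"
  unfolding conductance_def by (rule INF_lower) simp

section \<open>Graphs of small maximal degree have small conductance\<close>

definition sg :: "'a set \<Rightarrow> 'a \<Rightarrow> real" where
  "sg X v = (if v \<in> X then 1 else - 1)"

lemma sum_sg:
  assumes V: "finite V" and u: "u \<in> V" and ne: "u \<noteq> v"
  shows "(\<Sum>X\<in>Pow V. sg X u * sg X v) = 0"
proof -
  define i where "i X = (if u \<in> X then X - {u} else insert u X)" for X
  have "bij_betw i (Pow V) (Pow V)"
    by (rule bij_betw_byWitness[where f' = i]) (use u in \<open>auto simp: i_def split: if_splits\<close>)
  then have "(\<Sum>X\<in>Pow V. sg X u * sg X v) = (\<Sum>X\<in>Pow V. sg (i X) u * sg (i X) v)"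
    by (rule sum.reindex_bij_betw[symmetric])
  also have "\<dots> = - (\<Sum>X\<in>Pow V. sg X u * sg X v)"
    unfolding sum_negf[symmetric] using ne by (intro sum.cong refl) (auto simp: sg_def i_def)
  finally show ?thesis by simp
qed

lemma sum_cut_size:
  assumes G: "simple_graph G"
  shows "(\<Sum>X\<in>Pow (verts G). real (cut_size G X)) = 2 ^ card (verts G) * real (card (edges G)) / 2"
proof -
  note f = sg_fin_edges[OF G] and fv = sg_fin[OF G]
  have "(\<Sum>X\<in>Pow (verts G). real (cut_size G X)) =
      (\<Sum>X\<in>Pow (verts G). \<Sum>e\<in>edges G. if e \<inter> X \<noteq> {} \<and> e - X \<noteq> {} then 1 else 0)"
    unfolding cut_size_def using f by (intro sum.cong refl) (simp add: sum.If_cases Int_def)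
  also have "\<dots> = (\<Sum>e\<in>edges G. \<Sum>X\<in>Pow (verts G). if e \<inter> X \<noteq> {} \<and> e - X \<noteq> {} then 1 else 0)" by (rule sum.swap)
  also have "\<dots> = (\<Sum>e\<in>edges G. 2 ^ card (verts G) / 2)"
  proof (intro sum.cong refl)
    fix e assume e: "e \<in> edges G"
    then obtain u v where uv: "e = {u, v}" "u \<noteq> v" using sg_card[OF G e] by (auto simp: card_2_iff)
    have "(\<Sum>X\<in>Pow (verts G). if e \<inter> X \<noteq> {} \<and> e - X \<noteq> {} then 1 else 0) =
        (\<Sum>X\<in>Pow (verts G). 1 / 2 - sg X u * sg X v / 2)"
      using uv by (intro sum.cong refl) (auto simp: sg_def)
    also have "\<dots> = real (card (Pow (verts G))) / 2 - (\<Sum>X\<in>Pow (verts G). sg X u * sg X v) / 2"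
      by (simp add: sum_subtractf sum_divide_distrib)
    also have "\<dots> = 2 ^ card (verts G) / 2"
      using sum_sg[OF fv _ uv(2)] sg_sub[OF G e] uv(1) by (simp add: card_Pow[OF fv])
    finally show "(\<Sum>X\<in>Pow (verts G). if e \<inter> X \<noteq> {} \<and> e - X \<noteq> {} then 1 else 0) = (2 ^ card (verts G) / 2 :: real)" .
  qed
  finally show ?thesis by simp
qed

lemma sum_imbalance:
  fixes d :: "'a \<Rightarrow> real"
  assumes V: "finite V"
  shows "(\<Sum>X\<in>Pow V. (\<Sum>v\<in>V. d v * sg X v)\<^sup>2) = 2 ^ card V * (\<Sum>v\<in>V. (d v)\<^sup>2)"
proof -
  have "(\<Sum>X\<in>Pow V. (\<Sum>v\<in>V. d v * sg X v)\<^sup>2) =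
      (\<Sum>X\<in>Pow V. \<Sum>u\<in>V. \<Sum>v\<in>V. d u * d v * (sg X u * sg X v))"
    unfolding power2_eq_square sum_product by (intro sum.cong refl) simp
  also have "\<dots> = (\<Sum>u\<in>V. \<Sum>X\<in>Pow V. \<Sum>v\<in>V. d u * d v * (sg X u * sg X v))" by (rule sum.swap)
  also have "\<dots> = (\<Sum>u\<in>V. \<Sum>v\<in>V. d u * d v * (\<Sum>X\<in>Pow V. sg X u * sg X v))"
    unfolding sum_distrib_left by (intro sum.cong refl sum.swap)
  also have "\<dots> = (\<Sum>u\<in>V. \<Sum>v\<in>V. if v = u then 2 ^ card V * (d u)\<^sup>2 else 0)"
  proof (intro sum.cong refl)
    fix u v assume u: "u \<in> V"
    show "d u * d v * (\<Sum>X\<in>Pow V. sg X u * sg X v) = (if v = u then 2 ^ card V * (d u)\<^sup>2 else 0)"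
    proof (cases "v = u")
      case True
      have "(\<Sum>X\<in>Pow V. sg X u * sg X u) = (\<Sum>X\<in>Pow V. 1)" by (intro sum.cong refl) (auto simp: sg_def)
      then show ?thesis using True by (simp add: card_Pow[OF V] power2_eq_square)
    next
      case False
      then show ?thesis using sum_sg[OF V u] by simp
    qed
  qed
  also have "\<dots> = 2 ^ card V * (\<Sum>v\<in>V. (d v)\<^sup>2)" using V by (simp add: sum_distrib_left)
  finally show ?thesis .
qed

lemma conductance_small:
  assumes G: "simple_graph G" and deg: "\<And>v. v \<in> verts G \<Longrightarrow> 10 ^ 6 * degree G v \<le> card (edges G)"
    and m: "0 < card (edges G)"
  shows "conductance G < ereal (27 / 50)"
proof -
  let ?m = "real (card (edges G))" and ?V = "verts G"
  note fv = sg_fin[OF G]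
  define I where "I X = (\<Sum>v\<in>?V. real (degree G v) * sg X v)" for X
  have vV: "(\<Sum>v\<in>?V. real (degree G v)) = 2 * ?m"
    using handshake[OF G] unfolding vol_def by (metis of_nat_mult of_nat_numeral of_nat_sum)
  have "(\<Sum>v\<in>?V. (real (degree G v))\<^sup>2) \<le> (\<Sum>v\<in>?V. ?m / 10 ^ 6 * real (degree G v))"
  proof (rule sum_mono)
    fix v assume "v \<in> ?V"
    from deg[OF this] have "real (10 ^ 6 * degree G v) \<le> ?m" by (simp only: of_nat_le_iff)
    then have "real (degree G v) \<le> ?m / 10 ^ 6" by simp
    then show "(real (degree G v))\<^sup>2 \<le> ?m / 10 ^ 6 * real (degree G v)"
      unfolding power2_eq_square by (rule mult_right_mono) simp
  qed
  also have "\<dots> = ?m / 10 ^ 6 * (2 * ?m)" by (simp only: sum_distrib_left[symmetric] vV)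
  finally have d2: "(\<Sum>v\<in>?V. (real (degree G v))\<^sup>2) \<le> ?m / 10 ^ 6 * (2 * ?m)" .
  have "(\<Sum>X\<in>Pow ?V. real (cut_size G X) + 1000 * (I X)\<^sup>2 / ?m) \<le> (\<Sum>X\<in>Pow ?V. 502 / 1000 * ?m)"
  proof -
    have "(\<Sum>X\<in>Pow ?V. real (cut_size G X) + 1000 * (I X)\<^sup>2 / ?m) =
       2 ^ card ?V * ?m / 2 + 1000 * (2 ^ card ?V * (\<Sum>v\<in>?V. (real (degree G v))\<^sup>2)) / ?m"
      unfolding sum.distrib sum_cut_size[OF G] sum_imbalance[OF fv, symmetric] I_def
      by (simp add: sum_distrib_left sum_divide_distrib)
    also have "\<dots> \<le> 2 ^ card ?V * ?m / 2 + 1000 * (2 ^ card ?V * (?m / 10 ^ 6 * (2 * ?m))) / ?m"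
      using d2 m by (intro add_left_mono divide_right_mono mult_left_mono) auto
    also have "\<dots> = 2 ^ card ?V * (502 / 1000 * ?m)" using m by (simp add: field_simps)
    also have "\<dots> = (\<Sum>X\<in>Pow ?V. 502 / 1000 * ?m)" by (simp add: card_Pow[OF fv])
    finally show ?thesis .
  qed
  then have "\<exists>X\<in>Pow ?V. real (cut_size G X) + 1000 * (I X)\<^sup>2 / ?m \<le> 502 / 1000 * ?m"
  proof (rule contrapos_pp)
    assume "\<not> (\<exists>X\<in>Pow ?V. real (cut_size G X) + 1000 * (I X)\<^sup>2 / ?m \<le> 502 / 1000 * ?m)"
    then have "(\<Sum>X\<in>Pow ?V. 502 / 1000 * ?m) < (\<Sum>X\<in>Pow ?V. real (cut_size G X) + 1000 * (I X)\<^sup>2 / ?m)"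
      using fv by (intro sum_strict_mono) (auto simp: not_le)
    then show "\<not> (\<Sum>X\<in>Pow ?V. real (cut_size G X) + 1000 * (I X)\<^sup>2 / ?m) \<le> (\<Sum>X\<in>Pow ?V. 502 / 1000 * ?m)" by simp
  qed
  then obtain X where X: "X \<subseteq> ?V" and b: "real (cut_size G X) + 1000 * (I X)\<^sup>2 / ?m \<le> 502 / 1000 * ?m" by auto
  have c: "real (cut_size G X) \<le> 502 / 1000 * ?m" using b m by (smt (verit) divide_nonneg_pos mult_nonneg_nonneg of_nat_0_less_iff zero_le_power2)
  have "1000 * (I X)\<^sup>2 / ?m \<le> 502 / 1000 * ?m" using b by (smt (verit) of_nat_0_le_iff)
  then have "(I X)\<^sup>2 \<le> 502 / 1000000 * ?m * ?m" using m by (simp add: field_simps)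
  also have "\<dots> \<le> (?m / 40)\<^sup>2" by (simp add: power2_eq_square)
  finally have I: "\<bar>I X\<bar> \<le> ?m / 40" using abs_le_square_iff[of "I X" "?m / 40"] by simp
  have IX: "I X = real (vol G X) - real (vol G (?V - X))"
  proof -
    have "I X = (\<Sum>v\<in>?V - X. real (degree G v) * sg X v) + (\<Sum>v\<in>X. real (degree G v) * sg X v)"
      unfolding I_def by (rule sum.subset_diff[OF X fv])
    also have "(\<Sum>v\<in>X. real (degree G v) * sg X v) = real (vol G X)" by (simp add: vol_def sg_def)
    also have "(\<Sum>v\<in>?V - X. real (degree G v) * sg X v) = - real (vol G (?V - X))"
      by (simp add: vol_def sg_def sum_negf)
    finally show ?thesis by simp
  qed
  have sum: "real (vol G X) + real (vol G (?V - X)) = 2 * ?m"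
    using vol_compl[OF fv X] handshake[OF G] by (metis of_nat_add of_nat_mult of_nat_numeral)
  let ?k = "real (min (vol G X) (vol G (?V - X)))"
  have mn: "79 / 80 * ?m \<le> ?k" using I IX sum unfolding min_def by (split if_split) linarith
  have "real (cut_size G X) < 27 / 50 * ?k" using c mn m by simp
  then have "cut_conductance G X < 27 / 50"
    unfolding cut_conductance_def using mn m by (simp add: divide_less_eq)
  moreover have "is_cut G X"
  proof -
    have "0 < vol G X" "0 < vol G (?V - X)" using mn m by (auto simp: min_def split: if_splits)
    then show ?thesis using X unfolding is_cut_def by (auto simp: vol_def)
  qed
  ultimately show ?thesis using conductance_le by (meson ereal_less_eq(3) less_ereal.simps(1) order.strict_trans1)
qed

section \<open>The pruned graph\<close>

locale update =
  fixes G :: "nat ugraph" and D :: "nat set set" and n :: nat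
  assumes G: "simple_graph G" and Gb: "simple_graph (add_edges G D)" and disj: "D \<inter> edges G = {}"
    and V: "verts G = {..<n}"
begin

abbreviation "Gb \<equiv> add_edges G D"
abbreviation "E \<equiv> \<lambda>u v. {u, v} \<in> edges G"

definition dd :: "nat \<Rightarrow> nat" where "dd v = card {e \<in> D. v \<in> e}"
definition dcut :: "nat set \<Rightarrow> nat" where "dcut S = card {e \<in> D. e \<inter> S \<noteq> {} \<and> e - S \<noteq> {}}"

lemma verts_Gb [simp]: "verts Gb = verts G" and edges_Gb [simp]: "edges Gb = edges G \<union> D"
  by (simp_all add: add_edges_def)

lemma fin_D: "finite D" and D_card: "e \<in> D \<Longrightarrow> card e = 2" and D_sub: "e \<in> D \<Longrightarrow> e \<subseteq> {..<n}" and fin_e: "e \<in> D \<Longrightarrow> finite e"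
  using sg_fin_edges[OF Gb] sg_card[OF Gb, of e] sg_sub[OF Gb, of e] sg_fin_edge[OF Gb, of e] V by auto

lemma degree_Gb: "degree Gb v = degree G v + dd v"
proof -
  have "{e \<in> edges Gb. v \<in> e} = {e \<in> edges G. v \<in> e} \<union> {e \<in> D. v \<in> e}" by auto
  then show ?thesis unfolding degree_def dd_def
    using fin_D sg_fin_edges[OF G] disj by (subst card_Un_disjoint[symmetric]) auto
qed

lemma vol_Gb: "vol Gb S = vol G S + sum dd S"
  by (simp add: vol_def degree_Gb sum.distrib)

lemma vol_le_Gb: "real (vol G S) \<le> real (vol Gb S)"
  unfolding vol_Gb of_nat_le_iff by simp

lemma cut_Gb: "cut_size Gb S = cut_size G S + dcut S"
proof -
  have "{e \<in> edges Gb. e \<inter> S \<noteq> {} \<and> e - S \<noteq> {}} =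
      {e \<in> edges G. e \<inter> S \<noteq> {} \<and> e - S \<noteq> {}} \<union> {e \<in> D. e \<inter> S \<noteq> {} \<and> e - S \<noteq> {}}"
    unfolding edges_Gb by blast
  moreover have "card ({e \<in> edges G. e \<inter> S \<noteq> {} \<and> e - S \<noteq> {}} \<union> {e \<in> D. e \<inter> S \<noteq> {} \<and> e - S \<noteq> {}}) =
      card {e \<in> edges G. e \<inter> S \<noteq> {} \<and> e - S \<noteq> {}} + card {e \<in> D. e \<inter> S \<noteq> {} \<and> e - S \<noteq> {}}"
    using fin_D sg_fin_edges[OF G] disj by (intro card_Un_disjoint) (simp_all, blast)
  ultimately show ?thesis unfolding cut_size_def dcut_def by simp
qed

lemma sum_dd: "finite S \<Longrightarrow> sum dd S = (\<Sum>e\<in>D. card (e \<inter> S))"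
  unfolding dd_def by (rule sum_degrees[OF fin_D _ fin_e])

lemma dcut_sum: "dcut S = (\<Sum>e\<in>D. if e \<inter> S \<noteq> {} \<and> e - S \<noteq> {} then 1 else 0)"
  unfolding dcut_def using fin_D by (simp add: sum.If_cases Int_def)

lemma dcut_le: "finite S \<Longrightarrow> dcut S \<le> sum dd S"
  unfolding sum_dd dcut_sum using fin_e
  by (intro sum_mono) (auto simp: Suc_le_eq card_gt_0_iff)

lemma sum_dd_dcut: "finite S \<Longrightarrow> sum dd S + dcut S \<le> 2 * card D"
proof -
  assume S: "finite S"
  have "sum dd S + dcut S = (\<Sum>e\<in>D. card (e \<inter> S) + (if e \<inter> S \<noteq> {} \<and> e - S \<noteq> {} then 1 else 0))"
    unfolding sum_dd[OF S] dcut_sum by (simp add: sum.distrib)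
  also have "\<dots> \<le> (\<Sum>e\<in>D. 2)"
  proof (rule sum_mono)
    fix e assume e: "e \<in> D"
    show "card (e \<inter> S) + (if e \<inter> S \<noteq> {} \<and> e - S \<noteq> {} then 1 else 0) \<le> 2"
    proof (cases "e - S = {}")
      case False
      then have "card (e \<inter> S) < card e" using fin_e[OF e] by (intro psubset_card_mono) auto
      then show ?thesis using D_card[OF e] by simp
    next
      case True
      then show ?thesis using D_card[OF e] card_mono[OF fin_e[OF e], of "e \<inter> S"] by simp
    qed
  qed
  finally show ?thesis by simp
qed

lemma sum_dd_le: "finite S \<Longrightarrow> sum dd S \<le> 2 * card D"
  using sum_dd_dcut[of S] by simp

lemma cut_crossing: "finite S \<Longrightarrow> cut_size G S = crossing E S (- S)"
  by (simp add: cut_size_crossing[OF G] crossing_def neighbours_def)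

lemma expansion:
  assumes c: "ereal \<phi> \<le> conductance Gb" and S: "S \<noteq> {}" "S \<subset> {..<n}" "vol Gb S \<le> vol Gb ({..<n} - S)"
  shows "\<phi> * real (vol Gb S) \<le> real (cut_size Gb S)"
    and "0 < \<phi> \<Longrightarrow> 0 < vol Gb S"
proof -
  have "is_cut Gb S" using S V by (simp add: is_cut_def)
  from order.trans[OF c conductance_le[OF this]] have "\<phi> \<le> cut_conductance Gb S" by simp
  then have le: "\<phi> \<le> real (cut_size Gb S) / real (vol Gb S)"
    using S(3) V by (simp add: cut_conductance_def min_def)
  show "\<phi> * real (vol Gb S) \<le> real (cut_size Gb S)"
    using le by (cases "vol Gb S = 0") (simp_all add: pos_le_divide_eq)
  show "0 < \<phi> \<Longrightarrow> 0 < vol Gb S" using le by (cases "vol Gb S = 0") auto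
qed

lemma induced_simple: "simple_graph (induced G U)" if "U \<subseteq> {..<n}"
  using G that V finite_subset[OF that] by (auto simp: simple_graph_def induced_def)

lemma degree_induced: "degree (induced G U) v \<le> degree G v"
  unfolding degree_def induced_def using sg_fin_edges[OF G] by (intro card_mono) auto

lemma vol_induced: "vol (induced G U) S \<le> vol G S"
  unfolding vol_def by (intro sum_mono degree_induced)

lemma cut_induced:
  assumes "S \<subseteq> {..<n} - P"
  shows "cut_size (induced G ({..<n} - P)) S = crossing E S (- (P \<union> S))"
proof -
  have fS: "finite S" using assms finite_subset by blast
  have "cut_size (induced G ({..<n} - P)) S = (\<Sum>u\<in>S. card (neighbours (induced G ({..<n} - P)) u \<inter> - S))"
    by (rule cut_size_crossing[OF induced_simple fS]) auto
  also have "\<dots> = crossing E S (- (P \<union> S))"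
    unfolding crossing_def
  proof (intro sum.cong refl arg_cong[where f = card])
    fix u assume "u \<in> S"
    then have "u \<in> {..<n} - P" using assms by auto
    then show "neighbours (induced G ({..<n} - P)) u \<inter> - S = {v. E u v} \<inter> - (P \<union> S)"
      using edge_vert[OF G] V by (auto simp: neighbours_def induced_def)
  qed
  finally show ?thesis .
qed

lemma pruned_answer:
  assumes pr: "pruned n E (degree G) dd k P" and k: "0 < k" "2 \<le> real k * \<phi>" "real k * \<phi> \<le> 3" and \<phi>: "0 < \<phi>" "\<phi> \<le> 1"
    and D: "14 * real (card D) \<le> \<phi> * real (card (edges G))" "D \<noteq> {}"
  shows "P \<subset> verts G"
    and "ereal \<phi> \<le> conductance Gb \<Longrightarrow> real (vol G P) \<le> 2 * real (card D) / \<phi> \<and>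
       ereal (\<phi> / 5) \<le> conductance (induced G (verts G - P))"
proof -
  let ?m = "real (card (edges G))"
  have Pn: "P \<subseteq> {..<n}" and p1: "vol G P + 2 * k * crossing E P (- P) \<le> 2 * k * sum dd P"
    and p2: "vol G P \<le> 2 * k * sum dd {..<n}"
    and p3: "\<And>S. S \<subseteq> {..<n} - P \<Longrightarrow> k * (sum dd S + crossing E S P) \<le> vol G S + k * crossing E S (- (P \<union> S))"
    using pr unfolding pruned_def vol_def by blast+
  have fP: "finite P" using Pn finite_subset by blast
  have c1: "1 \<le> real (card D)" using D(2) fin_D by (simp add: Suc_le_eq card_gt_0_iff)
  have m0: "0 < ?m" using D(1) c1 \<phi> by (smt (verit) mult_nonneg_nonpos)
  have "vol G P \<le> 2 * k * (2 * card D)" using order.trans[OF p2 mult_le_mono2[OF sum_dd_le]] by simp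
  then have "real (vol G P) \<le> 4 * (real k * real (card D))"
    using of_nat_mono[of "vol G P" "2 * k * (2 * card D)", where 'a = real] by simp
  then have "\<phi> * real (vol G P) \<le> \<phi> * (4 * (real k * real (card D)))" using \<phi> by (intro mult_left_mono) auto
  also have "\<dots> = 4 * ((real k * \<phi>) * real (card D))" by simp
  also have "\<dots> \<le> 4 * (3 * real (card D))" using k(3) by (intro mult_left_mono mult_right_mono) auto
  finally have v1: "\<phi> * real (vol G P) \<le> 12 * real (card D)" by simp
  have dle: "2 * real (card D) \<le> \<phi> * ?m" using D(1) c1 by linarith
  have "\<phi> * (real (vol G P) + 2 * real (card D)) \<le> 12 * real (card D) + 2 * real (card D)"
    using v1 \<phi> mult_right_mono[OF \<phi>(2), of "2 * real (card D)"] unfolding distrib_left by linarith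
  also have "\<dots> \<le> \<phi> * ?m" using D(1) by simp
  finally have v2: "real (vol G P) + 2 * real (card D) \<le> ?m" using \<phi> by simp
  have hs: "vol G {..<n} = 2 * card (edges G)" using handshake[OF G] V by simp
  have PV: "P \<noteq> {..<n}"
  proof
    assume "P = {..<n}"
    then show False using v2 hs m0 c1 by simp
  qed
  then show "P \<subset> verts G" using Pn V by auto
  have volGb: "vol Gb S + vol Gb ({..<n} - S) = vol Gb {..<n}" if "S \<subseteq> {..<n}" for S
    using vol_compl[of Gb S] sg_fin[OF Gb] that V by simp
  show "real (vol G P) \<le> 2 * real (card D) / \<phi> \<and> ereal (\<phi> / 5) \<le> conductance (induced G (verts G - P))"
    if cond: "ereal \<phi> \<le> conductance Gb"
  proof
    show "real (vol G P) \<le> 2 * real (card D) / \<phi>"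
    proof (cases "P = {}")
      case True
      then show ?thesis using \<phi> by (simp add: vol_def)
    next
      case False
      have "real (vol Gb P) \<le> ?m"
        using v2 of_nat_mono[OF sum_dd_le[OF fP], where 'a = real] unfolding vol_Gb by simp
      moreover have "2 * ?m \<le> real (vol Gb {..<n})" 
      proof -
        have "2 * card (edges G) \<le> vol Gb {..<n}" using hs vol_Gb[of "{..<n}"] by simp
        from of_nat_mono[OF this, where 'a = real] show ?thesis by simp
      qed
      ultimately have "vol Gb P \<le> vol Gb ({..<n} - P)" using volGb[OF Pn] by linarith
      from expansion(1)[OF cond False _ this] have "\<phi> * real (vol Gb P) \<le> real (cut_size Gb P)"
        using Pn PV by auto
      also have "cut_size Gb P = crossing E P (- P) + dcut P" using cut_Gb cut_crossing[OF fP] by simp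
      also have "crossing E P (- P) \<le> sum dd P"
      proof -
        have "2 * k * crossing E P (- P) \<le> 2 * k * sum dd P" by (rule order.trans[OF le_add2 p1])
        then show ?thesis using k(1) by simp
      qed
      then have "real (crossing E P (- P) + dcut P) \<le> 2 * real (card D)"
        using sum_dd_dcut[OF fP] by linarith
      finally have "\<phi> * real (vol Gb P) \<le> 2 * real (card D)" .
      moreover have "\<phi> * real (vol G P) \<le> \<phi> * real (vol Gb P)" 
        using \<phi> vol_le_Gb by (intro mult_left_mono) auto
      ultimately have "\<phi> * real (vol G P) \<le> 2 * real (card D)" by (rule order.trans[rotated])
      then show ?thesis using \<phi> by (simp add: pos_le_divide_eq mult.commute)
    qed
    let ?R = "{..<n} - P"
    let ?H = "induced G ?R"
    have vH: "verts ?H = ?R" by (simp add: induced_def)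
    have sH: "simple_graph ?H" by (rule induced_simple) auto
    have key: "\<phi> / 5 * real (vol Gb S) \<le> real (cut_size ?H S) \<and> 0 < vol Gb S"
      if S: "S \<noteq> {}" "S \<subseteq> ?R" "S \<noteq> {..<n}" "vol Gb S \<le> vol Gb ({..<n} - S)" for S
    proof -
      have fS: "finite S" using S(2) finite_subset by blast
      have Sn: "S \<subset> {..<n}" using S by auto
      let ?c = "crossing E S (- (P \<union> S))"
      have disj: "P \<inter> - (P \<union> S) = {}" by auto
      have "crossing E S (- S) = crossing E S P + ?c"
        unfolding crossing_def sum.distrib[symmetric]
      proof (intro sum.cong refl)
        fix u
        have "{v. E u v} \<inter> - S = ({v. E u v} \<inter> P) \<union> ({v. E u v} \<inter> - (P \<union> S))" using S(2) by auto
        moreover have "finite {v. E u v}" using finite_neighbours[OF G, of u] by (simp add: neighbours_def)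
        ultimately show "card ({v. E u v} \<inter> - S) = card ({v. E u v} \<inter> P) + card ({v. E u v} \<inter> - (P \<union> S))"
          using card_Un_disjoint[of "{v. E u v} \<inter> P" "{v. E u v} \<inter> - (P \<union> S)"] by auto
      qed
      then have "cut_size Gb S \<le> crossing E S P + ?c + sum dd S"
        using cut_Gb cut_crossing[OF fS] dcut_le[OF fS] by simp
      then have "real k * real (cut_size Gb S) \<le> real k * (real (sum dd S + crossing E S P) + real ?c)"
        by (intro mult_left_mono) (simp_all flip: of_nat_add)
      also have "\<dots> = real (k * (sum dd S + crossing E S P)) + real k * real ?c" by (simp add: distrib_left)
      also have "\<dots> \<le> real (vol G S + k * ?c) + real k * real ?c"
        using p3[OF S(2)] by (intro add_right_mono) (simp only: of_nat_le_iff)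
      also have "\<dots> \<le> real (vol Gb S) + 2 * (real k * real ?c)" using vol_le_Gb[of S] by simp
      finally have a: "real k * real (cut_size Gb S) \<le> real (vol Gb S) + 2 * (real k * real ?c)" .
      have "real k * (\<phi> * real (vol Gb S)) \<le> real k * real (cut_size Gb S)"
        using expansion(1)[OF cond S(1) Sn S(4)] by (intro mult_left_mono) auto
      then have b: "real k * \<phi> * real (vol Gb S) \<le> real (vol Gb S) + 2 * (real k * real ?c)" using a by simp
      have "2 * real (vol Gb S) \<le> real k * \<phi> * real (vol Gb S)" using k(2) by (intro mult_right_mono) auto
      then have "real k * \<phi> * real (vol Gb S) \<le> 4 * (real k * real ?c)" using b by simp
      then have "\<phi> * real (vol Gb S) \<le> 4 * real ?c" using k(1) by simp
      moreover have "0 \<le> \<phi> * real (vol Gb S)" using \<phi> by simp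
      ultimately have "\<phi> / 5 * real (vol Gb S) \<le> real ?c" by linarith
      then show ?thesis using cut_induced[OF S(2)] expansion(2)[OF cond S(1) Sn S(4) \<phi>(1)] by simp
    qed
    have "ereal (\<phi> / 5) \<le> conductance ?H"
      unfolding conductance_def
    proof (rule INF_greatest)
      fix S assume "S \<in> {S. is_cut ?H S}"
      then have S: "S \<noteq> {}" "S \<subset> ?R" by (auto simp: is_cut_def vH)
      define S' where "S' = (if vol Gb S \<le> vol Gb ({..<n} - S) then S else ?R - S)"
      have S'R: "S' \<subseteq> ?R" "S' \<noteq> {}" "S' \<noteq> {..<n}" using S by (auto simp: S'_def)
      have half: "vol Gb S' \<le> vol Gb ({..<n} - S')"
      proof (cases "vol Gb S \<le> vol Gb ({..<n} - S)")
        case False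
        have "vol Gb (?R - S) \<le> vol Gb ({..<n} - S)" "vol Gb S \<le> vol Gb ({..<n} - (?R - S))"
          using S by (auto intro!: vol_mono)
        then show ?thesis using False by (simp add: S'_def)
      qed (simp add: S'_def)
      from key[OF S'R(2,1,3) half] have k': "\<phi> / 5 * real (vol Gb S') \<le> real (cut_size ?H S')" "0 < vol Gb S'" by auto
      have SR: "S \<subseteq> verts ?H" using S vH by auto
      have cS: "cut_size ?H S' = cut_size ?H S"
        using cut_size_compl[OF sH SR] vH by (simp add: S'_def)
      have fin: "finite S" "finite (?R - S)" using S finite_subset[of S "{..<n}"] by auto
      have pos: "0 < cut_size ?H S"
      proof -
        have "0 < \<phi> / 5 * real (vol Gb S')" using k'(2) \<phi> by simp
        then show ?thesis using k'(1) cS by simp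
      qed
      have v1: "0 < vol ?H S" "0 < vol ?H (?R - S)"
        using cut_size_le_vol[OF sH fin(1)] cut_size_le_vol[OF sH fin(2)] cut_size_compl[OF sH SR] pos vH by auto
      have "min (vol ?H S) (vol ?H (?R - S)) \<le> vol ?H S'" by (simp add: S'_def)
      also have "\<dots> \<le> vol Gb S'" using vol_induced[of ?R S'] vol_Gb[of S'] by simp
      finally have "\<phi> / 5 * real (min (vol ?H S) (vol ?H (?R - S))) \<le> \<phi> / 5 * real (vol Gb S')"
        using \<phi> by (intro mult_left_mono) auto
      also have "\<dots> \<le> real (cut_size ?H S)" using k'(1) cS by simp
      finally have "\<phi> / 5 \<le> cut_conductance ?H S"
        unfolding cut_conductance_def vH using v1 by (simp add: pos_le_divide_eq)
      then show "ereal (\<phi> / 5) \<le> ereal (cut_conductance ?H S)" by simp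
    qed
    then show "ereal (\<phi> / 5) \<le> conductance (induced G (verts G - P))" using V by simp
  qed
qed

end

section \<open>Runs that do not read the changed cells\<close>

definition read_adr :: "program \<Rightarrow> config \<Rightarrow> nat" where
  "read_adr Q s = (if pc s < length Q then (case Q ! pc s of IRead d a \<Rightarrow> ireg s a | _ \<Rightarrow> 0) else 0)"

definition sim :: "nat set \<Rightarrow> (nat \<Rightarrow> nat) \<Rightarrow> (nat \<Rightarrow> nat) \<Rightarrow> config \<Rightarrow> config \<Rightarrow> bool" where
  "sim Z M M' s s' \<longleftrightarrow> pc s' = pc s \<and> ireg s' = ireg s \<and> rreg s' = rreg s \<and> rmem s' = rmem s \<and>
     (\<forall>c. imem s' c = imem s c \<or> c \<in> Z \<and> imem s c = M c \<and> imem s' c = M' c)"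

lemma sim_step:
  assumes s: "sim Z M M' s s'" and r: "read_adr Q s \<notin> Z"
  shows "sim Z M M' (step Q s) (step Q s')"
proof (cases "pc s < length Q")
  case False
  then show ?thesis using s by (simp add: step_def sim_def)
next
  case True
  have eq: "imem s' c = imem s c" if "c \<notin> Z" for c using s that unfolding sim_def by blast
  have st: "step Q s = exec (Q ! pc s) s" "step Q s' = exec (Q ! pc s) s'"
    using True s by (auto simp: step_def sim_def)
  show ?thesis
  proof (cases "Q ! pc s")
    case (IRead d a)
    then have "ireg s a \<notin> Z" using r True by (simp add: read_adr_def)
    then show ?thesis using s eq unfolding st IRead by (auto simp: sim_def set_ireg_def)
  qed (use s in \<open>auto simp: st sim_def set_ireg_def set_rreg_def\<close>)
qed

lemma sim_run:
  assumes "sim Z M M' s s'" and "\<And>j. j < k \<Longrightarrow> read_adr Q ((step Q ^^ j) s) \<notin> Z"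
  shows "sim Z M M' ((step Q ^^ k) s) ((step Q ^^ k) s')"
  using assms(2) by (induction k) (auto simp: assms(1) intro: sim_step)

lemma halts_after_unique:
  assumes "halts_after Q s k x" "halts_after Q s l y"
  shows "x = y"
proof -
  have stay: "(step Q ^^ i) z = z" if "length Q \<le> pc z" for i z
    using that by (induction i) (auto simp: step_def)
  have *: "x = y" if "halts_after Q s k x" "halts_after Q s l y" "k \<le> l" for k l x y
  proof -
    have "(step Q ^^ l) s = (step Q ^^ (l - k)) ((step Q ^^ k) s)"
      using that(3) by (metis funpow_add le_add_diff_inverse2 comp_apply)
    then show ?thesis using that stay by (auto simp: halts_after_def)
  qed
  show ?thesis using *[OF assms] *[OF assms(2,1)] by (cases "k \<le> l") auto
qed

section \<open>The lower bound for local cut algorithms\<close>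

text \<open>
  The nodes 0, 1 and 2 are hubs adjacent to each of the \<open>30 p\<close> leaves; the first \<open>p\<close> pairs of
  leaves are matched; the remaining nodes are isolated. This graph has no cut of conductance
  below 27/50 other than those by isolated nodes. In the hidden version of the graph one of the
  last \<open>p\<close> leaves is split off together with the isolated node \<open>b\<close>, the isolated node \<open>x\<close> takes
  over its place at the hubs, and one matched pair is unmatched so that the number of edges does
  not change. The degrees of the hubs are the same, and an algorithm that reads fewer than
  \<open>p\<close> cells misses the change.
\<close>

locale hidden =
  fixes n p :: nat
  assumes p: "1 \<le> p" and n: "31 * p + 5 \<le> n"
begin

definition N :: nat where "N = 30 * p"
definition matched :: "nat \<Rightarrow> nat set" where "matched i = {3 + 2 * i, 4 + 2 * i}"

definition hubs :: "nat set" where "hubs = {0, 1, 2}"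
definition leaves :: "nat set" where "leaves = {3..<N + 3}"
definition star :: "nat set \<Rightarrow> nat set set" where "star L = (\<lambda>(h, l). {h, l}) ` (hubs \<times> L)"

definition base :: "nat ugraph" where
  "base = ({..<n}, star leaves \<union> matched ` {..<p})"

definition hide :: "nat \<Rightarrow> nat \<Rightarrow> nat \<Rightarrow> nat \<Rightarrow> nat ugraph" where
  "hide i a b x = ({..<n}, star (insert x (leaves - {a})) \<union> matched ` ({..<p} - {i}) \<union> {{a, b}})"

lemma matched_leaves: "i < p \<Longrightarrow> matched i \<subseteq> leaves"
  using p by (auto simp: matched_def leaves_def N_def)

lemma star_edge: "{u, v} \<in> star L \<longleftrightarrow> u \<in> hubs \<and> v \<in> L \<or> v \<in> hubs \<and> u \<in> L"
  by (auto simp: star_def doubleton_eq_iff)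

lemma match_edge: "{u, v} \<in> matched ` I \<longleftrightarrow>
    (\<exists>i\<in>I. u = 3 + 2 * i \<and> v = 4 + 2 * i \<or> u = 4 + 2 * i \<and> v = 3 + 2 * i)"
  by (auto simp: matched_def doubleton_eq_iff image_iff)

lemma card_star: "L \<inter> hubs = {} \<Longrightarrow> e \<in> star L \<Longrightarrow> card e = 2"
  by (auto simp: star_def card_insert_if)

lemma card_matched: "card (matched i) = 2"
  by (simp add: matched_def)

lemma star_sub: "L \<subseteq> {..<n} \<Longrightarrow> e \<in> star L \<Longrightarrow> e \<subseteq> {..<n}"
  using n by (auto simp: star_def hubs_def)

lemma leaves_sub: "leaves \<subseteq> {..<n}" "leaves \<inter> hubs = {}"
  using n by (auto simp: leaves_def hubs_def N_def)

lemma simple_base: "simple_graph base"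
  using leaves_sub matched_leaves card_star[of leaves] star_sub[of leaves] card_matched
  unfolding simple_graph_def base_def by fastforce

lemma simple_hide:
  assumes "i < p" "a \<in> leaves" "b \<noteq> x" "N + 3 \<le> b" "b < n" "N + 3 \<le> x" "x < n"
  shows "simple_graph (hide i a b x)"
proof -
  let ?L = "insert x (leaves - {a})"
  have L: "?L \<subseteq> {..<n}" "?L \<inter> hubs = {}" using leaves_sub assms by (auto simp: hubs_def)
  have "a < n" "card {a, b} = 2" using assms leaves_sub by (auto simp: leaves_def)
  then show ?thesis
    using L matched_leaves leaves_sub card_star[of ?L] star_sub[of ?L] card_matched assms(5)
    unfolding simple_graph_def hide_def by fastforce
qed

definition bdeg :: "nat \<Rightarrow> nat" where
  "bdeg v = (if v < 3 then N else if v < 3 + 2 * p then 4 else if v < N + 3 then 3 else 0)"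

definition hdeg :: "nat \<Rightarrow> nat \<Rightarrow> nat \<Rightarrow> nat \<Rightarrow> nat \<Rightarrow> nat" where
  "hdeg i a b x v = (if v = 3 + 2 * i \<or> v = 4 + 2 * i then 3 else if v = a \<or> v = b then 1
     else if v = x then 3 else bdeg v)"

text \<open>A node \<open>v\<close> that is not a hub has room for four neighbours, the first three of which are the
  hubs by default.\<close>

definition adr :: "nat \<Rightarrow> nat \<Rightarrow> nat" where
  "adr B v = (if v < 3 then B + v * N else B + 3 * N + 4 * (v - 3))"

definition partner :: "nat \<Rightarrow> nat" where
  "partner v = (if even v then v - 1 else v + 1)"

definition layout :: "nat \<Rightarrow> (nat \<Rightarrow> nat) \<Rightarrow> nat list \<Rightarrow> (nat \<Rightarrow> nat) \<Rightarrow> (nat \<Rightarrow> nat) \<Rightarrow> nat \<Rightarrow> nat" where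
  "layout B dg as hub slot i =
     (if i < 2 * n then (if even i then dg (i div 2) else adr B (i div 2))
      else if i < B then as ! (i - 2 * n)
      else if i < B + 3 * N then hub ((i - B) mod N)
      else if i < B + 3 * N + 4 * (n - 3) then
        (let v = 3 + (i - (B + 3 * N)) div 4; s = (i - (B + 3 * N)) mod 4 in
          if s < 3 then (if s = 0 then slot v else s) else partner v)
      else 0)"

definition bmem :: "nat list \<Rightarrow> nat \<Rightarrow> nat" where
  "bmem as = layout (2 * n + length as) bdeg as (\<lambda>j. j + 3) (\<lambda>v. 0)"

definition hmem :: "nat list \<Rightarrow> nat \<Rightarrow> nat \<Rightarrow> nat \<Rightarrow> nat \<Rightarrow> nat \<Rightarrow> nat" where
  "hmem as i a b x = layout (2 * n + length as) (hdeg i a b x) as (\<lambda>j. if j + 3 = a then x else j + 3)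
     (\<lambda>v. if v = a then b else if v = b then a else 0)"

definition endm :: "nat list \<Rightarrow> nat" where
  "endm as = 2 * n + length as + 3 * N + 4 * (n - 3)"

lemma layout_deg: "v < n \<Longrightarrow> layout B dg as hub slot (2 * v) = dg v"
  by (simp add: layout_def)

lemma layout_adr: "v < n \<Longrightarrow> layout B dg as hub slot (2 * v + 1) = adr B v"
  by (simp add: layout_def)

lemma layout_list: "B = 2 * n + length as \<Longrightarrow> j < length as \<Longrightarrow> layout B dg as hub slot (2 * n + j) = as ! j"
  by (simp add: layout_def)

lemma N_pos: "0 < N" using p by (simp add: N_def)

lemma layout_hub:
  assumes "2 * n \<le> B" "h < 3" "j < N"
  shows "layout B dg as hub slot (adr B h + j) = hub j"
proof -
  have "h * N + j < 3 * N"
    using assms by (cases h; cases "h - 1") (auto simp: numeral_eq_Suc less_Suc_eq)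
  moreover have "(h * N + j) mod N = j" using assms(3) by simp
  ultimately show ?thesis using assms by (simp add: layout_def adr_def)
qed

lemma layout_slot:
  assumes "2 * n \<le> B" "3 \<le> v" "v < n" "s < 4"
  shows "layout B dg as hub slot (adr B v + s) = (if s < 3 then (if s = 0 then slot v else s) else partner v)"
proof -
  have "(4 * (v - 3) + s) div 4 = v - 3" "(4 * (v - 3) + s) mod 4 = s" using assms(4) by auto
  moreover have "4 * (v - 3) + s < 4 * (n - 3)" using assms by linarith
  ultimately show ?thesis using assms(1-3) by (simp add: layout_def adr_def Let_def)
qed

lemma layout_end: "endm as \<le> i \<Longrightarrow> layout (2 * n + length as) dg as hub slot i = 0"
  by (simp add: layout_def endm_def)

lemma stores_layout:
  assumes G: "verts G = {..<n}" "simple_graph G"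
    and hub: "\<And>h. h < 3 \<Longrightarrow> inj_on hub {..<N} \<and> hub ` {..<N} = neighbours G h"
    and leaf: "\<And>v. 3 \<le> v \<Longrightarrow> v < n \<Longrightarrow> \<exists>l\<le>4. l = dg v \<and>
       bij_betw (\<lambda>s. if s < 3 then (if s = 0 then slot v else s) else partner v) {..<l} (neighbours G v)"
    and dg: "\<And>h. h < 3 \<Longrightarrow> dg h = N"
  shows "stores (layout (2 * n + length as) dg as hub slot) (endm as) G as"
proof -
  let ?B = "2 * n + length as"
  let ?M = "layout ?B dg as hub slot"
  have bij: "bij_betw (\<lambda>i. ?M (adr ?B v + i)) {..<dg v} (neighbours G v)" if v: "v < n" for v
  proof (cases "v < 3")
    case True
    have "bij_betw hub {..<N} (neighbours G v)" using hub[OF True] by (simp add: bij_betw_def)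
    then show ?thesis
      by (subst bij_betw_cong[where g = hub]) (use True in \<open>auto simp: dg layout_hub\<close>)
  next
    case False
    then obtain l where l: "l \<le> 4" "l = dg v"
       "bij_betw (\<lambda>s. if s < 3 then (if s = 0 then slot v else s) else partner v) {..<l} (neighbours G v)"
      using leaf[of v] v by auto
    then show ?thesis
      by (subst bij_betw_cong[where g = "\<lambda>s. if s < 3 then (if s = 0 then slot v else s) else partner v"])
        (use False v in \<open>auto simp: layout_slot\<close>)
  qed
  have deg: "degree G v = dg v" if "v < n" for v
    using bij_betw_same_card[OF bij[OF that]] degree_neighbours[OF G(2)] by simp
  have dg4: "dg v \<le> 4" if "3 \<le> v" "v < n" for v using leaf[OF that] by auto
  have rng: "?B \<le> adr ?B v \<and> adr ?B v + dg v \<le> endm as" if v: "v < n" for v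
  proof (cases "v < 3")
    case True
    then have "v * N \<le> 2 * N" by (intro mult_le_mono1) simp
    moreover have "adr ?B v = ?B + v * N" using True by (simp add: adr_def)
    ultimately show ?thesis using dg[OF True] unfolding endm_def by (intro conjI) linarith+
  next
    case False
    then have "4 * (v - 3) + 4 \<le> 4 * (n - 3)" using v by linarith
    then show ?thesis using False dg4[of v] v by (simp add: adr_def endm_def)
  qed
  have dj: "disjoint_family_on (\<lambda>v. {adr ?B v..<adr ?B v + dg v}) {..<n}"
    unfolding disjoint_family_on_def
  proof (intro ballI impI)
    fix u v assume uv: "u \<in> {..<n}" "v \<in> {..<n}" "u \<noteq> v"
    have *: "adr ?B u + dg u \<le> adr ?B v" if "u < v" "v < n" for u v
    proof (cases "v < 3")
      case True
      then have "u * N + N \<le> v * N" using that by (metis Suc_leI add.commute mult_Suc mult_le_mono1)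
      then show ?thesis using True that dg[of u] by (simp add: adr_def)
    next
      case v: False
      show ?thesis
      proof (cases "u < 3")
        case True
        then have "u * N \<le> 2 * N" by (intro mult_le_mono1) simp
        moreover have "adr ?B u = ?B + u * N" "?B + 3 * N \<le> adr ?B v" using True v by (simp_all add: adr_def)
        ultimately show ?thesis using dg[OF True] by linarith
      next
        case False
        then have "4 * (u - 3) + 4 \<le> 4 * (v - 3)" using that by linarith
        then show ?thesis using False v dg4[of u] that by (simp add: adr_def)
      qed
    qed
    show "{adr ?B u..<adr ?B u + dg u} \<inter> {adr ?B v..<adr ?B v + dg v} = {}"
      using *[of u v] *[of v u] uv by (cases "u < v") auto
  qed
  then have "disjoint_family_on (\<lambda>v. {?M (2 * v + 1)..<?M (2 * v + 1) + degree G v}) {..<n}"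
    using layout_adr deg unfolding disjoint_family_on_def by simp
  then show ?thesis
    unfolding stores_def Let_def G(1) card_lessThan
    using bij rng deg layout_deg layout_adr[unfolded Suc_eq_plus1[symmetric]] layout_list layout_end layout_adr
    by (auto simp: endm_def)
qed

lemma match_edge': "{v, u} \<in> matched ` I \<longleftrightarrow> 3 \<le> v \<and> (v - 3) div 2 \<in> I \<and> u = partner v"
proof
  assume "{v, u} \<in> matched ` I"
  then obtain i where i: "i \<in> I" "v = 3 + 2 * i \<and> u = 4 + 2 * i \<or> v = 4 + 2 * i \<and> u = 3 + 2 * i"
    unfolding match_edge by blast
  have "(2 * i) div 2 = i" "(2 * i + 1) div 2 = i" by simp_all
  then show "3 \<le> v \<and> (v - 3) div 2 \<in> I \<and> u = partner v"
    using i by (elim disjE) (simp_all add: partner_def)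
next
  assume v: "3 \<le> v \<and> (v - 3) div 2 \<in> I \<and> u = partner v"
  let ?i = "(v - 3) div 2"
  have "v = 3 + 2 * ?i \<and> u = 4 + 2 * ?i \<or> v = 4 + 2 * ?i \<and> u = 3 + 2 * ?i"
  proof (cases "even v")
    case True
    then obtain j where "v = 2 * j" by blast
    then show ?thesis using v by (simp add: partner_def)
  next
    case False
    then obtain j where "v = 2 * j + 1" by (rule oddE)
    then show ?thesis using v by (simp add: partner_def)
  qed
  then show "{v, u} \<in> matched ` I" unfolding match_edge using v by blast
qed

lemma partner_ge: "3 \<le> v \<Longrightarrow> 3 \<le> partner v"
  by (cases "v = 3") (auto simp: partner_def)

lemma partner_hubs: "3 \<le> v \<Longrightarrow> partner v \<notin> hubs"
  using partner_ge[of v] by (auto simp: hubs_def)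

lemma neighbours_base: "neighbours base v = (if v < 3 then leaves else if v < 3 + 2 * p then insert (partner v) hubs
     else if v < N + 3 then hubs else {})"
  using p unfolding neighbours_def base_def leaves_def N_def
  by (auto simp: star_edge match_edge' hubs_def)

definition ok :: "nat \<Rightarrow> nat \<Rightarrow> nat \<Rightarrow> nat \<Rightarrow> bool" where
  "ok i a b x \<longleftrightarrow> i < p \<and> N + 3 - p \<le> a \<and> a < N + 3 \<and> b \<noteq> x \<and> N + 3 \<le> b \<and> b < n \<and> N + 3 \<le> x \<and> x < n"

lemma neighbours_hide:
  assumes "ok i a b x"
  shows "neighbours (hide i a b x) v = (if v < 3 then insert x (leaves - {a})
     else if v = 3 + 2 * i \<or> v = 4 + 2 * i then hubs else if v = a then {b} else if v = b then {a}
     else if v = x then hubs else neighbours base v)"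
proof -
  have "29 * p + 3 \<le> a" using assms by (simp add: ok_def N_def)
  moreover have "(v - 3) div 2 = i \<longleftrightarrow> v = 3 + 2 * i \<or> v = 4 + 2 * i" if "3 \<le> v" using that by presburger
  ultimately show ?thesis
    using p assms unfolding neighbours_base unfolding neighbours_def hide_def leaves_def N_def ok_def
    by (auto simp: star_edge match_edge' hubs_def doubleton_eq_iff)
qed

lemma bij_betw_none: "bij_betw f {} {}"
  by (simp add: bij_betw_def)

lemma slots:
  assumes "w \<notin> hubs"
  shows "bij_betw (\<lambda>s::nat. if s < 3 then (if s = 0 then 0 else s) else w) {..<3} hubs"
    and "bij_betw (\<lambda>s::nat. if s < 3 then (if s = 0 then 0 else s) else w) {..<4} (insert w hubs)"
proof -
  have [simp]: "{..<3::nat} = {0, 1, 2}" "{..<4::nat} = {0, 1, 2, 3}" by auto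
  show "bij_betw (\<lambda>s::nat. if s < 3 then (if s = 0 then 0 else s) else w) {..<3} hubs"
    "bij_betw (\<lambda>s::nat. if s < 3 then (if s = 0 then 0 else s) else w) {..<4} (insert w hubs)"
    using assms by (auto simp: bij_betw_def hubs_def)
qed

lemma stores_base: "stores (bmem as) (endm as) base as"
  unfolding bmem_def
proof (rule stores_layout[OF _ simple_base])
  show "inj_on (\<lambda>j. j + 3) {..<N} \<and> (\<lambda>j. j + 3) ` {..<N} = neighbours base h" if "h < 3" for h
    using that image_add_atLeastLessThan'[of 3 0 N] by (simp add: neighbours_base leaves_def lessThan_atLeast0)
  show "\<exists>l\<le>4. l = bdeg v \<and> bij_betw (\<lambda>s. if s < 3 then (if s = 0 then 0 else s) else partner v) {..<l} (neighbours base v)"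
    if "3 \<le> v" "v < n" for v
    using that slots[OF partner_hubs[OF that(1)]] by (auto simp: neighbours_base bdeg_def bij_betw_none)
qed (simp_all add: base_def bdeg_def)

lemma stores_hide:
  assumes "ok i a b x"
  shows "stores (hmem as i a b x) (endm as) (hide i a b x) as"
  unfolding hmem_def
proof (rule stores_layout)
  show "verts (hide i a b x) = {..<n}" by (simp add: hide_def)
  show "simple_graph (hide i a b x)" using assms by (intro simple_hide) (auto simp: ok_def leaves_def N_def)
  have a: "29 * p + 3 \<le> a" "a < N + 3" using assms by (simp_all add: ok_def N_def)
  show "inj_on (\<lambda>j. if j + 3 = a then x else j + 3) {..<N} \<and>
      (\<lambda>j. if j + 3 = a then x else j + 3) ` {..<N} = neighbours (hide i a b x) h" if "h < 3" for h
  proof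
    show "inj_on (\<lambda>j. if j + 3 = a then x else j + 3) {..<N}"
      using assms by (auto simp: inj_on_def ok_def)
    have "(\<lambda>j. if j + 3 = a then x else j + 3) ` {..<N} = insert x (leaves - {a})"
    proof (intro equalityI subsetI)
      fix u assume u: "u \<in> insert x (leaves - {a})"
      show "u \<in> (\<lambda>j. if j + 3 = a then x else j + 3) ` {..<N}"
      proof (cases "u = x")
        case True
        then show ?thesis using a by (intro image_eqI[of _ _ "a - 3"]) auto
      next
        case False
        then show ?thesis using u by (intro image_eqI[of _ _ "u - 3"]) (auto simp: leaves_def)
      qed
    qed (auto simp: leaves_def)
    then show "(\<lambda>j. if j + 3 = a then x else j + 3) ` {..<N} = neighbours (hide i a b x) h"
      using that by (simp add: neighbours_hide[OF assms])
  qed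
  show "\<exists>l\<le>4. l = hdeg i a b x v \<and>
      bij_betw (\<lambda>s. if s < 3 then (if s = 0 then (if v = a then b else if v = b then a else 0) else s) else partner v)
        {..<l} (neighbours (hide i a b x) v)" if "3 \<le> v" "v < n" for v
  proof (cases "v = a \<or> v = b")
    case True
    have "3 + 2 * p \<le> a" "a < b" "4 + 2 * i < 3 + 2 * p" using a assms by (auto simp: ok_def N_def)
    then show ?thesis using True that
      by (intro exI[of _ 1]) (auto simp: hdeg_def neighbours_hide[OF assms] lessThan_Suc bij_betw_def)
  next
    case False
    then show ?thesis
      using that slots[OF partner_hubs[OF that(1)]] assms bij_betw_none
      by (auto simp: neighbours_hide[OF assms] neighbours_base hdeg_def bdeg_def ok_def)
  qed
  show "hdeg i a b x h = N" if "h < 3" for h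
    using that assms a by (auto simp: hdeg_def bdeg_def ok_def)
qed

lemma degree_stores:
  assumes "stores M f G as" "v \<in> verts G"
  shows "degree G v = M (2 * v)"
  using assms by (auto simp: stores_def Let_def)

lemma degree_base: "v < n \<Longrightarrow> degree base v = bdeg v"
  using degree_stores[OF stores_base[of "[]"], of v] by (simp add: base_def bmem_def layout_deg)

lemma degree_hide: "ok i a b x \<Longrightarrow> v < n \<Longrightarrow> degree (hide i a b x) v = hdeg i a b x v"
  using degree_stores[OF stores_hide[of i a b x "[]"], of v] by (simp add: hide_def hmem_def layout_deg)

lemma verts_base: "verts base = {..<n}" by (simp add: base_def)
lemma verts_hide: "verts (hide i a b x) = {..<n}" by (simp add: hide_def)

lemma card_edges_hide:
  assumes ok: "ok i a b x"
  shows "card (edges (hide i a b x)) = card (edges base)"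
proof -
  let ?Z = "{3 + 2 * i, 4 + 2 * i, a, b, x}"
  have o: "3 + 2 * p \<le> a" "a < b" "a < x" "b \<noteq> x" "i < p" "N + 3 \<le> b" "N + 3 \<le> x" "a < N + 3" "4 + 2 * i < 3 + 2 * p" "3 + 2 * p < N + 3"
    using ok by (auto simp: ok_def N_def)
  have Zn: "?Z \<subseteq> {..<n}" using ok o n by (auto simp: ok_def N_def)
  have "sum (hdeg i a b x) ?Z = sum bdeg ?Z"
    using o by (simp add: hdeg_def bdeg_def)
  moreover have "sum (hdeg i a b x) ({..<n} - ?Z) = sum bdeg ({..<n} - ?Z)"
    by (rule sum.cong) (auto simp: hdeg_def)
  ultimately have "sum (hdeg i a b x) {..<n} = sum bdeg {..<n}"
    using sum.subset_diff[OF Zn, of "hdeg i a b x"] sum.subset_diff[OF Zn, of bdeg] by simp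
  moreover have "vol base (verts base) = sum bdeg {..<n}"
    unfolding vol_def verts_base by (rule sum.cong) (auto simp: degree_base)
  moreover have "vol (hide i a b x) (verts (hide i a b x)) = sum (hdeg i a b x) {..<n}"
    unfolding vol_def verts_hide using ok by (intro sum.cong) (auto simp: degree_hide)
  moreover have "simple_graph (hide i a b x)" using ok by (intro simple_hide) (auto simp: ok_def leaves_def N_def)
  ultimately show ?thesis using handshake[OF simple_base] handshake[of "hide i a b x"] by simp
qed

lemma sum_split:
  assumes "S \<subseteq> {..<n}"
  shows "sum g S = sum g (S \<inter> hubs) + sum g (S \<inter> leaves) + sum g (S \<inter> {N + 3..<n})"
proof -
  have f: "finite S" using assms finite_subset by blast
  have "S = (S \<inter> hubs) \<union> (S \<inter> leaves) \<union> (S \<inter> {N + 3..<n})" using assms by (auto simp: hubs_def leaves_def)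
  then have "sum g S = sum g ((S \<inter> hubs) \<union> (S \<inter> leaves) \<union> (S \<inter> {N + 3..<n}))" by simp
  also have "\<dots> = sum g (S \<inter> hubs) + sum g (S \<inter> leaves) + sum g (S \<inter> {N + 3..<n})"
    using f by (subst sum.union_disjoint, auto simp: hubs_def leaves_def)+
  finally show ?thesis .
qed

lemma sum_card: "finite A \<Longrightarrow> (\<Sum>v\<in>A. 3 + (if v \<in> B then 1 else 0)) = 3 * card A + card (A \<inter> B)"
  by (simp add: sum.distrib sum.If_cases)

lemma vol_base:
  assumes "S \<subseteq> {..<n}"
  shows "vol base S = card (S \<inter> hubs) * N + 3 * card (S \<inter> leaves) + card (S \<inter> {3..<3 + 2 * p})"
proof -
  have "vol base S = sum bdeg S" unfolding vol_def using assms by (intro sum.cong) (auto simp: degree_base)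
  also have "\<dots> = sum bdeg (S \<inter> hubs) + sum bdeg (S \<inter> leaves) + sum bdeg (S \<inter> {N + 3..<n})"
    by (rule sum_split[OF assms])
  also have "sum bdeg (S \<inter> hubs) = (\<Sum>v\<in>S \<inter> hubs. N)" by (rule sum.cong) (auto simp: hubs_def bdeg_def)
  also have "sum bdeg (S \<inter> leaves) = (\<Sum>v\<in>S \<inter> leaves. 3 + (if v \<in> {3..<3 + 2 * p} then 1 else 0))"
    by (rule sum.cong) (auto simp: leaves_def bdeg_def)
  also have "\<dots> = 3 * card (S \<inter> leaves) + card (S \<inter> leaves \<inter> {3..<3 + 2 * p})"
    by (rule sum_card) (simp add: leaves_def)
  also have "S \<inter> leaves \<inter> {3..<3 + 2 * p} = S \<inter> {3..<3 + 2 * p}" by (auto simp: leaves_def N_def)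
  also have "sum bdeg (S \<inter> {N + 3..<n}) = 0" using p by (intro sum.neutral) (auto simp: bdeg_def N_def)
  finally show ?thesis by simp
qed

lemma cut_base:
  assumes S: "S \<subseteq> {..<n}"
  shows "card (S \<inter> hubs) * (N - card (S \<inter> leaves)) + card (S \<inter> leaves) * (3 - card (S \<inter> hubs)) \<le> cut_size base S"
proof -
  let ?g = "\<lambda>u. card (neighbours base u \<inter> - S)"
  have f: "finite S" "finite leaves" "finite hubs" using S finite_subset by (auto simp: leaves_def hubs_def)
  have c: "card leaves = N" "card hubs = 3" by (simp_all add: leaves_def hubs_def)
  have "card (S \<inter> hubs) * (N - card (S \<inter> leaves)) = (\<Sum>u\<in>S \<inter> hubs. N - card (S \<inter> leaves))" by simp
  also have "\<dots> \<le> sum ?g (S \<inter> hubs)"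
  proof (rule sum_mono)
    fix u assume "u \<in> S \<inter> hubs"
    then have "neighbours base u = leaves" by (auto simp: neighbours_base hubs_def)
    then have "neighbours base u \<inter> - S = leaves - (S \<inter> leaves)" by auto
    then show "N - card (S \<inter> leaves) \<le> ?g u" using card_Diff_subset[of "S \<inter> leaves" leaves] f c by simp
  qed
  finally have 1: "card (S \<inter> hubs) * (N - card (S \<inter> leaves)) \<le> sum ?g (S \<inter> hubs)" .
  have "card (S \<inter> leaves) * (3 - card (S \<inter> hubs)) = (\<Sum>u\<in>S \<inter> leaves. 3 - card (S \<inter> hubs))" by simp
  also have "\<dots> \<le> sum ?g (S \<inter> leaves)"
  proof (rule sum_mono)
    fix u assume "u \<in> S \<inter> leaves"
    then have "hubs \<subseteq> neighbours base u" by (auto simp: neighbours_base leaves_def)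
    then have "hubs - (S \<inter> hubs) \<subseteq> neighbours base u \<inter> - S" by auto
    from card_mono[OF _ this] show "3 - card (S \<inter> hubs) \<le> ?g u"
      using card_Diff_subset[of "S \<inter> hubs" hubs] f c finite_neighbours[OF simple_base] by simp
  qed
  finally show ?thesis using 1 unfolding cut_size_crossing[OF simple_base f(1)] sum_split[OF S] by linarith
qed

lemma sparse_base:
  assumes sp: "sparse base \<alpha> S" and \<alpha>: "\<alpha> \<le> 27 / 50" and half: "vol base S \<le> vol base (verts base - S)"
  shows "S \<subseteq> {N + 3..<n}"
proof -
  have vb: "verts base = {..<n}" by (simp add: base_def)
  have S: "S \<subseteq> {..<n}" and c: "cut_conductance base S < 27 / 50" using sp \<alpha> vb by (auto simp: sparse_def is_cut_def)
  have f: "finite S" "finite leaves" "finite hubs" using S finite_subset by (auto simp: leaves_def hubs_def)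
  let ?j = "card (S \<inter> hubs)" and ?X = "card (S \<inter> leaves)" and ?Y = "card (S \<inter> {3..<3 + 2 * p})"
  have X: "?X \<le> N" using card_mono[OF f(2), of "S \<inter> leaves"] by (simp add: leaves_def)
  have j: "?j \<le> 3" using card_mono[OF f(3), of "S \<inter> hubs"] by (simp add: hubs_def)
  have Y: "?Y \<le> 2 * p" "?Y \<le> ?X"
  proof -
    show "?Y \<le> 2 * p" using card_mono[of "{3..<3 + 2 * p}" "S \<inter> {3..<3 + 2 * p}"] by simp
    show "?Y \<le> ?X" using f by (intro card_mono) (auto simp: leaves_def N_def)
  qed
  have v: "vol base S = ?j * N + 3 * ?X + ?Y" by (rule vol_base[OF S])
  have "vol base S + vol base (verts base - S) = vol base {..<n}"
    using vol_compl[of base S] S vb by simp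
  also have "\<dots> = 182 * p"
  proof -
    have "{..<n} \<inter> hubs = hubs" "{..<n} \<inter> leaves = leaves" "{..<n} \<inter> {3..<3 + 2 * p} = {3..<3 + 2 * p}"
      using n by (auto simp: hubs_def leaves_def N_def)
    then show ?thesis using vol_base[of "{..<n}"] by (simp add: leaves_def hubs_def N_def)
  qed
  finally have h: "?j * N + 3 * ?X + ?Y \<le> 91 * p" using half v by linarith
  have cut: "?j * (N - ?X) + ?X * (3 - ?j) \<le> cut_size base S" by (rule cut_base[OF S])
  have "S \<inter> hubs = {} \<and> S \<inter> leaves = {}"
  proof (rule ccontr)
    assume ne: "\<not> ?thesis"
    have pos: "0 < vol base S"
      using ne N_pos f unfolding v by (auto simp: card_gt_0_iff)
    have "real (cut_size base S) / real (vol base S) < 27 / 50"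
      using c half vb by (simp add: cut_conductance_def min_def)
    then have "50 * real (cut_size base S) < 27 * real (vol base S)" using pos by (simp add: pos_divide_less_eq)
    then have "50 * cut_size base S < 27 * vol base S" by linarith
    then have lt: "50 * (?j * (N - ?X) + ?X * (3 - ?j)) < 27 * (?j * N + 3 * ?X + ?Y)" 
      using le_less_trans[OF mult_le_mono2[OF cut, of 50]] v by simp
    consider "?j = 0" | "?j = 1" | "?j = 2" | "?j = 3" using j by linarith
    then show False
    proof cases
      case 1 then show ?thesis using lt Y by simp
    next
      case 2 then show ?thesis using lt Y X h unfolding N_def by simp
    next
      case 3 then show ?thesis using lt Y X h unfolding N_def by simp
    next
      case 4 then show ?thesis using lt Y X h unfolding N_def by simp
    qed
  qed
  then have "u \<notin> hubs" "u \<notin> leaves" if "u \<in> S" for u using that by auto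
  then show ?thesis using S by (fastforce simp: hubs_def leaves_def)
qed

lemma OPT_hide:
  assumes ok: "ok i a b x" and \<alpha>: "0 < \<alpha>'" and A: "\<alpha> \<le> 1 / 2 \<and> A = {N + 3..<n} \<or> \<alpha> \<le> 1 \<and> A = {N + 3 - p..<n}"
  shows "2 \<le> OPT (hide i a b x) \<alpha>' A \<alpha>"
proof -
  let ?G = "hide i a b x"
  have G: "simple_graph ?G" using ok by (intro simple_hide) (auto simp: ok_def leaves_def N_def)
  have V: "verts ?G = {..<n}" by (simp add: hide_def)
  have o: "3 + 2 * p \<le> a" "a < b" "N + 3 \<le> b" "b < n" "a < N + 3" "4 + 2 * i < 3 + 2 * p" "N + 3 - p \<le> a"
    using ok by (auto simp: ok_def N_def)
  have ab: "degree ?G a = 1" "degree ?G b = 1"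
    using o degree_hide[OF ok] by (auto simp: hdeg_def)
  have v: "vol ?G {a, b} = 2" using ab o by (simp add: vol_def)
  have nb: "neighbours ?G a = {b}" "neighbours ?G b = {a}" using o by (auto simp: neighbours_hide[OF ok])
  have c: "cut_size ?G {a, b} = 0" using cut_size_crossing[OF G, of "{a, b}"] nb by auto
  have "{0, 1} \<subseteq> verts ?G - {a, b}" using o V by auto
  then have "vol ?G {0, 1} \<le> vol ?G (verts ?G - {a, b})" using V by (intro vol_mono) auto
  moreover have "vol ?G {0, 1} \<ge> 2"
    using o degree_hide[OF ok, of 0] degree_hide[OF ok, of 1] ok p by (simp add: vol_def hdeg_def bdeg_def N_def ok_def)
  ultimately have half: "vol ?G {a, b} \<le> vol ?G (verts ?G - {a, b})" using v by simp
  have "a < n" "0 \<in> {..<n} - {a, b}" using o by auto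
  then have "is_cut ?G {a, b}" using o(4) unfolding is_cut_def V psubset_eq by blast
  then have sp: "sparse ?G \<alpha>' {a, b}" using c \<alpha> by (simp add: sparse_def cut_conductance_def)
  have "{a, b} \<inter> {N + 3..<n} = {b}" "{a, b} \<inter> {N + 3 - p..<n} = {a, b}" using o by auto
  then have "vol ?G ({a, b} \<inter> A) = 1 \<and> \<alpha> \<le> 1 / 2 \<or> vol ?G ({a, b} \<inter> A) = 2 \<and> \<alpha> \<le> 1"
    using A v ab(2) by (auto simp: vol_def[of _ "{b}"])
  then have "overlapping ?G A \<alpha> {a, b}" by (elim disjE) (simp_all add: overlapping_def v)
  moreover have "finite {vol ?G S |S. sparse ?G \<alpha>' S \<and> overlapping ?G A \<alpha> S \<and> vol ?G S \<le> vol ?G (verts ?G - S)}"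
    by (rule finite_subset[of _ "vol ?G ` Pow {..<n}"]) (auto simp: sparse_def is_cut_def V)
  ultimately show ?thesis unfolding OPT_def using v sp half by (intro Max_ge) (auto intro!: exI[of _ "{a, b}"])
qed

lemma isolated_not_sparse:
  assumes ok: "ok i a b x" and S: "S \<subseteq> {N + 3..<n}" and \<alpha>: "\<alpha> \<le> 1"
    and sp: "sparse (hide i a b x) \<alpha> S" "vol (hide i a b x) S \<le> vol (hide i a b x) (verts (hide i a b x) - S)"
  shows "vol (hide i a b x) S = 0"
proof (rule ccontr)
  let ?G = "hide i a b x"
  assume v: "vol ?G S \<noteq> 0"
  have G: "simple_graph ?G" using ok by (intro simple_hide) (auto simp: ok_def leaves_def N_def)
  have "cut_size ?G S = vol ?G S"
  proof (rule cut_size_independent[OF G])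
    show "finite S" using S finite_subset by blast
    fix u w assume uw: "u \<in> S" "w \<in> S"
    have "N + 3 \<le> u" using uw S by auto
    then have "neighbours ?G u \<subseteq> insert a hubs" and "a < N + 3" and "hubs \<subseteq> {..<N + 3}"
      using ok p by (auto simp: neighbours_hide[OF ok] neighbours_base ok_def hubs_def N_def)
    then have "neighbours ?G u \<inter> {N + 3..<n} = {}" by fastforce
    then show "{u, w} \<notin> edges ?G" using uw S by (auto simp: neighbours_def)
  qed
  then have "cut_conductance ?G S = 1" using v sp(2) by (simp add: cut_conductance_def min_def)
  then show False using sp(1) \<alpha> by (simp add: sparse_def)
qed

definition owner :: "nat \<Rightarrow> nat \<Rightarrow> nat" where
  "owner B c = (if c < 2 * n then c div 2 else if c < B + 3 * N then (c - B) mod N + 3 else 3 + (c - (B + 3 * N)) div 4)"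

lemma bmem_hmem:
  assumes ok: "ok i a b x" and ne: "bmem as c \<noteq> hmem as i a b x c"
  shows "bmem as c < N + 3 \<and> owner (2 * n + length as) c \<in> {3 + 2 * i, 4 + 2 * i, a, b, x}"
proof -
  have N: "30 \<le> N" using p by (simp add: N_def)
  have bd: "bdeg v < N + 3" for v using N by (simp add: bdeg_def)
  have md: "j mod N + 3 < N + 3" for j using N by simp
  let ?B = "2 * n + length as"
  consider "c < 2 * n" | "2 * n \<le> c" "c < ?B" | "?B \<le> c" "c < ?B + 3 * N"
    | "?B + 3 * N \<le> c" "c < ?B + 3 * N + 4 * (n - 3)" | "?B + 3 * N + 4 * (n - 3) \<le> c" by linarith
  then show ?thesis
  proof cases
    case 1
    then have "bdeg (c div 2) \<noteq> hdeg i a b x (c div 2)" "bmem as c = bdeg (c div 2)"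
      using ne unfolding bmem_def hmem_def layout_def by (cases "even c"; simp)+
    moreover from this have "c div 2 \<in> {3 + 2 * i, 4 + 2 * i, a, b, x}" unfolding hdeg_def by (metis insertCI)
    ultimately show ?thesis using 1 bd by (simp add: owner_def)
  next
    case 2
    then show ?thesis using ne by (simp add: bmem_def hmem_def layout_def)
  next
    case 3
    then have "(c - ?B) mod N + 3 = a" "bmem as c = (c - ?B) mod N + 3"
      using ne unfolding bmem_def hmem_def layout_def by (simp_all split: if_splits)
    then show ?thesis using 3 md[of "c - ?B"] by (simp add: owner_def)
  next
    case 4
    let ?v = "3 + (c - (?B + 3 * N)) div 4"
    have "?v = a \<or> ?v = b" "bmem as c = 0"
      using ne 4 unfolding bmem_def hmem_def layout_def Let_def by (simp_all split: if_splits)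
    then show ?thesis using 4 unfolding owner_def by auto
  next
    case 5
    then show ?thesis using ne by (simp add: bmem_def hmem_def layout_def)
  qed
qed

end

context hidden
begin

lemma lower_bound_run:
  assumes Q: "LBS_algorithm Q csz ccn t" and \<alpha>: "0 < \<alpha>" "\<alpha> \<le> 27 / 50"
    and as: "\<alpha> \<le> 1 / 2 \<and> as = [N + 3..<n] \<or> as = [N + 3 - p..<n]"
    and v: "real (vol base (set as)) \<le> v"
  shows "real p \<le> t n v \<alpha> \<alpha>"
proof (rule ccontr)
  assume less: "\<not> real p \<le> t n v \<alpha> \<alpha>"
  have ratio: "1 \<le> csz \<alpha>" "1 \<le> ccn \<alpha>" using Q \<alpha> unfolding LBS_algorithm_def by auto
  have N: "30 \<le> N" "N + 3 < n" using p n by (auto simp: N_def)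
  let ?G0 = base
  let ?B = "2 * n + length as"
  let ?init = "\<lambda>G. initial [card (verts G), card (edges G), length as, endm as] [\<alpha>, \<alpha>]"
  have run: "\<exists>k s. halts_after Q (?init G M) k s \<and> LBS_answer (csz \<alpha>) (ccn \<alpha>) G (set as) \<alpha> \<alpha> (answer s) \<and>
      (real (vol G (set as)) \<le> v \<longrightarrow> real k \<le> t n v \<alpha> \<alpha>)"
    if G: "simple_graph G" "verts G = {..<n}" "stores M (endm as) G as" for G M
  proof -
    have d: "distinct as" using as by auto
    have "0 \<in> {..<n} - set as" "set as \<subseteq> {..<n}" using as N p by (auto simp: N_def)
    then have "set as \<subset> verts G" using G(2) by blast
    then have hyp: "simple_graph G \<and> distinct as \<and> set as \<subset> verts G \<and> 0 \<le> \<alpha> \<and> \<alpha> \<le> 1 \<and> 0 \<le> \<alpha> \<and> \<alpha> \<le> 1 \<and> stores M (endm as) G as"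
      using d G(1,3) \<alpha> by simp
    note T = Q[unfolded LBS_algorithm_def, THEN conjunct2, THEN spec[of _ G], THEN spec[of _ as],
      THEN spec[of _ \<alpha>], THEN spec[of _ \<alpha>], THEN spec[of _ M], THEN spec[of _ "endm as"]]
    from mp[OF T hyp] obtain k s where r: "halts_after Q (?init G M) k s"
      "LBS_answer (csz \<alpha>) (ccn \<alpha>) G (set as) \<alpha> \<alpha> (answer s)"
      "\<forall>v. real (vol G (set as)) \<le> v \<longrightarrow> real k \<le> t (card (verts G)) v \<alpha> \<alpha>" by blast
    have "real (vol G (set as)) \<le> v \<longrightarrow> real k \<le> t n v \<alpha> \<alpha>" using r(3) G(2) by simp
    then show ?thesis using r(1,2) by blast
  qed
  obtain k s where k: "halts_after Q (?init base (bmem as)) k s"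
    "LBS_answer (csz \<alpha>) (ccn \<alpha>) base (set as) \<alpha> \<alpha> (answer s)" "real k \<le> t n v \<alpha> \<alpha>"
    using run[OF simple_base verts_base stores_base] v by blast
  have kp: "k < p" using less k(3) by linarith
  define R where "R = owner ?B ` (\<lambda>j. read_adr Q ((step Q ^^ j) (?init base (bmem as)))) ` {..<k}"
  have fR: "finite R" and cR: "card R < p"
  proof -
    show "finite R" by (simp add: R_def)
    have "card R \<le> k" unfolding R_def image_image using card_image_le[of "{..<k}"] by simp
    then show "card R < p" using kp by simp
  qed
  have avoid: "\<exists>z\<in>A. z \<notin> B" if "card B < card A" "finite B" for A B :: "nat set"
    using that card_mono[of B A] by fastforce
  have "card ((\<lambda>u. (u - 3) div 2) ` R) < card {..<p}"
    using card_image_le[OF fR, of "\<lambda>u. (u - 3) div 2"] cR by simp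
  then obtain i where i: "i < p" "i \<notin> (\<lambda>u. (u - 3) div 2) ` R" using avoid fR by blast
  have iR: "3 + 2 * i \<notin> R" "4 + 2 * i \<notin> R"
  proof -
    have "(3 + 2 * i - 3) div 2 = i" "(4 + 2 * i - 3) div 2 = i" by simp_all
    then show "3 + 2 * i \<notin> R" "4 + 2 * i \<notin> R" using i(2) by (metis imageI)+
  qed
  have "card R < card {N + 3 - p..<N + 3}" using cR by (simp add: N_def)
  then obtain a where a: "a \<in> {N + 3 - p..<N + 3}" "a \<notin> R" using avoid fR by blast
  have "card R < card {N + 3..<n}" using cR n by (simp add: N_def)
  then obtain b where b: "b \<in> {N + 3..<n}" "b \<notin> R" using avoid fR by blast
  have "card (insert b R) \<le> p" using cR fR by (simp add: card_insert_if)
  moreover have "p < card {N + 3..<n}" using n unfolding N_def card_atLeastLessThan by linarith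
  ultimately have "card (insert b R) < card {N + 3..<n}" by linarith
  then obtain x where x: "x \<in> {N + 3..<n}" "x \<notin> insert b R" using avoid[of "insert b R"] fR by blast
  have ok: "ok i a b x" using i a b x by (auto simp: ok_def)
  let ?H = "hide i a b x"
  have H: "simple_graph ?H" using ok by (intro simple_hide) (auto simp: ok_def leaves_def N_def)
  let ?Z = "{c. bmem as c \<noteq> hmem as i a b x c}"
  have "sim ?Z (bmem as) (hmem as i a b x) (?init base (bmem as)) (?init ?H (hmem as i a b x))"
    using card_edges_hide[OF ok] by (auto simp: sim_def initial_def verts_base verts_hide)
  moreover have "read_adr Q ((step Q ^^ j) (?init base (bmem as))) \<notin> ?Z" if "j < k" for j
  proof
    assume "read_adr Q ((step Q ^^ j) (?init base (bmem as))) \<in> ?Z"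
    then have "owner ?B (read_adr Q ((step Q ^^ j) (?init base (bmem as)))) \<in> {3 + 2 * i, 4 + 2 * i, a, b, x}"
      using bmem_hmem[OF ok] by blast
    moreover have "owner ?B (read_adr Q ((step Q ^^ j) (?init base (bmem as)))) \<in> R"
      using that unfolding R_def by blast
    ultimately show False using iR a b x by auto
  qed
  ultimately have sim: "sim ?Z (bmem as) (hmem as i a b x) s ((step Q ^^ k) (?init ?H (hmem as i a b x)))"
    using k(1) sim_run[of ?Z "bmem as" "hmem as i a b x"] unfolding halts_after_def by blast
  define s' where "s' = (step Q ^^ k) (?init ?H (hmem as i a b x))"
  have "halts_after Q (?init ?H (hmem as i a b x)) k s'"
    using k(1) sim unfolding s'_def halts_after_def sim_def by simp
  then have ans: "LBS_answer (csz \<alpha>) (ccn \<alpha>) ?H (set as) \<alpha> \<alpha> (answer s')"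
    using run[OF H verts_hide stores_hide[OF ok]] halts_after_unique by metis
  have "\<alpha> \<le> 1" using \<alpha> by simp
  then have O: "2 \<le> OPT ?H (\<alpha> / ccn \<alpha>) (set as) \<alpha>"
    using as \<alpha> ratio by (intro OPT_hide[OF ok]) auto
  show False
  proof (cases "answer s")
    case None
    then have "answer s' = None" using sim unfolding s'_def[symmetric] by (auto simp: answer_def sim_def split: if_splits)
    then show False using ans O by simp
  next
    case (Some S)
    then have S: "S = (\<lambda>j. imem s (ireg s 1 + j)) ` {..<ireg s 2}" "ireg s 0 \<noteq> 0"
      by (auto simp: answer_def split: if_splits)
    have sp: "S \<subseteq> {N + 3..<n}" using k(2) sparse_base[of \<alpha> S] \<alpha> Some by simp
    have im: "imem s' c = imem s c" if "c \<in> (\<lambda>j. ireg s 1 + j) ` {..<ireg s 2}" for c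
    proof -
      have "imem s c \<in> S" using that unfolding S(1) by auto
      then have "\<not> imem s c < N + 3" using sp by auto
      then show ?thesis using sim bmem_hmem[OF ok] unfolding s'_def[symmetric] sim_def by (metis mem_Collect_eq)
    qed
    have "answer s' = Some ((\<lambda>j. imem s' (ireg s 1 + j)) ` {..<ireg s 2})"
      using sim S(2) unfolding s'_def[symmetric] by (simp add: answer_def sim_def)
    also have "(\<lambda>j. imem s' (ireg s 1 + j)) ` {..<ireg s 2} = S"
      unfolding S(1) using im by (intro image_cong) auto
    finally have "answer s' = Some S" .
    then have "sparse ?H \<alpha> S" "vol ?H S \<le> vol ?H (verts ?H - S)" "csz \<alpha> * real (vol ?H S) \<ge> real (OPT ?H (\<alpha> / ccn \<alpha>) (set as) \<alpha>)"
      using ans by auto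
    then show False using isolated_not_sparse[OF ok sp \<open>\<alpha> \<le> 1\<close>] O by simp
  qed
qed

lemma lower_bound:
  assumes Q: "LBS_algorithm Q csz ccn t" and \<alpha>: "0 < \<alpha>" "\<alpha> \<le> 27 / 50"
    and v: "0 \<le> v" "\<alpha> \<le> 1 / 2 \<or> real (3 * p) \<le> v"
  shows "real p \<le> t n v \<alpha> \<alpha>"
proof (cases "\<alpha> \<le> 1 / 2")
  case True
  have e: "{N + 3..<n} \<inter> hubs = {}" "{N + 3..<n} \<inter> leaves = {}" "{N + 3..<n} \<inter> {3..<3 + 2 * p} = {}"
    by (auto simp: leaves_def hubs_def N_def)
  have "vol base {N + 3..<n} = 0" using vol_base[of "{N + 3..<n}"] e by fastforce
  then show ?thesis using True v by (intro lower_bound_run[OF Q \<alpha>, of "[N + 3..<n]"]) auto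
next
  case False
  have e: "{N + 3 - p..<n} \<inter> hubs = {}" "{N + 3 - p..<n} \<inter> leaves = {N + 3 - p..<N + 3}" "{N + 3 - p..<n} \<inter> {3..<3 + 2 * p} = {}"
    using p n by (auto simp: leaves_def hubs_def N_def)
  have "{N + 3 - p..<n} \<subseteq> {..<n}" "N + 3 - (N + 3 - p) = p" using p by (auto simp: N_def)
  then have "vol base {N + 3 - p..<n} = 3 * p" by (simp only: vol_base e) simp
  then show ?thesis using False v by (intro lower_bound_run[OF Q \<alpha>, of "[N + 3 - p..<n]"]) auto
qed

end

section \<open>The pruning program on graphs\<close>

lemma length_flatten: "length (flatten ds) = 2 * length ds"
  by (induction ds) (auto simp: flatten_def)

lemma count_flatten:
  "\<forall>(u, w)\<in>set ds. u \<noteq> w \<Longrightarrow>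
     count_list (flatten ds) v = length (filter (\<lambda>e. v \<in> e) (map (\<lambda>(u, w). {u, w}) ds))"
proof (induction ds)
  case (Cons d ds)
  obtain u w where d: "d = (u, w)" by fastforce
  have "flatten (d # ds) = u # w # flatten ds" by (simp add: d flatten_def)
  then show ?case using Cons d by (cases "u = v"; cases "w = v") (auto simp: comp_def)
qed (simp add: flatten_def)

lemma set_flatten: "set (flatten ds) = \<Union> ((\<lambda>(u, w). {u, w}) ` set ds)"
  by (auto simp: flatten_def)

context update
begin

lemma flatten_edges:
  assumes "lists_edges ds D"
  shows "length (flatten ds) = 2 * card D" "set (flatten ds) \<subseteq> {..<n}" "count_list (flatten ds) = dd"
proof -
  let ?ed = "\<lambda>(u, w). {u, w}"
  have ds: "set (map ?ed ds) = D" "length ds = card D" using assms by (auto simp: lists_edges_def)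
  show "length (flatten ds) = 2 * card D" using ds(2) by (simp add: length_flatten)
  show "set (flatten ds) \<subseteq> {..<n}" using ds(1) D_sub unfolding set_flatten by auto
  have "distinct (map ?ed ds)" using ds by (intro card_distinct) simp
  moreover have "\<forall>(u, w)\<in>set ds. u \<noteq> w"
  proof safe
    fix u assume "(u, u) \<in> set ds"
    then have "{u, u} \<in> D" using ds(1) by force
    then show False using D_card by fastforce
  qed
  ultimately have "count_list (flatten ds) v = dd v" for v
    unfolding count_flatten dd_def using ds(1) distinct_length_filter[of "map ?ed ds" "\<lambda>e. v \<in> e"]
    by (simp add: count_flatten Int_def conj_commute)
  then show "count_list (flatten ds) = dd" by auto
qed

lemma dd_le: "dd v \<le> card D"
  unfolding dd_def using fin_D by (intro card_mono) auto

lemma wp_Prune_graph: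
  assumes M: "stores M f G (flatten ds)" and ds: "lists_edges ds D" "D \<noteq> {}"
    and s: "ir s 0 = n" "ir s 3 = f" "ir s 2 = card D" "ir s 30 = 0" "im s = M" "rm s = (\<lambda>_. 0)"
      "rr s 0 = \<phi>" "0 < \<phi>" "tm s = 0" "50 * \<phi> \<le> 27"
  shows "wp Prune (\<lambda>s'. \<exists>k L P. 0 < k \<and> 2 \<le> real k * \<phi> \<and> real (k - 1) * \<phi> < 2 \<and>
     pruned n E (degree G) dd k P \<and>
     ir s' 0 = 1 \<and> (\<lambda>i. im s' (ir s' 1 + i)) ` {..<ir s' 2} = P \<and>
     (L = 0 \<or> 2 ^ (L - 1) \<le> 4 * k * card D) \<and> tm s' \<le> 120000 * (k * k * card D * (L + 1))) s"
proof -
  note fl = flatten_edges[OF ds(1)]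
  have c: "card (verts G) = n" using V by simp
  have st: "2 * n + length (flatten ds) \<le> f" "\<And>i. i < length (flatten ds) \<Longrightarrow> M (2 * n + i) = flatten ds ! i"
    "\<And>v. v < n \<Longrightarrow> M (2 * v) = degree G v" "\<And>v. v < n \<Longrightarrow> M (2 * v + 1) + degree G v \<le> f"
    "\<And>v. v < n \<Longrightarrow> bij_betw (\<lambda>i. M (M (2 * v + 1) + i)) {..<degree G v} (neighbours G v)"
    "\<And>i. f \<le> i \<Longrightarrow> M i = 0"
    using M unfolding stores_def Let_def c by blast+
  have "0 < card D" using ds(2) fin_D by (simp add: card_gt_0_iff)
  then have ne: "flatten ds \<noteq> []" using fl(1) by auto
  have E: "\<And>u v. E u v \<Longrightarrow> E v u" "\<And>u v. E u v \<Longrightarrow> u < n \<and> v < n"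
    using edge_vert[OF G] V by (auto simp: insert_commute)
  have E': "\<not> E u u" for u using edge_ne[OF G, of u u] by blast
  note W = wp_Prune[of E n "\<lambda>v i. M (M (2 * v + 1) + i)" "degree G" M f "flatten ds" s, OF E(1) E' E(2)]
  have eq: "2 * k * (2 * card D) = 4 * k * card D" "60000 * (k * k * (2 * card D) * (L + 1)) = 120000 * (k * k * card D * (L + 1))"
    for k L by (simp_all add: algebra_simps)
  show ?thesis
    by (rule W[unfolded fl s(7) eq]) (use st[unfolded fl(1)] fl(2) ne s in \<open>simp_all add: neighbours_def\<close>)
qed

end

lemma wp_Prune_trivial:
  assumes "tm s = 0" "ir s 30 = 0" "ir s 2 = 0 \<or> 27 < 50 * rr s 0"
  shows "wp Prune (\<lambda>s'. ir s' 0 = 1 \<and> ir s' 2 = 0 \<and> tm s' \<le> 20) s"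
  using assms by (auto simp: Prune_def wp_Cond wp_Seq wp_Do)

lemma log_bound:
  fixes x :: real
  assumes "1 \<le> x" "L = 0 \<or> 2 ^ (L - 1) \<le> 16 * x"
  shows "real (L + 1) \<le> 6 * (1 + ln x)"
proof (cases "L = 0")
  case True
  then show ?thesis using assms by simp
next
  case False
  have l2: "1 / 2 \<le> ln (2 :: real)" using ln_le_minus_one[of "1 / 2 :: real"] by (simp add: ln_div)
  have "ln ((2 :: real) ^ (L - 1)) \<le> ln (2 ^ 4 * x)" using assms False by (subst ln_le_cancel_iff) auto
  also have "ln (2 ^ 4 * x) = ln (2 ^ 4) + ln x" using assms(1) by (intro ln_mult_pos) auto
  also have "ln ((2 :: real) ^ 4) = real 4 * ln 2" by (rule ln_realpow)
  also have "ln ((2 :: real) ^ (L - 1)) = real (L - 1) * ln 2" by (rule ln_realpow)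
  finally have "real (L - 1) * ln 2 \<le> 4 * ln 2 + ln x" by simp
  then have "(real (L - 1) - 4) * ln 2 \<le> ln x" by (simp add: algebra_simps)
  moreover have "(real (L - 1) - 4) * (1 / 2) \<le> (real (L - 1) - 4) * ln 2" if "4 \<le> L - 1"
    using l2 that by (intro mult_left_mono) auto
  moreover have "0 \<le> ln x" using assms(1) by simp
  ultimately have "real (L - 1) \<le> 4 + 2 * ln x" by (cases "4 \<le> L - 1") (auto simp: algebra_simps)
  moreover have "real (L + 1) = real (L - 1) + 2" using False by simp
  ultimately show ?thesis using \<open>0 \<le> ln x\<close> by argo
qed

lemma powr_bound:
  fixes x :: real
  assumes "1 \<le> x" "0 < \<epsilon>" "\<epsilon> < 1" "1 \<le> c"
  shows "1 + ln x \<le> x powr \<epsilon> * (c / \<epsilon>)"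
proof -
  have "1 + ln x \<le> 1 / \<epsilon> + ln x" using assms by simp
  also have "\<dots> = (1 + \<epsilon> * ln x) / \<epsilon>" using assms by (simp add: field_simps)
  also have "\<dots> \<le> x powr \<epsilon> / \<epsilon>" using assms exp_ge_add_one_self[of "\<epsilon> * ln x"]
    by (intro divide_right_mono) (auto simp: powr_def)
  also have "\<dots> \<le> x powr \<epsilon> * (c / \<epsilon>)"
    using mult_left_mono[of 1 c "x powr \<epsilon> / \<epsilon>"] assms by simp
  finally show ?thesis .
qed

lemma induced_verts: "simple_graph G \<Longrightarrow> induced G (verts G) = G"
  by (rule prod_eqI) (auto simp: induced_def simple_graph_def)

lemma answer_empty: "ireg s 0 = 1 \<Longrightarrow> ireg s 2 = 0 \<Longrightarrow> answer s = Some {}"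
  by (simp add: answer_def)

lemma degree_le_max: "simple_graph G \<Longrightarrow> v \<in> verts G \<Longrightarrow> degree G v \<le> max_degree G"
  unfolding max_degree_def by (rule Max_ge) (auto simp: sg_fin)

lemma running_time:
  assumes Q: "LBS_algorithm Q csz ccn t" and \<alpha>: "0 < \<alpha>" "\<alpha> \<le> 27 / 50" and \<epsilon>: "0 < \<epsilon>" "\<epsilon> < 1" and c: "1 \<le> c"
    and d: "1 \<le> d" "2 * 10 ^ 8 * real d \<le> \<alpha>\<^sup>2 * real n" "1 \<le> \<Delta>"
    and k: "0 < k" "real (k - 1) * \<alpha> < 2" "L = 0 \<or> 2 ^ (L - 1) \<le> 4 * k * d"
  shows "real (120000 * (k * k * d * (L + 1))) \<le> 10 ^ 9 * max 1 ((real d / \<alpha>) powr \<epsilon> * (c / \<epsilon>) * t n (\<Delta> * real d / \<alpha>) \<alpha> \<alpha>)"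
proof -
  let ?x = "real d / \<alpha>" and ?T = "t n (\<Delta> * real d / \<alpha>) \<alpha> \<alpha>"
  let ?F = "?x powr \<epsilon> * (c / \<epsilon>)" and ?y = "real d / \<alpha>\<^sup>2"
  have d1: "1 \<le> real d" using d(1) by simp
  have x: "real d \<le> ?x" using \<alpha> mult_left_mono[of \<alpha> 1 "real d"] by (simp add: pos_le_divide_eq)
  have \<alpha>2: "0 < \<alpha>\<^sup>2" "\<alpha>\<^sup>2 \<le> 1" using \<alpha> power_le_one[of \<alpha> 2] by auto
  have F: "1 + ln ?x \<le> ?F" using x d1 \<epsilon> c by (intro powr_bound) auto
  have lx: "0 \<le> ln ?x" using x d1 by simp
  have n: "2 * 10 ^ 8 * ?y \<le> real n" using d(2) \<alpha>2 by (simp add: pos_divide_le_eq mult.commute)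
  then have n': "200000000 * ?y \<le> real n" by simp
  have y: "real d \<le> ?y" using \<alpha>2 mult_left_mono[of "\<alpha>\<^sup>2" 1 "real d"] by (simp add: pos_le_divide_eq)
  have nd: "200000000 * d \<le> n" using n' y by linarith
  have k\<alpha>: "real k * \<alpha> \<le> 3"
  proof -
    have "real k = real (k - 1) + 1" using k(1) by simp
    then show ?thesis using k(2) \<alpha> by (simp only: distrib_right)
  qed
  then have kx: "real k \<le> 3 / \<alpha>" using \<alpha> by (simp add: pos_le_divide_eq)
  have L: "real (L + 1) \<le> 6 * (1 + ln ?x)"
  proof (rule log_bound)
    show "1 \<le> ?x" using x d1 by simp
    have "L = 0 \<or> (2::real) ^ (L - 1) \<le> 4 * real k * real d"
      using k(3) of_nat_mono[of "2 ^ (L - 1)" "4 * k * d", where 'a = real] by auto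
    moreover have "4 * real k * real d \<le> 4 * (3 / \<alpha>) * real d" using kx by (intro mult_right_mono) auto
    moreover have "4 * (3 / \<alpha>) * real d \<le> 16 * ?x" using \<alpha> by (simp add: divide_right_mono)
    ultimately show "L = 0 \<or> (2::real) ^ (L - 1) \<le> 16 * ?x" by linarith
  qed
  have "real (k * k * d) \<le> (3 / \<alpha>) * (3 / \<alpha>) * real d"
    using kx \<alpha> unfolding of_nat_mult by (intro mult_mono) auto
  also have "\<dots> = 9 * ?y" using \<alpha> by (simp add: power2_eq_square)
  finally have "real (k * k * d) * real (L + 1) \<le> (9 * ?y) * (6 * (1 + ln ?x))"
    using L y lx by (intro mult_mono) auto
  then have st: "real (120000 * (k * k * d * (L + 1))) \<le> 6480000 * (?y * (1 + ln ?x))"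
    unfolding of_nat_mult by (simp only: of_nat_numeral)
  have v: "0 \<le> \<Delta> * real d / \<alpha>" using d \<alpha> by auto
  let ?W = "max 1 (?F * ?T)"
  have W: "1 \<le> ?W" "?F * ?T \<le> ?W" by simp_all
  have fin: ?thesis if "?y * (1 + ln ?x) \<le> 32 * ?W"
  proof -
    have "6480000 * (?y * (1 + ln ?x)) \<le> 6480000 * (32 * ?W)" using that by (rule mult_left_mono) simp
    also have "\<dots> \<le> 10 ^ 9 * ?W" unfolding mult.assoc[symmetric] using W(1) by (intro mult_right_mono) auto
    finally show ?thesis using st by (rule order.trans[rotated])
  qed
  show ?thesis
  proof (cases "1 / 2 < \<alpha> \<and> d \<le> 2")
    case True
    have "?x \<le> 4" using True \<alpha> by (simp add: pos_divide_le_eq)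
    then have "ln ?x \<le> 3" using ln_le_minus_one[of ?x] x d1 by linarith
    moreover have "(1 / 2)\<^sup>2 \<le> \<alpha>\<^sup>2" using True by (intro power_mono) auto
    then have "?y \<le> 8" using \<alpha>2 True by (simp add: pos_divide_le_eq power2_eq_square)
    ultimately have "?y * (1 + ln ?x) \<le> 8 * 4" using lx y by (intro mult_mono) auto
    also have "\<dots> \<le> 32 * ?W" using W(1) by simp
    finally show ?thesis by (rule fin)
  next
    case False
    have T: "?y \<le> 20 * ?T"
    proof (cases "\<alpha> \<le> 1 / 2")
      case True
      have p: "1 \<le> n div 40" using nd d(1) by linarith
      then interpret hidden n "n div 40" by unfold_locales (use nd d(1) in linarith)+
      have "real (n div 40) \<le> ?T" using lower_bound[OF Q \<alpha> v] True by simp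
      moreover have "real n \<le> 40 * real (n div 40) + 40" by linarith
      ultimately show ?thesis using n' y d1 by linarith
    next
      case big: False
      then have d3: "3 \<le> d" using False by simp
      interpret hidden n "d div 3" using d3 nd by unfold_locales linarith+
      have "real d \<le> \<Delta> * real d" using d(3) d1 mult_right_mono[of 1 \<Delta> "real d"] by simp
      also have "\<dots> \<le> \<Delta> * real d / \<alpha>"
        using \<alpha> d(3) d1 mult_left_mono[of \<alpha> 1 "\<Delta> * real d"] by (simp add: pos_le_divide_eq)
      finally have "real (3 * (d div 3)) \<le> \<Delta> * real d / \<alpha>" by linarith
      then have T: "real (d div 3) \<le> ?T" using lower_bound[OF Q \<alpha> v] by simp
      have "(1 / 2)\<^sup>2 \<le> \<alpha>\<^sup>2" using big by (intro power_mono) auto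
      then have "?y \<le> 4 * real d" using \<alpha>2 d1 mult_left_mono[of "1 / 4" "\<alpha>\<^sup>2" "4 * real d"]
        by (simp add: pos_divide_le_eq power2_eq_square)
      moreover have "d \<le> 5 * (d div 3)" using d3 by presburger
      then have "real d \<le> 5 * real (d div 3)" by linarith
      ultimately show ?thesis using T by linarith
    qed
    then have T0: "0 \<le> ?T" using y d1 by linarith
    have "?y * (1 + ln ?x) \<le> (20 * ?T) * ?F" using T F lx y T0 by (intro mult_mono) auto
    also have "\<dots> = 20 * (?F * ?T)" by (simp only: mult_ac)
    also have "\<dots> \<le> 20 * ?W" by (rule mult_left_mono[OF W(2)]) simp
    also have "\<dots> \<le> 32 * ?W" using W(1) by (intro mult_right_mono) auto
    finally show ?thesis by (rule fin)
  qed
qed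

lemma pruning_algorithm:
  assumes Q: "LBS_algorithm Q csz ccn t"
    and sg: "simple_graph G" "verts G \<noteq> {}" and n: "n = card (verts G)" and m: "m = card (edges G)"
    and \<Delta>: "\<Delta> = max_degree G" and \<phi>: "0 < \<phi>" "\<phi> \<le> 1" and \<epsilon>: "0 < \<epsilon>" "\<epsilon> < 1"
    and D: "simple_graph (add_edges G D)" "D \<inter> edges G = {}"
      "real (card D) \<le> 1 / 10 ^ 8 * (\<phi>\<^sup>2 * real m / real \<Delta>)"
    and ds: "lists_edges ds D" and M: "stores M f G (flatten ds)"
  shows "\<exists>k s. halts_after (compile 0 Prune) (initial [n, m, card D, f, \<Delta>] [\<phi>, \<epsilon>, csz (\<phi> / 2), ccn (\<phi> / 2)] M) k s \<and>
    real k \<le> 10 ^ 9 * max 1 ((real (card D) / \<phi>) powr \<epsilon> * (csz (\<phi> / 2) / \<epsilon>) * t n (real \<Delta> * real (card D) / \<phi>) \<phi> \<phi>) \<and>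
    pruning_answer G D \<phi> (\<phi> / (5 * ccn (\<phi> / 2) powr (1 / \<epsilon> - 1))) (answer s)"
    (is "\<exists>k s. halts_after _ ?init k s \<and> real k \<le> ?B \<and> pruning_answer G D \<phi> ?r (answer s)")
proof -
  define s0 where "s0 = \<lparr>tm = 0, ir = ireg ?init, rr = rreg ?init, im = M, rm = \<lambda>_. 0\<rparr>"
  have init: "conf 0 s0 = ?init" by (simp add: conf_def initial_def s0_def)
  have s0: "ir s0 0 = n" "ir s0 3 = f" "ir s0 2 = card D" "ir s0 30 = 0" "im s0 = M" "rm s0 = (\<lambda>_. 0)"
    "rr s0 0 = \<phi>" "tm s0 = 0"
    by (simp_all add: s0_def initial_def)
  have halt: ?thesis if "wp Prune R s0"
    "\<And>s' :: mst. R s' \<Longrightarrow> real (tm s') \<le> ?B \<and> pruning_answer G D \<phi> ?r (answer (conf (clen Prune) s'))" for R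
    using wp_halts[OF that(1) s0(8)] that(2) unfolding init by blast
  have V: "verts G = {..<n}" using M n by (simp add: stores_def Let_def)
  interpret update G D n by unfold_locales (rule sg(1) D(1,2) V)+
  have ratio: "1 \<le> csz (\<phi> / 2)" "1 \<le> ccn (\<phi> / 2)" using Q \<phi> unfolding LBS_algorithm_def by auto
  have "1 \<le> ccn (\<phi> / 2) powr (1 / \<epsilon> - 1)" using ratio(2) \<epsilon> by (intro ge_one_powr_ge_zero) auto
  then have r: "?r \<le> \<phi> / 5" using \<phi> by (intro divide_left_mono) auto
  then have r1: "?r \<le> \<phi>" using \<phi> by linarith
  have dense: "14 * real (card D) \<le> \<phi> * real m \<and> 1 \<le> real \<Delta> \<and> 2 * 10 ^ 8 * real (card D) \<le> \<phi>\<^sup>2 * real n \<and>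
      conductance Gb < ereal (27 / 50)" if "D \<noteq> {}"
  proof -
    have d1: "1 \<le> real (card D)" using that fin_D by (simp add: Suc_le_eq card_gt_0_iff)
    have \<Delta>1: "1 \<le> real \<Delta>" using d1 D(3) by (cases "\<Delta> = 0") auto
    have a: "10 ^ 8 * (real (card D) * real \<Delta>) \<le> \<phi>\<^sup>2 * real m"
      using D(3) \<Delta>1 by (simp add: pos_le_divide_eq algebra_simps)
    have "\<phi>\<^sup>2 * real m \<le> \<phi> * real m" using \<phi> by (intro mult_right_mono) (auto simp: power2_eq_square mult_left_le)
    then have b: "10 ^ 8 * (real (card D) * real \<Delta>) \<le> \<phi> * real m" using a by linarith
    have "\<phi> * real m \<le> 1 * real m" using \<phi> by (intro mult_right_mono) auto
    then have c: "10 ^ 8 * (real (card D) * real \<Delta>) \<le> real m" using b by linarith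
    then have c': "100000000 * (real (card D) * real \<Delta>) \<le> real m" by simp
    have dD: "real (card D) \<le> real (card D) * real \<Delta>" "real \<Delta> \<le> real (card D) * real \<Delta>"
      using d1 \<Delta>1 mult_left_mono[OF \<Delta>1, of "real (card D)"] mult_right_mono[OF d1, of "real \<Delta>"] by auto
    have "2 * m = vol G (verts G)" using handshake[OF sg(1)] m by simp
    also have "\<dots> \<le> (\<Sum>v\<in>verts G. \<Delta>)" unfolding vol_def \<Delta> by (intro sum_mono degree_le_max sg(1))
    also have "\<dots> = n * \<Delta>" using n by simp
    finally have "2 * real m \<le> real n * real \<Delta>" by (metis of_nat_le_iff of_nat_mult of_nat_numeral)
    then have "\<phi>\<^sup>2 * (2 * real m) \<le> \<phi>\<^sup>2 * (real n * real \<Delta>)" by (intro mult_left_mono) auto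
    then have "(2 * 10 ^ 8 * real (card D)) * real \<Delta> \<le> (\<phi>\<^sup>2 * real n) * real \<Delta>" using a by (simp add: algebra_simps)
    then have e: "2 * 10 ^ 8 * real (card D) \<le> \<phi>\<^sup>2 * real n" using \<Delta>1 by (simp add: mult_le_cancel_right)
    have "card (edges Gb) \<ge> m" unfolding m edges_Gb using sg_fin_edges[OF sg(1)] fin_D by (intro card_mono) auto
    moreover have "10 ^ 6 * degree Gb v \<le> m" if "v \<in> verts Gb" for v
    proof -
      have "degree G v \<le> \<Delta>" unfolding \<Delta> using that by (intro degree_le_max[OF sg(1)]) simp
      then have "degree Gb v \<le> \<Delta> + card D" using degree_Gb[of v] dd_le[of v] by linarith
      then have "real (degree Gb v) \<le> real \<Delta> + real (card D)" by linarith
      then have "1000000 * real (degree Gb v) \<le> real m" using c' dD d1 by linarith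
      then have "1000000 * degree Gb v \<le> m" by linarith
      then show ?thesis by simp
    qed
    moreover have "0 < m" using c' dD d1 by linarith
    ultimately have "conductance Gb < ereal (27 / 50)"
      by (intro conductance_small D(1)) (force intro: order.trans)+
    moreover have "100000000 * (real (card D) * real \<Delta>) \<le> \<phi> * real m" using b by simp
    then have "14 * real (card D) \<le> \<phi> * real m" using dD d1 by linarith
    ultimately show ?thesis using \<Delta>1 e by blast
  qed
  show ?thesis
  proof (cases "D = {} \<or> 27 < 50 * \<phi>")
    case True
    have "pruning_answer G D \<phi> ?r (Some {})"
    proof (cases "D = {}")
      case D: True
      have "conductance (induced G (verts G - {})) = conductance Gb"
        using induced_verts[OF sg(1)] D by (simp add: add_edges_def)
      then show ?thesis using sg(2) \<phi> r1 order.trans[of "ereal ?r" "ereal \<phi>" "conductance Gb"]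
        by (auto simp: vol_def)
    next
      case False
      then have "conductance Gb < ereal (27 / 50)" using dense by blast
      also have "\<dots> < ereal \<phi>" using True False by simp
      finally show ?thesis using sg(2) by (auto simp: not_le[symmetric])
    qed
    moreover have "(20::real) \<le> ?B" by simp
    ultimately show ?thesis
      using True s0 by (intro halt[OF wp_Prune_trivial[of s0]]) (auto simp: answer_empty conf_def)
  next
    case False
    then have ne: "D \<noteq> {}" and small: "50 * \<phi> \<le> 27" by auto
    note de = dense[OF ne]
    have d1: "1 \<le> card D" using ne fin_D by (simp add: Suc_le_eq card_gt_0_iff)
    show ?thesis
    proof (rule halt[OF wp_Prune_graph[OF M ds ne s0(1-7) \<phi>(1) s0(8) small]], elim exE conjE, intro conjI)
      fix s' :: mst and k L P
      assume k: "0 < k" "2 \<le> real k * \<phi>" "real (k - 1) * \<phi> < 2" and P: "pruned n E (degree G) dd k P"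
        and ans: "ir s' 0 = 1" "(\<lambda>i. im s' (ir s' 1 + i)) ` {..<ir s' 2} = P"
        and L: "L = 0 \<or> 2 ^ (L - 1) \<le> 4 * k * card D" and time: "tm s' \<le> 120000 * (k * k * card D * (L + 1))"
      have "real (120000 * (k * k * card D * (L + 1))) \<le> ?B"
        using de small \<phi> k L d1 by (intro running_time[OF Q _ _ \<epsilon> ratio(1)]) auto
      then show "real (tm s') \<le> ?B" using of_nat_mono[OF time, where 'a = real] by linarith
      have "real k = real (k - 1) + 1" using k(1) by simp
      then have k3: "real k * \<phi> \<le> 3" using k(3) \<phi> by (simp only: distrib_right)
      have de': "14 * real (card D) \<le> \<phi> * real (card (edges G))" using de m by simp
      note pa = pruned_answer[OF P k(1,2) k3 \<phi> de' ne]
      have "answer (conf (clen Prune) s') = Some P" using ans by (simp add: answer_def conf_def)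
      then show "pruning_answer G D \<phi> ?r (answer (conf (clen Prune) s'))"
        using pa r order.trans[of "ereal ?r" "ereal (\<phi> / 5)"] by simp
    qed
  qed
qed

theorem theoremA1:
  "\<exists>c0::real. 0 < c0 \<and>
    (\<forall>(c_size :: real \<Rightarrow> real) (c_con :: real \<Rightarrow> real) (t :: nat \<Rightarrow> real \<Rightarrow> real \<Rightarrow> real \<Rightarrow> real).
      (\<exists>Q. LBS_algorithm Q c_size c_con t) \<longrightarrow>
      (\<exists>(P :: program) (C :: real). 0 < C \<and>
        (\<forall>(G :: nat ugraph) (D :: nat set set) ds (\<alpha>b :: real) (\<epsilon> :: real) M f n m \<Delta>.
          simple_graph G \<and> verts G \<noteq> {} \<and> n = card (verts G) \<and> m = card (edges G) \<and>
          \<Delta> = max_degree G \<and>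
          0 < \<alpha>b \<and> \<alpha>b \<le> 1 \<and> 0 < \<epsilon> \<and> \<epsilon> < 1 \<and>
          simple_graph (add_edges G D) \<and> D \<inter> edges G = {} \<and>
          real (card D) \<le> c0 * (\<alpha>b\<^sup>2 * real m / real \<Delta>) \<and>
          lists_edges ds D \<and> stores M f G (flatten ds) \<longrightarrow>
          (\<exists>k s. halts_after P
                   (initial [n, m, card D, f, \<Delta>] [\<alpha>b, \<epsilon>, c_size (\<alpha>b / 2), c_con (\<alpha>b / 2)] M) k s \<and>
                 real k \<le> C * max 1
                   ((real (card D) / \<alpha>b) powr \<epsilon> * (c_size (\<alpha>b / 2) / \<epsilon>) *
                    t n (real \<Delta> * real (card D) / \<alpha>b) \<alpha>b \<alpha>b) \<and>
                 pruning_answer G D \<alpha>b (\<alpha>b / (5 * c_con (\<alpha>b / 2) powr (1 / \<epsilon> - 1)))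
                   (answer s)))))"
  apply (intro exI[of _ "1 / 10 ^ 8 :: real"] conjI allI impI)
   apply simp
  apply (elim exE)
  apply (intro exI[of _ "compile 0 Prune"] exI[of _ "10 ^ 9 :: real"] conjI allI impI)
   apply simp
  apply (elim conjE)
  apply (rule pruning_algorithm; assumption)
  done

end
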